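(* Let $G=(V,L\cup R)$ be a partitioned plane $st$-graph and let $\mathcal E$ be its planar embedding. Then $G$ admits an upward book embedding in two pages respecting $\mathcal E$ if and only if $\mathcal E$ is 4-modal and no face of $\mathcal E$ is impossible.
   Context: A partitioned digraph $G=(V,L\cup R)$ is a finite simple digraph whose edge set is partitioned into left edges $L$ and right edges $R$. A plane $st$-graph is an acyclic digraph with a single source $s$ and a single sink $t$ together with a planar embedding $\mathcal E$ in which $s$ and $t$ are on the outer face. Every face $f$ is bounded by two directed paths from a source $s_f$ to a sink $t_f$: the left path $\ell_f$ and the right path $r_f$, where the edge of $\ell_f$ at $s_f$ immediately precedes the edge of $r_f$ at $s_f$ in clockwise order around $s_f$ if $f$ is internal, and immediately follows it if $f$ is the outer face. A plane $st$-graph has a unique upward-consistent angle assignment: the only large angles are those at $s$ and $t$ in the outer face, all other switch angles are small, and non-switch angles are flat; "4-modal" refers to $\mathcal E$ with this assignment. A face $f$ is impossible if either $\ell_f$ consists only of edges in $R$ and $r_f$ is not a single edge, or $r_f$ consists only of edges in $L$ and $\ell_f$ is not a single edge. An upward book embedding is a bijection $\pi:V\to\{1,\dots,|V|\}$ with $\pi(u)<\pi(v)$ for each edge $(u,v)$ such that no two edges of the same part cross (end-vertices interleave in $\pi$). It determines a planar upward drawing: vertices on a vertical spine at height $\pi(v)$, edges of $L$ as semicircles left of the spine, edges of $R$ as semicircles right of it; the book embedding respects $\mathcal E$ if this drawing has planar embedding $\mathcal E$ (same clockwise edge orders around vertices and same outer face). A vertex $v$ is 4-modal if: when $v$ is not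 a source or sink, clockwise around $v$ come all outgoing left edges, then outgoing right edges, then incoming right edges, then incoming left edges (one of the first two and/or one of the last two sets possibly empty); when $v$ is a source (resp. sink), clockwise around $v$ come the large angle at $v$, then all outgoing left edges, then all outgoing right edges (resp. the large angle, then incoming right edges, then incoming left edges), one of the two sets possibly empty. $\mathcal E$ is 4-modal if every vertex is.
   Formalization: "No face is impossible" is proved as "no internal face is impossible"; with the outer face included the claim fails, e.g. for the path s→a→t with both edges in R, which has a respecting, 4-modal upward book embedding although its only (outer) face is impossible. *)

theory Defs
  imports "HOL-Analysis.Analysis" "HOL-Combinatorics.Orbits"
begin

section \<open>Partitioned digraphs and plane st-graphs\<close>

definition partitioned_digraph :: "'a set \<Rightarrow> 'a rel \<Rightarrow> 'a rel \<Rightarrow> bool" where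
  "partitioned_digraph V L R \<longleftrightarrow>
     finite V \<and> L \<union> R \<subseteq> V \<times> V \<and> irrefl (L \<union> R) \<and> L \<inter> R = {}"

definition is_source :: "'a rel \<Rightarrow> 'a \<Rightarrow> bool" where
  "is_source E v \<longleftrightarrow> (\<forall>u. (u, v) \<notin> E)"

definition is_sink :: "'a rel \<Rightarrow> 'a \<Rightarrow> bool" where
  "is_sink E v \<longleftrightarrow> (\<forall>w. (v, w) \<notin> E)"

text \<open>
  A planar embedding is a rotation system together with a distinguished outer face.
  The list \<open>rot v\<close> contains the neighbours of \<open>v\<close> in the clockwise order of
  the connecting edges; it is relevant only up to cyclic shifts.  In an acyclic digraph an edge is
  determined by its two end-vertices, so neighbours can stand for edges.
\<close>

definition rotation_system :: "'a set \<Rightarrow> 'a rel \<Rightarrow> ('a \<Rightarrow> 'a list) \<Rightarrow> bool" where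
  "rotation_system V E rot \<longleftrightarrow>
     (\<forall>v\<in>V. distinct (rot v) \<and> set (rot v) = {w. (v, w) \<in> E \<or> (w, v) \<in> E})"

text \<open>The cyclic successor of a member \<open>x\<close> of a distinct list.\<close>

definition cyc_next :: "'a list \<Rightarrow> 'a \<Rightarrow> 'a" where
  "cyc_next xs x = hd (tl (dropWhile (\<lambda>y. y \<noteq> x) xs @ xs))"

text \<open>
  A dart is an edge traversed in one of its two directions.  A walk that continues, after
  entering \<open>v\<close> from \<open>u\<close>, along the edge following \<open>{u, v}\<close> clockwise
  around \<open>v\<close> keeps one face on its left-hand side.  A face is identified with the set
  of darts that have it on their left.
\<close>

definition darts :: "'a rel \<Rightarrow> ('a \<times> 'a) set" where
  "darts E = E \<union> E\<inverse>"

definition face_step :: "('a \<Rightarrow> 'a list) \<Rightarrow> 'a \<times> 'a \<Rightarrow> 'a \<times> 'a" where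
  "face_step rot = (\<lambda>(u, v). (v, cyc_next (rot v) u))"

definition faces :: "'a rel \<Rightarrow> ('a \<Rightarrow> 'a list) \<Rightarrow> ('a \<times> 'a) set set" where
  "faces E rot = orbit (face_step rot) ` darts E"

text \<open>
  Planarity of the rotation system is Euler's formula for connected graphs: an acyclic digraph on a
  finite set with a single source is connected, since every vertex is reachable from the source.
\<close>

definition plane_st_graph ::
  "'a set \<Rightarrow> 'a rel \<Rightarrow> 'a \<Rightarrow> 'a \<Rightarrow> ('a \<Rightarrow> 'a list) \<Rightarrow> ('a \<times> 'a) set \<Rightarrow> bool" where
  "plane_st_graph V E s t rot outer \<longleftrightarrow>
     finite V \<and> E \<subseteq> V \<times> V \<and> acyclic E \<and>
     s \<noteq> t \<and> {v \<in> V. is_source E v} = {s} \<and> {v \<in> V. is_sink E v} = {t} \<and>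
     rotation_system V E rot \<and>
     card V + card (faces E rot) = card E + 2 \<and>
     outer \<in> faces E rot \<and> s \<in> fst ` outer \<and> t \<in> fst ` outer"

section \<open>Impossible faces\<close>

definition directed_path :: "'a rel \<Rightarrow> 'a list \<Rightarrow> bool" where
  "directed_path E p \<longleftrightarrow> 2 \<le> length p \<and> distinct p \<and> successively (\<lambda>u v. (u, v) \<in> E) p"

definition path_edges :: "'a list \<Rightarrow> 'a rel" where
  "path_edges p = set (zip p (tl p))"

text \<open>
  An internal face lies to the left of the darts traversing its right path forwards and its left
  path backwards; for the outer face the roles of the two paths are exchanged.
\<close>

definition bounding_paths ::
  "'a rel \<Rightarrow> ('a \<Rightarrow> 'a list) \<Rightarrow> ('a \<times> 'a) set \<Rightarrow> ('a \<times> 'a) set \<Rightarrow> 'a list \<Rightarrow> 'a list \<Rightarrow> bool"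
where
  "bounding_paths E rot outer f l r \<longleftrightarrow>
     directed_path E l \<and> directed_path E r \<and> hd l = hd r \<and> last l = last r \<and>
     (if f \<noteq> outer
      then f = path_edges r \<union> (path_edges l)\<inverse> \<and> cyc_next (rot (hd l)) (l ! 1) = r ! 1
      else f = path_edges l \<union> (path_edges r)\<inverse> \<and> cyc_next (rot (hd l)) (r ! 1) = l ! 1)"

definition impossible_face ::
  "'a rel \<Rightarrow> 'a rel \<Rightarrow> ('a \<Rightarrow> 'a list) \<Rightarrow> ('a \<times> 'a) set \<Rightarrow> ('a \<times> 'a) set \<Rightarrow> bool" where
  "impossible_face L R rot outer f \<longleftrightarrow>
     (\<exists>l r. bounding_paths (L \<union> R) rot outer f l r \<and>
        (path_edges l \<subseteq> R \<and> length r \<noteq> 2 \<or> path_edges r \<subseteq> L \<and> length l \<noteq> 2))"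

text \<open>
  Impossibility is an obstruction for internal faces only.  A directed path with at least two edges,
  all of them right edges, has an upward book embedding, although its only face, the outer one, is
  impossible.
\<close>

section \<open>4-modality\<close>

text \<open>
  The large angle at a source or sink \<open>v\<close> is the one in the outer face.  The edge that
  follows it clockwise is the one by which the boundary walk of the outer face leaves \<open>v\<close>.
\<close>

definition four_modal_vertex ::
  "'a rel \<Rightarrow> 'a rel \<Rightarrow> ('a \<Rightarrow> 'a list) \<Rightarrow> ('a \<times> 'a) set \<Rightarrow> 'a \<Rightarrow> bool" where
  "four_modal_vertex L R rot outer v \<longleftrightarrow>
     (\<exists>k out_l out_r in_r in_l.
        set out_l \<subseteq> {w. (v, w) \<in> L} \<and> set out_r \<subseteq> {w. (v, w) \<in> R} \<and>
        set in_r \<subseteq> {w. (w, v) \<in> R} \<and> set in_l \<subseteq> {w. (w, v) \<in> L} \<and>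
        (if is_source (L \<union> R) v
         then rotate k (rot v) = out_l @ out_r \<and> (v, hd (out_l @ out_r)) \<in> outer
         else if is_sink (L \<union> R) v
         then rotate k (rot v) = in_r @ in_l \<and> (v, hd (in_r @ in_l)) \<in> outer
         else rotate k (rot v) = out_l @ out_r @ in_r @ in_l))"

definition four_modal ::
  "'a set \<Rightarrow> 'a rel \<Rightarrow> 'a rel \<Rightarrow> ('a \<Rightarrow> 'a list) \<Rightarrow> ('a \<times> 'a) set \<Rightarrow> bool" where
  "four_modal V L R rot outer \<longleftrightarrow> (\<forall>v\<in>V. four_modal_vertex L R rot outer v)"

section \<open>Upward book embeddings and their drawings\<close>

definition crossing :: "('a \<Rightarrow> nat) \<Rightarrow> 'a \<times> 'a \<Rightarrow> 'a \<times> 'a \<Rightarrow> bool" where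
  "crossing \<pi> = (\<lambda>(a, b) (c, d).
     \<pi> a < \<pi> c \<and> \<pi> c < \<pi> b \<and> \<pi> b < \<pi> d \<or> \<pi> c < \<pi> a \<and> \<pi> a < \<pi> d \<and> \<pi> d < \<pi> b)"

definition upward_book_embedding ::
  "'a set \<Rightarrow> 'a rel \<Rightarrow> 'a rel \<Rightarrow> ('a \<Rightarrow> nat) \<Rightarrow> bool" where
  "upward_book_embedding V L R \<pi> \<longleftrightarrow>
     bij_betw \<pi> V {1..card V} \<and> (\<forall>(u, v) \<in> L \<union> R. \<pi> u < \<pi> v) \<and>
     (\<forall>e\<in>L. \<forall>e'\<in>L. \<not> crossing \<pi> e e') \<and> (\<forall>e\<in>R. \<forall>e'\<in>R. \<not> crossing \<pi> e e')"

text \<open>The plane is the complex plane and the spine is the imaginary axis.\<close>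

definition spine_point :: "('a \<Rightarrow> nat) \<Rightarrow> 'a \<Rightarrow> complex" where
  "spine_point \<pi> v = Complex 0 (real (\<pi> v))"

definition left_edge :: "'a rel \<Rightarrow> 'a \<Rightarrow> 'a \<Rightarrow> bool" where
  "left_edge L u v \<longleftrightarrow> (u, v) \<in> L \<or> (v, u) \<in> L"

definition edge_arc :: "('a \<Rightarrow> nat) \<Rightarrow> 'a rel \<Rightarrow> 'a \<Rightarrow> 'a \<Rightarrow> complex set" where
  "edge_arc \<pi> L u v =
     sphere (midpoint (spine_point \<pi> u) (spine_point \<pi> v))
            (dist (spine_point \<pi> u) (spine_point \<pi> v) / 2)
     \<inter> (if left_edge L u v then {z. Re z \<le> 0} else {z. 0 \<le> Re z})"

definition edge_apex :: "('a \<Rightarrow> nat) \<Rightarrow> 'a rel \<Rightarrow> 'a \<Rightarrow> 'a \<Rightarrow> complex" where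
  "edge_apex \<pi> L u v =
     midpoint (spine_point \<pi> u) (spine_point \<pi> v)
     + (if left_edge L u v then - 1 else 1)
       * of_real (dist (spine_point \<pi> u) (spine_point \<pi> v) / 2)"

definition book_drawing :: "'a set \<Rightarrow> 'a rel \<Rightarrow> 'a rel \<Rightarrow> ('a \<Rightarrow> nat) \<Rightarrow> complex set" where
  "book_drawing V L R \<pi> = spine_point \<pi> ` V \<union> (\<Union>(u, v)\<in>L \<union> R. edge_arc \<pi> L u v)"

text \<open>
  The curves \<open>A x\<close>, for \<open>x\<close> in the list \<open>xs\<close>, leave the point
  \<open>c\<close> in the clockwise cyclic order given by \<open>xs\<close>: every sufficiently small
  circle around \<open>c\<close> meets each curve exactly once, and clockwise around the circle the
  intersection points have this order.  (Polar angles increase counterclockwise.)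
\<close>

definition clockwise_around :: "complex \<Rightarrow> ('b \<Rightarrow> complex set) \<Rightarrow> 'b list \<Rightarrow> bool" where
  "clockwise_around c A xs \<longleftrightarrow>
     (\<forall>\<^sub>F \<epsilon> in at_right (0::real). \<exists>p k.
        (\<forall>x\<in>set xs. A x \<inter> sphere c \<epsilon> = {p x}) \<and>
        sorted_wrt (\<lambda>x y. Arg2pi (p x - c) > Arg2pi (p y - c)) (rotate k xs))"

text \<open>
  The region to the left of a drawn dart: at its apex a semicircle has a vertical tangent, so the
  points just left of the dart are those west of the apex if the dart leads upwards and those east
  of the apex if it leads downwards.  A face of the rotation system is the outer face of the
  drawing if the region to the left of its darts is the unbounded one.
\<close>

definition left_region_unbounded ::
  "'a set \<Rightarrow> 'a rel \<Rightarrow> 'a rel \<Rightarrow> ('a \<Rightarrow> nat) \<Rightarrow> 'a \<times> 'a \<Rightarrow> bool" where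
  "left_region_unbounded V L R \<pi> = (\<lambda>(u, v).
     \<forall>\<^sub>F \<delta> in at_right (0::real).
       edge_apex \<pi> L u v - of_real (sgn (real (\<pi> v) - real (\<pi> u)) * \<delta>)
         \<in> outside (book_drawing V L R \<pi>))"

definition respects_embedding ::
  "'a set \<Rightarrow> 'a rel \<Rightarrow> 'a rel \<Rightarrow> ('a \<Rightarrow> 'a list) \<Rightarrow> ('a \<times> 'a) set \<Rightarrow> ('a \<Rightarrow> nat) \<Rightarrow> bool" where
  "respects_embedding V L R rot outer \<pi> \<longleftrightarrow>
     (\<forall>v\<in>V. clockwise_around (spine_point \<pi> v) (edge_arc \<pi> L v) (rot v)) \<and>
     (\<forall>d\<in>outer. left_region_unbounded V L R \<pi> d)"

end

theory Submission
  imports Defs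
begin

text \<open>
  Necessity of 4-modality is read off the polar angles at which the semicircles leave a vertex.  The
  large angles at the source and the sink are in the outer face because a point of the plane that has
  drawing both to its west and to its east is separated from infinity.  An impossible face would
  contain two crossing edges.

  For sufficiency, bimodality and Euler's formula imply that every face has exactly one source switch
  and one sink switch, so it is bounded by two directed paths.  Then the edges that leave a downset
  of vertices are ordered from left to right such that neighbouring edges share a face.  In a face
  that is not impossible the vertices of the two bounding paths can be merged into one sequence in
  which no vertex of the right path lies between the ends of a right edge of the left path, and
  symmetrically.
  These sequences are jointly acyclic: if a downset respects all of them, then the edges leaving it
  are left edges followed by right edges, and the head of one of the two edges next to the change can
  be added.  Any linear order that respects all of them is the required book embedding.
\<close>

section \<open>Consecutive members of a list\<close>

text \<open>The orders demanded by different faces overlap in many vertices, so their union could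
  contain a cycle that no single face shows. Cycles are never analysed: for every initial segment a
  vertex that may come next is exhibited, and the linear order is built from below. The
  combinatorics of cuts takes place in a locale that knows only the faces \<open>lf\<close> and
  \<open>rf\<close> to the left and right of an edge and, for every vertex, its incoming and
  outgoing edges from left to right. Hence reflection in the spine is an instance of the locale, and
  a claim about left edges yields the one about right edges; reversing all edges plays the same part
  for the faces of the rotation system. The cut of an initial segment of the final order is the
  sequence of edges that a horizontal line meets, so the structure that finds the next vertex also
  shows that the edges of one page are nested and locates the edges next to the outer face. Geometry
  enters in two places only: the order in which semicircles leave a vertex becomes a comparison of
  integers, and membership in the unbounded region is decided by looking along horizontal
  lines.\<close>

lemma path_edges_simps [simp]:
  "path_edges [] = {}" "path_edges [x] = {}"
  "path_edges (x # y # xs) = insert (x, y) (path_edges (y # xs))"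
  by (auto simp: path_edges_def)

lemma path_edges_append:
  "path_edges (xs @ ys) =
    path_edges xs \<union> path_edges ys \<union> (if xs = [] \<or> ys = [] then {} else {(last xs, hd ys)})"
  by (induction xs rule: induct_list012) (auto simp: neq_Nil_conv)

lemma path_edges_iff: "(a, b) \<in> path_edges p \<longleftrightarrow> (\<exists>xs ys. p = xs @ a # b # ys)"
proof
  assume "(a, b) \<in> path_edges p"
  then show "\<exists>xs ys. p = xs @ a # b # ys"
  proof (induction p rule: induct_list012)
    case (3 x y p)
    show ?case
    proof (cases "(a, b) = (x, y)")
      case False
      then obtain xs ys where "y # p = xs @ a # b # ys" using 3 by auto
      then have "x # y # p = (x # xs) @ a # b # ys" by simp
      then show ?thesis by blast
    qed auto
  qed auto
qed (auto simp: path_edges_append)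

lemma successively_iff_path_edges: "successively P xs \<longleftrightarrow> (\<forall>(x, y) \<in> path_edges xs. P x y)"
  by (induction xs rule: induct_list012) auto

lemma path_edges_rev: "path_edges (rev xs) = (path_edges xs)\<inverse>"
proof -
  have "(a, b) \<in> path_edges (rev xs) \<longleftrightarrow> (b, a) \<in> path_edges xs" for a b
    unfolding path_edges_iff
  proof
    assume "\<exists>us ys. rev xs = us @ a # b # ys"
    then obtain us ys where "rev xs = us @ a # b # ys" by blast
    then have "xs = rev ys @ b # a # rev us" by (metis append.assoc append_Cons append_Nil rev.simps(2) rev_append rev_rev_ident)
    then show "\<exists>xsa ys. xs = xsa @ b # a # ys" by blast
  next
    assume "\<exists>us ys. xs = us @ b # a # ys"
    then show "\<exists>us ys. rev xs = us @ a # b # ys" by force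
  qed
  then show ?thesis by auto
qed

lemma path_edges_set: "(a, b) \<in> path_edges p \<Longrightarrow> a \<in> set p \<and> b \<in> set p"
  by (auto simp: path_edges_iff)

lemma path_edges_out: "distinct p \<Longrightarrow> (a, b) \<in> path_edges p \<Longrightarrow> (a, b') \<in> path_edges p \<Longrightarrow> b = b'"
  by (induction p rule: induct_list012) (auto dest: path_edges_set)

lemma path_edges_in:
  "distinct p \<Longrightarrow> (a, b) \<in> path_edges p \<Longrightarrow> (a', b) \<in> path_edges p \<Longrightarrow> a = a'"
  using path_edges_out[of "rev p" b a a'] by (auto simp: path_edges_rev)

lemma path_edges_last: "distinct p \<Longrightarrow> (last p, b) \<notin> path_edges p"
  by (induction p rule: induct_list012) (auto dest: path_edges_set)

lemma path_edges_hd: "distinct p \<Longrightarrow> (a, hd p) \<notin> path_edges p"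
  using path_edges_last[of "rev p" a] by (auto simp: path_edges_rev last_rev)

lemma path_edges_next: "x \<in> set p \<Longrightarrow> x \<noteq> last p \<Longrightarrow> \<exists>y. (x, y) \<in> path_edges p"
  by (induction p rule: induct_list012) auto

lemma path_edges_prev: "x \<in> set p \<Longrightarrow> x \<noteq> hd p \<Longrightarrow> \<exists>y. (y, x) \<in> path_edges p"
  using path_edges_next[of x "rev p"] by (auto simp: path_edges_rev last_rev)

lemma path_edges_nth1: "2 \<le> length p \<Longrightarrow> (hd p, p ! 1) \<in> path_edges p"
  by (cases p rule: remdups_adj.cases) auto

lemma sorted_wrt_path_edges:
  assumes "\<And>a b. (a, b) \<in> path_edges p \<Longrightarrow> f a < (f b :: 'b :: preorder)"
  shows "sorted_wrt (\<lambda>a b. f a < f b) p"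
proof -
  have "transp (\<lambda>a b. f a < f b)" by (auto intro!: transpI intro: less_trans)
  moreover have "successively (\<lambda>a b. f a < f b) p" using assms by (auto simp: successively_iff_path_edges)
  ultimately show ?thesis by (simp add: successively_conv_sorted_wrt)
qed

text \<open>Going backwards through \<open>zs\<close>: once the tail is a block of \<open>C\<close>,
  this block is preceded by \<open>x\<close>, because \<open>y\<close> has only one predecessor in a
  distinct list.\<close>

lemma contiguous_sublist:
  assumes "zs \<noteq> []" "set zs \<subseteq> set C"
    and "\<And>x y. (x, y) \<in> path_edges zs \<Longrightarrow> (x, y) \<in> path_edges C" and "distinct C"
  shows "\<exists>X Y. C = X @ zs @ Y"
  using assms
proof (induction zs rule: induct_list012)
  case (2 x) then show ?case by (auto dest: split_list)
next
  case (3 x y zs)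
  then obtain X Y where C: "C = X @ (y # zs) @ Y" by auto
  have "(x, y) \<in> path_edges C" using 3 by auto
  then obtain X' Y' where C': "C = X' @ x # y # Y'" unfolding path_edges_iff by blast
  have "y \<notin> set X" "y \<notin> set (zs @ Y)" "X @ y # (zs @ Y) = (X' @ [x]) @ y # Y'"
    using C C' \<open>distinct C\<close> by auto
  then have "X = X' @ [x]" using append_Cons_eq_iff[of y X "zs @ Y" "X' @ [x]" Y'] by simp
  then show ?case using C by auto
qed simp

section \<open>Directed paths in acyclic graphs\<close>

lemma path_linear:
  assumes "path_edges p \<subseteq> E" "x \<in> set p" "y \<in> set p"
  shows "(x, y) \<in> E\<^sup>* \<or> (y, x) \<in> E\<^sup>*"
  using assms
proof (induction p arbitrary: x y rule: induct_list012)
  case (3 a b p)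
  have *: "(b, z) \<in> E\<^sup>*" if "z \<in> set (b # p)" for z
  proof -
    have "path_edges (b # p) \<subseteq> E" using 3(3) by auto
    then show ?thesis using that
      by (induction p arbitrary: b)
        (auto simp: r_into_rtrancl intro: converse_rtrancl_into_rtrancl)
  qed
  have "(a, z) \<in> E\<^sup>*" if "z \<in> set (a # b # p)" for z
    using * that 3(3) by (auto intro: converse_rtrancl_into_rtrancl)
  then show ?case using 3 by auto
qed auto

lemma path_edge_split:
  assumes "path_edges p \<subseteq> E" "(c, d) \<in> path_edges p" "x \<in> set p"
  shows "(x, c) \<in> E\<^sup>* \<or> (d, x) \<in> E\<^sup>*"
proof -
  obtain xs ys where p: "p = xs @ c # d # ys" using assms(2) by (auto simp: path_edges_iff)
  have 1: "path_edges (xs @ [c]) \<subseteq> E" "path_edges (d # ys) \<subseteq> E"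
    using assms(1) unfolding p by (auto simp: path_edges_append)
  have R: "(d, x) \<in> E\<^sup>*" if "x \<in> set (d # ys)" "path_edges (d # ys) \<subseteq> E" for d x ys and E :: "'a rel"
    using that
    by (induction ys arbitrary: d)
      (auto simp: r_into_rtrancl intro: converse_rtrancl_into_rtrancl)
  show ?thesis
  proof (cases "x \<in> set (d # ys)")
    case True then show ?thesis using R 1 by blast
  next
    case False
    then have "x \<in> set (c # rev xs)" using assms(3) p by auto
    \<comment> \<open>A vertex at or before \<open>c\<close> is handled by the same induction, on
      the reversed prefix and in the converse relation.\<close>
    moreover have "path_edges (c # rev xs) \<subseteq> E\<inverse>"
      using 1(1) path_edges_rev[of "xs @ [c]"] by auto
    ultimately have "(c, x) \<in> (E\<inverse>)\<^sup>*" using R by blast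
    then show ?thesis by (simp add: rtrancl_converse)
  qed
qed

lemma acyclic_antisym: "acyclic E \<Longrightarrow> (x, y) \<in> E\<^sup>* \<Longrightarrow> (y, x) \<in> E\<^sup>* \<Longrightarrow> x = y"
  by (metis acyclic_impl_antisym_rtrancl antisymD)

lemma directed_path_edges: "directed_path E p \<Longrightarrow> path_edges p \<subseteq> E"
  by (auto simp: directed_path_def successively_iff_path_edges)

text \<open>The tail of either edge is in the downset and the head of the other is not, so neither
  tail lies beyond the other edge. Each tail thus reaches the other, and acyclicity makes them
  equal.\<close>

lemma path_crosses_once:
  assumes "acyclic E" "directed_path E p" and D: "\<And>u v. (u, v) \<in> E \<Longrightarrow> v \<in> D \<Longrightarrow> u \<in> D"
    and "(a, b) \<in> path_edges p" "(c, d) \<in> path_edges p" "a \<in> D" "b \<notin> D" "c \<in> D" "d \<notin> D"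
  shows "a = c" "b = d"
proof -
  have down: "x \<in> D" if "(x, y) \<in> E\<^sup>*" "y \<in> D" for x y
    using that by (induction rule: converse_rtrancl_induct) (auto intro: D)
  have E: "path_edges p \<subseteq> E" using assms(2) by (rule directed_path_edges)
  have "(a, c) \<in> E\<^sup>*" using path_edge_split[OF E assms(5), of a] assms(4,6,9) down path_edges_set by metis
  moreover have "(c, a) \<in> E\<^sup>*" using path_edge_split[OF E assms(4), of c] assms(5,8,7) down path_edges_set by metis
  ultimately show "a = c" using assms(1) acyclic_antisym by metis
  then show "b = d" using assms(2,4,5) path_edges_out unfolding directed_path_def by metis
qed

section \<open>Faces of an st-graph with a left-to-right order\<close>

text \<open>An upward plane drawing without coordinates. \<open>ins\<close> and \<open>outs\<close>
  list the neighbours from left to right; neighbouring edges of one list enclose the sink angle or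
  the source angle of an inner face, and the flat angles \<open>flat_l\<close> and
  \<open>flat_r\<close> link the two lists. \<open>ins_adj\<close> and \<open>outs_adj\<close>
  mention only the ends of \<open>lp\<close>, since \<open>face\<close> makes them the ends of
  \<open>rp\<close> as well.\<close>

locale st_faces =
  fixes V :: "'a set" and E L R :: "'a rel" and s t :: 'a
    and ins outs :: "'a \<Rightarrow> 'a list" and lf rf :: "'a \<times> 'a \<Rightarrow> 'f" and outer :: 'f
    and lp rp :: "'f \<Rightarrow> 'a list"
  assumes finV: "finite V" and E_eq: "E = L \<union> R" and LR: "L \<inter> R = {}"
    and EV: "E \<subseteq> V \<times> V" and acyc: "acyclic E"
    and sV: "s \<in> V" and tV: "t \<in> V" and st: "s \<noteq> t"
    and ins_set: "v \<in> V \<Longrightarrow> set (ins v) = {u. (u, v) \<in> E}" and ins_dist: "v \<in> V \<Longrightarrow> distinct (ins v)"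
    and outs_set: "v \<in> V \<Longrightarrow> set (outs v) = {w. (v, w) \<in> E}" and outs_dist: "v \<in> V \<Longrightarrow> distinct (outs v)"
    and ins_Nil: "v \<in> V \<Longrightarrow> ins v = [] \<longleftrightarrow> v = s"
    and outs_Nil: "v \<in> V \<Longrightarrow> outs v = [] \<longleftrightarrow> v = t"
    and ins_adj: "v \<in> V \<Longrightarrow> (x, y) \<in> path_edges (ins v) \<Longrightarrow>
      rf (x, v) = lf (y, v) \<and> rf (x, v) \<noteq> outer \<and> last (lp (rf (x, v))) = v"
    and outs_adj: "v \<in> V \<Longrightarrow> (x, y) \<in> path_edges (outs v) \<Longrightarrow>
      rf (v, x) = lf (v, y) \<and> rf (v, x) \<noteq> outer \<and> hd (lp (rf (v, x))) = v"
    and flat_l: "v \<in> V \<Longrightarrow> v \<noteq> s \<Longrightarrow> v \<noteq> t \<Longrightarrow> lf (hd (ins v), v) = lf (v, hd (outs v))"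
    and flat_r: "v \<in> V \<Longrightarrow> v \<noteq> s \<Longrightarrow> v \<noteq> t \<Longrightarrow> rf (last (ins v), v) = rf (v, last (outs v))"
    and s_outer: "lf (s, hd (outs s)) = outer" "rf (s, last (outs s)) = outer"
    and t_outer: "lf (hd (ins t), t) = outer" "rf (last (ins t), t) = outer"
    and face: "f \<in> lf ` E \<union> rf ` E \<Longrightarrow> f \<noteq> outer \<Longrightarrow>
      directed_path E (lp f) \<and> directed_path E (rp f) \<and>
      hd (lp f) = hd (rp f) \<and> last (lp f) = last (rp f) \<and>
      path_edges (lp f) = {e \<in> E. rf e = f} \<and> path_edges (rp f) = {e \<in> E. lf e = f}"
    and ins_modal: "v \<in> V \<Longrightarrow> sorted_wrt (\<lambda>x y. (x, v) \<in> R \<longrightarrow> (y, v) \<in> R) (ins v)"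
    and outs_modal: "v \<in> V \<Longrightarrow> sorted_wrt (\<lambda>x y. (v, x) \<in> R \<longrightarrow> (v, y) \<in> R) (outs v)"
begin

definition inner :: "'f set" where "inner = (lf ` E \<union> rf ` E) - {outer}"

lemma inner_path:
  assumes "f \<in> inner"
  shows "directed_path E (lp f)" "directed_path E (rp f)" "hd (lp f) = hd (rp f)" "last (lp f) = last (rp f)"
    "path_edges (lp f) = {e \<in> E. rf e = f}" "path_edges (rp f) = {e \<in> E. lf e = f}"
    "distinct (lp f)" "distinct (rp f)" "lp f \<noteq> []" "rp f \<noteq> []"
  using assms face[of f] unfolding inner_def directed_path_def by auto

text \<open>Reflection in the spine.\<close>

lemma mirror: "st_faces V E R L s t (\<lambda>v. rev (ins v)) (\<lambda>v. rev (outs v)) rf lf outer rp lp"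
proof
  fix v x y assume v: "v \<in> V"
  show "sorted_wrt (\<lambda>x y. (x, v) \<in> L \<longrightarrow> (y, v) \<in> L) (rev (ins v))"
    unfolding sorted_wrt_rev
    by (rule sorted_wrt_mono_rel[OF _ ins_modal[OF v]]) (use ins_set[OF v] E_eq LR in auto)
  show "sorted_wrt (\<lambda>x y. (v, x) \<in> L \<longrightarrow> (v, y) \<in> L) (rev (outs v))"
    unfolding sorted_wrt_rev
    by (rule sorted_wrt_mono_rel[OF _ outs_modal[OF v]]) (use outs_set[OF v] E_eq LR in auto)
  show "lf (x, v) = rf (y, v) \<and> lf (x, v) \<noteq> outer \<and> last (rp (lf (x, v))) = v"
    if "(x, y) \<in> path_edges (rev (ins v))"
  proof -
    have *: "(y, x) \<in> path_edges (ins v)" using that by (auto simp: path_edges_rev)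
    moreover have "(y, v) \<in> E" using * path_edges_set[OF *] ins_set[OF v] by auto
    ultimately show ?thesis using ins_adj[OF v *] face[OF UnI2[OF imageI], of "(y, v)"] by auto
  qed
  show "lf (v, x) = rf (v, y) \<and> lf (v, x) \<noteq> outer \<and> hd (rp (lf (v, x))) = v"
    if "(x, y) \<in> path_edges (rev (outs v))"
  proof -
    have *: "(y, x) \<in> path_edges (outs v)" using that by (auto simp: path_edges_rev)
    moreover have "(v, y) \<in> E" using * path_edges_set[OF *] outs_set[OF v] by auto
    ultimately show ?thesis using outs_adj[OF v *] face[OF UnI2[OF imageI], of "(v, y)"] by auto
  qed
qed (use finV LR EV acyc sV tV st ins_set ins_dist outs_set outs_dist ins_Nil outs_Nil flat_l flat_r
    s_outer t_outer E_eq face in \<open>auto simp: hd_rev last_rev\<close>)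

section \<open>Downsets and the left-to-right order of the edges leaving them\<close>

definition downset :: "'a set \<Rightarrow> bool" where
  "downset D \<longleftrightarrow> D \<subseteq> V \<and> s \<in> D \<and> t \<notin> D \<and> (\<forall>(u, v) \<in> E. v \<in> D \<longrightarrow> u \<in> D)"

text \<open>The left-to-right order of the edges that leave a downset: neighbouring edges bound a common
  inner face.\<close>

definition cut :: "'a set \<Rightarrow> ('a \<times> 'a) list \<Rightarrow> bool" where
  "cut D C \<longleftrightarrow> distinct C \<and> set C = {(u, v) \<in> E. u \<in> D \<and> v \<notin> D} \<and> C \<noteq> [] \<and>
     (\<forall>(e, e') \<in> path_edges C. rf e = lf e' \<and> rf e \<noteq> outer) \<and> lf (hd C) = outer \<and> rf (last C) = outer"

lemma cut_mem: "cut D C \<Longrightarrow> e \<in> set C \<longleftrightarrow> e \<in> E \<and> fst e \<in> D \<and> snd e \<notin> D"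
  by (auto simp: cut_def)

lemma innerI: "e \<in> E \<Longrightarrow> rf e = f \<or> lf e = f \<Longrightarrow> f \<noteq> outer \<Longrightarrow> f \<in> inner"
  by (auto simp: inner_def)

text \<open>Each bounding path of an inner face leaves a downset at most once, so a cut has at most
  one edge with a given inner face on its left and at most one with it on its right.\<close>

lemma cut_unique:
  assumes "downset D" "f \<noteq> outer" "e \<in> E" "e' \<in> E" "lf e = f \<and> lf e' = f \<or> rf e = f \<and> rf e' = f"
    "fst e \<in> D" "snd e \<notin> D" "fst e' \<in> D" "snd e' \<notin> D"
  shows "e = e'"
proof -
  have f: "f \<in> inner" using assms by (auto intro: innerI)
  note p = inner_path[OF f]
  obtain p where "directed_path E p" "e \<in> path_edges p" "e' \<in> path_edges p"
    using assms(3-5) p by blast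
  moreover have "\<And>u v. (u, v) \<in> E \<Longrightarrow> v \<in> D \<Longrightarrow> u \<in> D" using assms(1) by (auto simp: downset_def)
  ultimately show ?thesis
    using path_crosses_once[OF acyc, of p D "fst e" "snd e" "fst e'" "snd e'"] assms(6-9)
    by (cases e; cases e') simp
qed

text \<open>If \<open>x\<close> and \<open>y\<close> are neighbouring edges into \<open>v\<close>,
  the edge that follows \<open>x\<close> in the cut has the same inner face on its left as
  \<open>y\<close> and is equal to \<open>y\<close> by \<open>cut_unique\<close>. There is a
  following edge because the last one has the outer face on its right.\<close>

lemma cut_step:
  assumes D: "downset D" and C: "cut D C" and v: "v \<in> V" "v \<notin> D" and pre: "\<And>u. (u, v) \<in> E \<Longrightarrow> u \<in> D"
  shows "\<exists>X Y. C = X @ map (\<lambda>u. (u, v)) (ins v) @ Y"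
proof (rule contiguous_sublist)
  have vs: "v \<noteq> s" using D v by (auto simp: downset_def)
  show "map (\<lambda>u. (u, v)) (ins v) \<noteq> []" using vs v ins_Nil by simp
  show "distinct C" using C by (simp add: cut_def)
  show sub: "set (map (\<lambda>u. (u, v)) (ins v)) \<subseteq> set C"
    using ins_set[OF v(1)] pre v C by (auto simp: cut_def)
  fix x y assume xy: "(x, y) \<in> path_edges (map (\<lambda>u. (u, v)) (ins v))"
  then obtain a b where ab: "x = (a, v)" "y = (b, v)" "(a, b) \<in> path_edges (ins v)"
    by (auto simp: path_edges_def zip_map_map simp flip: map_tl)
  have adj: "rf x = lf y" "rf x \<noteq> outer" using ins_adj[OF v(1) ab(3)] ab by auto
  have xy_in: "x \<in> set C" "y \<in> set C" using path_edges_set[OF xy] sub by auto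
  have "x \<noteq> last C" using adj C by (auto simp: cut_def)
  then obtain z where z: "(x, z) \<in> path_edges C" using path_edges_next xy_in by metis
  then have "z \<in> set C" using path_edges_set by metis
  moreover have "lf z = rf x" using C z by (auto simp: cut_def)
  ultimately have "z = y" using cut_unique[OF D, of "rf x" z y] adj xy_in C
    by (simp add: cut_mem)
  then show "(x, y) \<in> path_edges C" using z by simp
qed

text \<open>The cut is swept over \<open>v\<close>: the block of edges into \<open>v\<close> is
  exchanged for the block of edges out of \<open>v\<close>. The flat angles at \<open>v\<close> give
  both blocks the same faces at their ends, so the adjacencies with \<open>X\<close> and
  \<open>Y\<close> survive.\<close>

lemma cut_insert:
  assumes D: "downset D" and C: "cut D (X @ map (\<lambda>u. (u, v)) (ins v) @ Y)"
    and v: "v \<in> V" "v \<notin> D" "v \<noteq> t" and pre: "\<And>u. (u, v) \<in> E \<Longrightarrow> u \<in> D"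
  shows "cut (insert v D) (X @ map (Pair v) (outs v) @ Y)"
proof -
  have vs: "v \<noteq> s" using D v by (auto simp: downset_def)
  have ne: "ins v \<noteq> []" "outs v \<noteq> []" using vs v ins_Nil outs_Nil by auto
  have out: "w \<notin> insert v D" if "(v, w) \<in> E" for w
    using that D v acyc by (auto simp: downset_def acyclic_def)
  let ?I = "map (\<lambda>u. (u, v)) (ins v)" and ?O = "map (Pair v) (outs v)"
  have I: "set ?I = {(u, w) \<in> E. w = v}" and O: "set ?O = {(u, w) \<in> E. u = v}"
    using ins_set outs_set v by auto
  have dis: "distinct (X @ ?I @ Y)" using C by (simp add: cut_def)
  have set1: "set X \<union> set ?I \<union> set Y = {(u, v) \<in> E. u \<in> D \<and> v \<notin> D}" using C by (auto simp: cut_def)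
  have XY: "set X \<union> set Y = {(u, w) \<in> E. u \<in> D \<and> w \<notin> D \<and> w \<noteq> v}"
  proof -
    have "set X \<union> set Y = (set X \<union> set ?I \<union> set Y) - set ?I" using dis unfolding distinct_append by auto
    then show ?thesis unfolding set1 unfolding I by auto
  qed
  have hdl: "lf (hd ?I) = lf (hd ?O)" "rf (last ?I) = rf (last ?O)"
    using flat_l[of v] flat_r[of v] v vs ne by (auto simp: hd_map last_map)
  have adjO: "\<forall>(e, e') \<in> path_edges ?O. rf e = lf e' \<and> rf e \<noteq> outer"
    using outs_adj[OF v(1)] by (auto simp: path_edges_def zip_map_map simp flip: map_tl)
  have adj: "\<forall>(e, e') \<in> path_edges (X @ ?I @ Y). rf e = lf e' \<and> rf e \<noteq> outer"
    using C by (auto simp: cut_def)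
  have ends: "lf (hd (X @ ?I @ Y)) = outer" "rf (last (X @ ?I @ Y)) = outer" using C by (auto simp: cut_def)
  have "distinct ?O" using outs_dist v by (simp add: distinct_map inj_on_def)
  moreover have "set ?O \<inter> (set X \<union> set Y) = {}" using O XY v by auto
  ultimately have "distinct (X @ ?O @ Y)" using dis by auto
  moreover have "set (X @ ?O @ Y) = {(u, w) \<in> E. u \<in> insert v D \<and> w \<notin> insert v D}"
  proof -
    have "set (X @ ?O @ Y) = (set X \<union> set Y) \<union> set ?O" by auto
    then show ?thesis unfolding XY O using out pre v by auto
  qed
  moreover have "\<forall>(e, e') \<in> path_edges (X @ ?O @ Y). rf e = lf e' \<and> rf e \<noteq> outer"
    using adj adjO hdl ne unfolding path_edges_append by (auto split: if_splits)
  moreover have "lf (hd (X @ ?O @ Y)) = outer" "rf (last (X @ ?O @ Y)) = outer"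
    using ends hdl ne by (auto simp: hd_append last_append split: if_splits)
  ultimately show ?thesis using ne by (simp add: cut_def)
qed

lemma ex_maximal:
  assumes "D \<subseteq> V" "D \<noteq> {}"
  shows "\<exists>v \<in> D. \<forall>w. (v, w) \<in> E \<longrightarrow> w \<notin> D"
proof -
  have "finite E" using finV EV finite_subset by blast
  then have "wf (E\<inverse>)" using acyc by (rule finite_acyclic_wf_converse)
  then show ?thesis using assms(2) unfolding wf_eq_minimal by (metis converse_iff ex_in_conv)
qed

lemma reach_t: "v \<in> V \<Longrightarrow> (v, t) \<in> E\<^sup>*"
proof (rule ccontr)
  assume v: "v \<in> V" "(v, t) \<notin> E\<^sup>*"
  let ?D = "{w \<in> V. (w, t) \<notin> E\<^sup>*}"
  obtain w where w: "w \<in> ?D" "\<forall>x. (w, x) \<in> E \<longrightarrow> x \<notin> ?D"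
    using ex_maximal[of ?D] v by auto
  then have "outs w \<noteq> []" using outs_Nil by auto
  then obtain x where "(w, x) \<in> E" using outs_set w by (metis (mono_tags) mem_Collect_eq list.set_sel(1))
  then show False using w EV by (auto intro: converse_rtrancl_into_rtrancl)
qed

text \<open>Induction on the size of the downset: a maximal vertex is taken away, and the cut of the
  rest is swept over it. The start is \<open>{s}\<close>, whose cut is
  \<open>outs s\<close>.\<close>

lemma ex_cut: "downset D \<Longrightarrow> \<exists>C. cut D C"
proof (induction "card D" arbitrary: D)
  case 0
  then have "finite D" "s \<in> D" using finV finite_subset by (auto simp: downset_def)
  then show ?case using 0 by auto
next
  case (Suc k)
  show ?case
  proof (cases "D = {s}")
    case True
    have "cut D (map (Pair s) (outs s))" unfolding cut_def
    proof (intro conjI)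
      show "distinct (map (Pair s) (outs s))" using outs_dist sV by (simp add: distinct_map inj_on_def)
      have "(s, s) \<notin> E" using acyc by (auto simp: acyclic_def)
      then show "set (map (Pair s) (outs s)) = {(u, v) \<in> E. u \<in> D \<and> v \<notin> D}"
        using True outs_set sV by auto
      show "\<forall>(e, e') \<in> path_edges (map (Pair s) (outs s)). rf e = lf e' \<and> rf e \<noteq> outer"
        using outs_adj[OF sV] by (auto simp: path_edges_def zip_map_map simp flip: map_tl)
      show ne: "map (Pair s) (outs s) \<noteq> []" using st sV outs_Nil by simp
      show "lf (hd (map (Pair s) (outs s))) = outer" "rf (last (map (Pair s) (outs s))) = outer"
        using s_outer ne by (auto simp: hd_map last_map)
    qed
    then show ?thesis by blast
  next
    case False
    have D: "D \<subseteq> V" "s \<in> D" "t \<notin> D" "\<And>u v. (u, v) \<in> E \<Longrightarrow> v \<in> D \<Longrightarrow> u \<in> D"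
      using Suc(3) by (auto simp: downset_def)
    obtain v where v: "v \<in> D - {s}" "\<forall>w. (v, w) \<in> E \<longrightarrow> w \<notin> D - {s}"
      using ex_maximal[of "D - {s}"] False D by blast
    \<comment> \<open>Maximality was chosen within \<open>D - {s}\<close> only, so an edge from
      \<open>v\<close> back to \<open>s\<close> has to be excluded separately.\<close>
    have "(v, s) \<notin> E" using ins_Nil[OF sV] ins_set[OF sV] by auto
    then have vD: "\<And>w. (v, w) \<in> E \<Longrightarrow> w \<notin> D" using v by auto
    have D': "downset (D - {v})" using D v vD unfolding downset_def by blast
    have "card (D - {v}) = k" using Suc(2) v by auto
    then obtain C where C: "cut (D - {v}) C" using Suc(1)[of "D - {v}"] D' by auto
    have vV: "v \<in> V" "v \<notin> D - {v}" "v \<noteq> t" using v D by auto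
    have pre: "\<And>u. (u, v) \<in> E \<Longrightarrow> u \<in> D - {v}" using D v acyc by (auto simp: acyclic_def)
    obtain X Y where "C = X @ map (\<lambda>u. (u, v)) (ins v) @ Y" using cut_step[OF D' C vV(1,2) pre] by blast
    then have "cut (insert v (D - {v})) (X @ map (Pair v) (outs v) @ Y)"
      using cut_insert[OF D' _ vV pre] C by blast
    then show ?thesis using v by (auto simp: insert_absorb)
  qed
qed

lemma acyc_rtrancl: "(x, y) \<in> E \<Longrightarrow> (y, x) \<notin> E\<^sup>*"
  using acyc by (auto simp: acyclic_def dest: rtrancl_into_trancl2)

text \<open>The two bounding paths of an inner face share only their ends: otherwise the cut right
  below a common inner vertex would meet the left path of the face twice.\<close>

lemma face_paths_disjoint:
  assumes f: "f \<noteq> outer" and e: "(a, x) \<in> E" "(x, b) \<in> E" "(a', x) \<in> E" "(x, b') \<in> E"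
    and rf: "rf (a, x) = f" "rf (x, b) = f" and lf: "lf (a', x) = f" "lf (x, b') = f"
  shows False
proof -
  have x: "x \<in> V" using e EV by auto
  have f': "f \<in> inner" using f e rf innerI by blast
  note p = inner_path[OF f']
  have "(x, b) \<in> path_edges (lp f)" unfolding p(5) using e rf by simp
  then have not_end: "last (lp f) \<noteq> x" using path_edges_last[OF p(7), of b] by metis
  \<comment> \<open>A right neighbour of \<open>a\<close> among the edges into \<open>x\<close>
    would make \<open>x\<close> the last vertex of the left path, which however continues from
    \<open>x\<close>.\<close>
  have "a = last (ins x)"
    using path_edges_next[of a "ins x"] ins_adj[OF x, of a] ins_set[OF x] e rf(1) not_end by force
  have "a' = hd (ins x)"
  proof (rule ccontr)
    assume "a' \<noteq> hd (ins x)"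
    then obtain c where "(c, a') \<in> path_edges (ins x)" using path_edges_prev[of a' "ins x"] ins_set[OF x] e by auto
    then show False using ins_adj[OF x, of c a'] lf(1) not_end by force
  qed
  \<comment> \<open>The largest downset without \<open>x\<close>. All edges into \<open>x\<close>
    leave it and form a block of its cut.\<close>
  let ?D = "{w \<in> V. (x, w) \<notin> E\<^sup>*}"
  have D: "downset ?D" unfolding downset_def
  proof (intro conjI)
    have "\<And>u. (u, s) \<notin> E" using ins_Nil[OF sV] ins_set[OF sV] by auto
    then have "(x, s) \<in> E\<^sup>* \<Longrightarrow> x = s" by (metis rtranclE)
    then show "s \<in> ?D" using sV \<open>\<And>u. (u, s) \<notin> E\<close> e by auto
    show "t \<notin> ?D" using reach_t x by auto
    show "\<forall>(u, v) \<in> E. v \<in> ?D \<longrightarrow> u \<in> ?D" using EV by (auto intro: rtrancl_into_rtrancl)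
  qed auto
  obtain C where C: "cut ?D C" using ex_cut D by blast
  have pre: "\<And>u. (u, x) \<in> E \<Longrightarrow> u \<in> ?D" using EV acyc_rtrancl by auto
  obtain X Y where XY: "C = X @ map (\<lambda>u. (u, x)) (ins x) @ Y" using cut_step[OF D C x _ pre] by auto
  have ne: "ins x \<noteq> []" using ins_set[OF x] e by auto
  \<comment> \<open>The block starts with the edge from \<open>a'\<close>, whose left face is
    \<open>f\<close> and not the outer face, so the cut has an edge before it. That edge has
    \<open>f\<close> on its right, as the edge from \<open>a\<close> has.\<close>
  have "X \<noteq> []"
  proof
    assume "X = []"
    then have "hd C = (a', x)" using XY ne \<open>a' = hd (ins x)\<close> by (simp add: hd_map)
    then show False using C lf f by (auto simp: cut_def)
  qed
  then have "(last X, (a', x)) \<in> path_edges C" unfolding XY path_edges_append using ne \<open>a' = hd (ins x)\<close>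
    by (auto simp: hd_map)
  then have "rf (last X) = f" using C lf by (auto simp: cut_def)
  moreover have "last X \<in> set C" "(a, x) \<in> set C"
    using XY \<open>X \<noteq> []\<close> ins_set[OF x] e by auto
  ultimately have "last X = (a, x)" using cut_unique[OF D f, of "last X" "(a, x)"] rf C by (simp add: cut_mem)
  moreover have "distinct C" using C by (simp add: cut_def)
  moreover have "(a, x) \<in> set (map (\<lambda>u. (u, x)) (ins x))" using ins_set[OF x] e by auto
  ultimately show False using XY \<open>X \<noteq> []\<close> by (metis distinct_append disjoint_iff last_in_set set_append UnI1)
qed

text \<open>The vertex \<open>a\<close> is the source of \<open>f\<close>, since otherwise both
  paths would enter it and meet at an inner vertex. The edge of the left path has a right neighbour
  at \<open>a\<close>: if it were the last, the flat angle would give the left path an edge into its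
  own first vertex. This neighbour has \<open>f\<close> on its left, and the right path has only one
  edge out of \<open>a\<close>.\<close>

lemma source_adj:
  assumes f: "f \<noteq> outer" and e: "(a, b) \<in> E" "(a, b') \<in> E" and r: "rf (a, b) = f" and l: "lf (a, b') = f"
  shows "(b, b') \<in> path_edges (outs a)"
proof -
  have a: "a \<in> V" using e EV by auto
  have f': "f \<in> inner" using innerI[OF e(1)] r f by blast
  note p = inner_path[OF f']
  have ab: "(a, b) \<in> path_edges (lp f)" "(a, b') \<in> path_edges (rp f)" unfolding p(5,6) using e r l by auto
  have hd: "a = hd (lp f)"
  proof (rule ccontr)
    assume "a \<noteq> hd (lp f)"
    then obtain c d where "(c, a) \<in> path_edges (lp f)" "(d, a) \<in> path_edges (rp f)"
      using path_edges_prev ab path_edges_set p(3) by metis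
    then have "(c, a) \<in> E" "rf (c, a) = f" "(d, a) \<in> E" "lf (d, a) = f" unfolding p(5,6) by auto
    then show False using face_paths_disjoint[OF f _ e(1) _ e(2) _ r _ l] by blast
  qed
  have "b \<noteq> last (outs a)"
  proof
    assume b: "b = last (outs a)"
    then have "a \<noteq> s" using r s_outer f by auto
    moreover have "a \<noteq> t" using outs_Nil[OF a] outs_set[OF a] e by auto
    ultimately have "rf (last (ins a), a) = f" "last (ins a) \<in> set (ins a)"
      using flat_r[OF a] b r ins_Nil[OF a] by auto
    then have "(last (ins a), hd (lp f)) \<in> path_edges (lp f)" unfolding p(5) using ins_set[OF a] hd by auto
    then show False using path_edges_hd p(7) by metis
  qed
  then obtain w where w: "(b, w) \<in> path_edges (outs a)"
    using path_edges_next[of b "outs a"] outs_set[OF a] e by auto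
  then have "(a, w) \<in> E" "lf (a, w) = f" using outs_adj[OF a w] outs_set[OF a] r path_edges_set[OF w] by auto
  then have "(a, w) \<in> path_edges (rp f)" unfolding p(6) by auto
  then have "w = b'" using path_edges_out ab p(8) by metis
  then show ?thesis using w by simp
qed

text \<open>As for \<open>source_adj\<close>, with the common sink of the two paths in place of
  their common source.\<close>

lemma sink_adj:
  assumes f: "f \<noteq> outer" and e: "(b, a) \<in> E" "(b', a) \<in> E" and r: "rf (b, a) = f" and l: "lf (b', a) = f"
  shows "(b, b') \<in> path_edges (ins a)"
proof -
  have a: "a \<in> V" using e EV by auto
  have f': "f \<in> inner" using innerI[OF e(1)] r f by blast
  note p = inner_path[OF f']
  have ab: "(b, a) \<in> path_edges (lp f)" "(b', a) \<in> path_edges (rp f)" unfolding p(5,6) using e r l by auto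
  have last: "a = last (lp f)"
  proof (rule ccontr)
    assume "a \<noteq> last (lp f)"
    then obtain c d where "(a, c) \<in> path_edges (lp f)" "(a, d) \<in> path_edges (rp f)"
      using path_edges_next ab path_edges_set p(4) by metis
    then have "(a, c) \<in> E" "rf (a, c) = f" "(a, d) \<in> E" "lf (a, d) = f" unfolding p(5,6) by auto
    then show False using face_paths_disjoint[OF f e(1) _ e(2) _ r _ l] by blast
  qed
  have "b \<noteq> last (ins a)"
  proof
    assume b: "b = last (ins a)"
    then have "a \<noteq> t" using r t_outer f by auto
    moreover have "a \<noteq> s" using ins_Nil[OF a] ins_set[OF a] e by auto
    ultimately have "rf (a, last (outs a)) = f" "last (outs a) \<in> set (outs a)"
      using flat_r[OF a] b r outs_Nil[OF a] by auto
    then have "(last (lp f), last (outs a)) \<in> path_edges (lp f)" unfolding p(5) using outs_set[OF a] last by auto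
    then show False using path_edges_last p(7) by metis
  qed
  then obtain w where w: "(b, w) \<in> path_edges (ins a)"
    using path_edges_next[of b "ins a"] ins_set[OF a] e by auto
  then have "(w, a) \<in> E" "lf (w, a) = f" using ins_adj[OF a w] ins_set[OF a] r path_edges_set[OF w] by auto
  then have "(w, a) \<in> path_edges (rp f)" unfolding p(6) by auto
  then have "w = b'" using path_edges_in ab p(8) by metis
  then show ?thesis using w by simp
qed

lemma outs_adj_modal:
  "v \<in> V \<Longrightarrow> (x, y) \<in> path_edges (outs v) \<Longrightarrow> (v, x) \<in> R \<Longrightarrow> (v, y) \<in> R"
  using successively_if_sorted_wrt[OF outs_modal] by (auto simp: successively_iff_path_edges)

lemma ins_adj_modal:
  "v \<in> V \<Longrightarrow> (x, y) \<in> path_edges (ins v) \<Longrightarrow> (x, v) \<in> R \<Longrightarrow> (y, v) \<in> R"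
  using successively_if_sorted_wrt[OF ins_modal] by (auto simp: successively_iff_path_edges)

lemma reach_s: "v \<in> V \<Longrightarrow> (s, v) \<in> E\<^sup>*"
proof (rule ccontr)
  assume v: "v \<in> V" "(s, v) \<notin> E\<^sup>*"
  let ?D = "{w \<in> V. (s, w) \<notin> E\<^sup>*}"
  have "finite E" using finV EV finite_subset by blast
  then have "wf E" using acyc by (rule finite_acyclic_wf)
  then obtain w where w: "w \<in> ?D" "\<forall>x. (x, w) \<in> E \<longrightarrow> x \<notin> ?D"
    using v unfolding wf_eq_minimal by (metis (mono_tags, lifting) mem_Collect_eq)
  then have "ins w \<noteq> []" using ins_Nil by auto
  then obtain x where "(x, w) \<in> E" using ins_set w by (metis (mono_tags) mem_Collect_eq list.set_sel(1))
  then show False using w EV by (auto intro: rtrancl_into_rtrancl)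
qed

definition fverts :: "'f \<Rightarrow> 'a set" where "fverts f = set (lp f) \<union> set (rp f)"

lemma fverts_edge: "f \<in> inner \<Longrightarrow> (a, b) \<in> E \<Longrightarrow> rf (a, b) = f \<Longrightarrow> a \<in> set (lp f) \<and> b \<in> set (lp f)"
  "f \<in> inner \<Longrightarrow> (a, b) \<in> E \<Longrightarrow> lf (a, b) = f \<Longrightarrow> a \<in> set (rp f) \<and> b \<in> set (rp f)"
  using inner_path(5,6)[of f] path_edges_set by fastforce+

end

text \<open>The ranking \<open>\<rho> f\<close> is the order in which the vertices of \<open>f\<close> have to appear along the spine.  A
  vertex of the right path strictly between the ends of a right edge of the left path would lie to
  the west of that edge, outside \<open>f\<close>.\<close>

locale merged_faces = st_faces V E L R s t ins outs lf rf outer lp rp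
  for V :: "'a set" and E L R s t ins outs
    and lf rf :: "'a \<times> 'a \<Rightarrow> 'f" and outer lp rp +
  fixes \<rho> :: "'f \<Rightarrow> 'a \<Rightarrow> nat"
  assumes rho_inj: "f \<in> inner \<Longrightarrow> inj_on (\<rho> f) (set (lp f) \<union> set (rp f))"
    and rho_mono: "f \<in> inner \<Longrightarrow> (a, b) \<in> E \<Longrightarrow> lf (a, b) = f \<or> rf (a, b) = f \<Longrightarrow> \<rho> f a < \<rho> f b"
    and rho_l: "f \<in> inner \<Longrightarrow> (a, b) \<in> R \<Longrightarrow> rf (a, b) = f \<Longrightarrow> x \<in> set (rp f) \<Longrightarrow>
      \<not> (\<rho> f a < \<rho> f x \<and> \<rho> f x < \<rho> f b)"
    and rho_r: "f \<in> inner \<Longrightarrow> (a, b) \<in> L \<Longrightarrow> lf (a, b) = f \<Longrightarrow> x \<in> set (lp f) \<Longrightarrow>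
      \<not> (\<rho> f a < \<rho> f x \<and> \<rho> f x < \<rho> f b)"
begin

lemma merged_mirror:
  "merged_faces V E R L s t (\<lambda>v. rev (ins v)) (\<lambda>v. rev (outs v)) rf lf outer rp lp \<rho>"
proof -
  interpret m: st_faces V E R L s t "\<lambda>v. rev (ins v)" "\<lambda>v. rev (outs v)" rf lf outer rp lp
    by (rule mirror)
  have i: "m.inner = inner" by (auto simp: m.inner_def inner_def)
  show ?thesis
    by unfold_locales
      (use rho_inj rho_mono rho_l rho_r in \<open>auto simp: i Un_commute\<close>)
qed

section \<open>Sets closed under all face orders, and the vertices that may follow them\<close>

definition closed :: "'a set \<Rightarrow> bool" where
  "closed D \<longleftrightarrow> downset D \<and>
    (\<forall>f \<in> inner. \<forall>x \<in> fverts f. \<forall>y \<in> fverts f. \<rho> f x < \<rho> f y \<longrightarrow> y \<in> D \<longrightarrow> x \<in> D)"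

definition ready :: "'a set \<Rightarrow> 'a \<Rightarrow> bool" where
  "ready D v \<longleftrightarrow> (\<forall>u. (u, v) \<in> E \<longrightarrow> u \<in> D) \<and>
    (\<forall>f \<in> inner. \<forall>x \<in> fverts f. v \<in> fverts f \<longrightarrow> \<rho> f x < \<rho> f v \<longrightarrow> x \<in> D)"

lemma closedD: "closed D \<Longrightarrow> f \<in> inner \<Longrightarrow> x \<in> fverts f \<Longrightarrow> y \<in> fverts f \<Longrightarrow> y \<in> D \<Longrightarrow> x \<notin> D \<Longrightarrow> \<rho> f y < \<rho> f x"
proof -
  assume a: "closed D" "f \<in> inner" "x \<in> fverts f" "y \<in> fverts f" "y \<in> D" "x \<notin> D"
  then have "\<not> \<rho> f x < \<rho> f y" unfolding closed_def by blast
  moreover have "\<rho> f x \<noteq> \<rho> f y" using a rho_inj[OF a(2)] unfolding fverts_def by (metis inj_onD)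
  ultimately show ?thesis by simp
qed

lemma rho_path:
  assumes f: "f \<in> inner" and p: "p = lp f \<or> p = rp f" and ab: "(a, b) \<in> (path_edges p)\<^sup>*"
  shows "(a, b) \<in> E\<^sup>*" "\<rho> f a \<le> \<rho> f b"
proof -
  have pe: "path_edges p \<subseteq> {(a, b) \<in> E. lf (a, b) = f \<or> rf (a, b) = f}" using p inner_path(5,6)[OF f] by auto
  have "(a, b) \<in> E\<^sup>* \<and> \<rho> f a \<le> \<rho> f b"
    using ab
  proof (induction rule: rtrancl_induct)
    case (step y z)
    then have "(y, z) \<in> E" "\<rho> f y < \<rho> f z" using pe rho_mono[OF f, of y z] by auto
    then show ?case using step by (auto intro: rtrancl_into_rtrancl)
  qed auto
  then show "(a, b) \<in> E\<^sup>*" "\<rho> f a \<le> \<rho> f b" by auto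
qed

lemma rho_split:
  assumes f: "f \<in> inner" and p: "p = lp f \<or> p = rp f" and e: "(c, d) \<in> path_edges p" and x: "x \<in> set p"
  shows "(x, c) \<in> E\<^sup>* \<and> \<rho> f x \<le> \<rho> f c \<or> (d, x) \<in> E\<^sup>* \<and> \<rho> f d \<le> \<rho> f x"
  using path_edge_split[of p "path_edges p", OF _ e x] rho_path[OF f p] by blast

lemma rho_hd:
  assumes f: "f \<in> inner" and x: "x \<in> fverts f"
  shows "\<rho> f (hd (lp f)) \<le> \<rho> f x"
proof -
  obtain p where p: "p = lp f \<or> p = rp f" "x \<in> set p" using x by (auto simp: fverts_def)
  have h: "hd p = hd (lp f)" "p \<noteq> []" "distinct p" using p inner_path[OF f] by auto
  have "(hd p, x) \<in> (path_edges p)\<^sup>*"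
    using path_linear[of p "path_edges p" "hd p" x] hd_in_set[OF h(2)] p(2) path_edges_hd[OF h(3)] by (metis rtranclE subset_refl)
  then show ?thesis using rho_path[OF f p(1)] h by simp
qed

lemma rho_split_l:
  "f \<in> inner \<Longrightarrow> (c, d) \<in> E \<Longrightarrow> rf (c, d) = f \<Longrightarrow> x \<in> set (lp f) \<Longrightarrow>
    (x, c) \<in> E\<^sup>* \<and> \<rho> f x \<le> \<rho> f c \<or> (d, x) \<in> E\<^sup>* \<and> \<rho> f d \<le> \<rho> f x"
  using rho_split[of f "lp f" c d x] inner_path(5)[of f] by auto

lemma rho_split_r:
  "f \<in> inner \<Longrightarrow> (c, d) \<in> E \<Longrightarrow> lf (c, d) = f \<Longrightarrow> x \<in> set (rp f) \<Longrightarrow>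
    (x, c) \<in> E\<^sup>* \<and> \<rho> f x \<le> \<rho> f c \<or> (d, x) \<in> E\<^sup>* \<and> \<rho> f d \<le> \<rho> f x"
  using rho_split[of f "rp f" c d x] inner_path(6)[of f] by auto

lemma downset_rtrancl:
  assumes "downset D" "(x, y) \<in> E\<^sup>*" "y \<in> D"
  shows "x \<in> D"
  using assms(2,1,3) by (induction rule: converse_rtrancl_induct) (auto simp: downset_def)

lemma cut_adjD:
  assumes "cut D C" "((a, b), (c, d)) \<in> path_edges C"
  shows "(a, b) \<in> E" "(c, d) \<in> E" "a \<in> D" "c \<in> D" "b \<notin> D" "d \<notin> D" "rf (a, b) \<in> inner" "lf (c, d) = rf (a, b)"
proof -
  show *: "(a, b) \<in> E" "(c, d) \<in> E" "a \<in> D" "c \<in> D" "b \<notin> D" "d \<notin> D"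
    using assms path_edges_set[OF assms(2)] by (auto simp: cut_mem)
  show "rf (a, b) \<in> inner" "lf (c, d) = rf (a, b)"
    using assms innerI[OF *(1)] by (auto simp: cut_def)
qed

text \<open>Let \<open>g\<close> be the face between the edges from \<open>u\<close> and
  \<open>a\<close>. The edge \<open>(c, d)\<close> before \<open>(a, v)\<close> in the cut lies on
  the left path of \<open>g\<close>, as \<open>(u, v)\<close> does. Since \<open>a\<close> is in
  \<open>D\<close> and \<open>d\<close> is not, \<open>d\<close> ranks above \<open>a\<close>; the
  left edge \<open>(a, v)\<close> on the right path tolerates no vertex of the left path between its
  ends, so \<open>d\<close> ranks at least as high as \<open>v\<close>. It does not rank higher
  either, because \<open>v\<close> is outside \<open>D\<close>. So \<open>d = v\<close> and
  \<open>c = u\<close>.\<close>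

lemma left_chain1:
  assumes D: "closed D" and C: "cut D C" and a: "(a, v) \<in> set C" "(a, v) \<in> L"
    and u: "(u, a) \<in> path_edges (ins v)"
  shows "(u, v) \<in> set C \<and> (u, v) \<in> L"
proof -
  have av: "(a, v) \<in> E" "a \<in> D" "v \<notin> D" using C a by (auto simp: cut_mem)
  have v: "v \<in> V" using av EV by auto
  have uE: "(u, v) \<in> E" using path_edges_set[OF u] ins_set[OF v] by auto
  obtain g where rg: "rf (u, v) = g" by blast
  have g: "lf (a, v) = g" "g \<noteq> outer" "last (lp g) = v" using ins_adj[OF v u] rg by auto
  have gi: "g \<in> inner" using innerI[OF uE] g rg by blast
  have "(a, v) \<noteq> hd C" using C g by (auto simp: cut_def)
  then obtain c d where cd: "((c, d), (a, v)) \<in> path_edges C" using path_edges_prev[OF a(1)] by (metis surj_pair)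
  note cd' = cut_adjD[OF C cd]
  have rcd: "rf (c, d) = g" using cd' g by simp
  have fv: "a \<in> fverts g" "v \<in> fverts g" "c \<in> fverts g" "d \<in> fverts g" "d \<in> set (lp g)" "v \<in> set (lp g)"
    using fverts_edge(1)[OF gi cd'(1) rcd] fverts_edge(1)[OF gi uE rg] fverts_edge(2)[OF gi av(1) g(1)]
    unfolding fverts_def by blast+
  have "\<rho> g a < \<rho> g d" by (rule closedD[OF D gi fv(4,1) av(2) cd'(5)])
  then have "\<rho> g v \<le> \<rho> g d" using rho_r[OF gi a(2) g(1) fv(5)] by auto
  moreover have "\<rho> g d \<le> \<rho> g v"
    using rho_split_l[OF gi cd'(1) rcd fv(6)] cd' av D downset_rtrancl unfolding closed_def by metis
  ultimately have "d = v" using rho_inj[OF gi] fv unfolding fverts_def by (metis dual_order.antisym inj_onD)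
  have "c = u" using path_edges_in[OF inner_path(7)[OF gi], of c v u] inner_path(5)[OF gi] rcd uE cd'(1) \<open>d = v\<close> rg by auto
  have "(u, v) \<in> L" using ins_adj_modal[OF v u] E_eq LR uE a(2) by auto
  then show ?thesis using cd path_edges_set \<open>d = v\<close> \<open>c = u\<close> by metis
qed

lemma left_chain:
  assumes D: "closed D" and C: "cut D C" and "(a, v) \<in> set C" "(a, v) \<in> L"
    and "ins v = P @ a # Q" "u \<in> set P"
  shows "(u, v) \<in> set C \<and> (u, v) \<in> L"
  using assms(3-)
proof (induction P arbitrary: a Q rule: rev_induct)
  case (snoc b P)
  have "(b, a) \<in> path_edges (ins v)" using snoc by (auto simp: path_edges_iff)
  then have "(b, v) \<in> set C" "(b, v) \<in> L" using left_chain1[OF D C] snoc by blast+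
  then show ?case using snoc.IH[of b "a # Q"] snoc.prems by auto
qed simp

text \<open>Vertices of the right path ranked below \<open>v\<close> are at or before
  \<open>a\<close>. On the left path, the edge \<open>(c, d)\<close> that precedes
  \<open>(a, v)\<close> in the cut has \<open>d\<close> ranked at least as high as \<open>v\<close>,
  again because \<open>(a, v)\<close> is a left edge, so vertices ranked below \<open>v\<close> are
  at or before \<open>c\<close>.\<close>

lemma left_flat:
  assumes D: "closed D" and C: "cut D C" and a: "(a, v) \<in> set C" "(a, v) \<in> L"
    and h: "lf (a, v) = h" "h \<in> inner" and x: "x \<in> fverts h" "\<rho> h x < \<rho> h v"
  shows "x \<in> D"
proof (cases "x \<in> set (rp h)")
  case True
  have av: "(a, v) \<in> E" "a \<in> D" "v \<notin> D" using C a by (auto simp: cut_mem)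
  then show ?thesis using rho_split_r[OF h(2) av(1) h(1) True] x D downset_rtrancl
    unfolding closed_def by (metis not_less)
next
  case False
  have av: "(a, v) \<in> E" "a \<in> D" "v \<notin> D" using C a by (auto simp: cut_mem)
  have xl: "x \<in> set (lp h)" using False x by (auto simp: fverts_def)
  have "(a, v) \<noteq> hd C" using C h by (auto simp: cut_def inner_def)
  then obtain c d where cd: "((c, d), (a, v)) \<in> path_edges C" using path_edges_prev[OF a(1)] by (metis surj_pair)
  note cd' = cut_adjD[OF C cd]
  have rcd: "rf (c, d) = h" using cd' h by simp
  have fv: "a \<in> fverts h" "d \<in> fverts h" "d \<in> set (lp h)"
    using fverts_edge(1)[OF h(2) cd'(1) rcd] fverts_edge(2)[OF h(2) av(1) h(1)] unfolding fverts_def by blast+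
  have "\<rho> h a < \<rho> h d" by (rule closedD[OF D h(2) fv(2,1) av(2) cd'(5)])
  then have "\<rho> h v \<le> \<rho> h d" using rho_r[OF h(2) a(2) h(1) fv(3)] by auto
  then have "\<not> \<rho> h d \<le> \<rho> h x" using x by auto
  then have "(x, c) \<in> E\<^sup>*" using rho_split_l[OF h(2) cd'(1) rcd xl] by auto
  then show ?thesis using cd' D downset_rtrancl unfolding closed_def by metis
qed

text \<open>Where both paths of \<open>f\<close> enter \<open>v\<close>, every vertex of
  \<open>f\<close> ranked below \<open>v\<close> is at or before one of the two tails.\<close>

lemma sink_face:
  assumes D: "closed D" and f: "f \<in> inner"
    and e: "(u, v) \<in> E" "rf (u, v) = f" "u \<in> D" "(w, v) \<in> E" "lf (w, v) = f" "w \<in> D"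
    and x: "x \<in> fverts f" "\<rho> f x < \<rho> f v"
  shows "x \<in> D"
  using x rho_split_l[OF f e(1,2), of x] rho_split_r[OF f e(4,5), of x] D downset_rtrancl e(3,6)
  unfolding closed_def fverts_def by (metis UnE not_less)

text \<open>Predecessors of \<open>v\<close>: those to the left of \<open>a\<close> come from
  \<open>left_chain\<close>. To the right of \<open>a\<close>, the hypothesis on \<open>hd Y\<close>
  forces the next cut edge to end in \<open>v\<close> too, and the reflected
  \<open>left_chain\<close> covers the rest. Faces at \<open>v\<close>: those between two edges into
  \<open>v\<close> are settled by \<open>sink_face\<close>, the one left of the first edge by
  \<open>left_flat\<close>, and the one right of the last edge by its reflection or, if that edge is
  \<open>(a, v)\<close> itself, by the hypothesis on \<open>Y\<close>.\<close>

lemma ready_left: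
  assumes D: "closed D" and C: "cut D C" "C = X @ (a, v) # Y" and av: "(a, v) \<in> L"
    and Y: "Y \<noteq> [] \<Longrightarrow> hd Y \<in> R \<and> \<rho> (rf (a, v)) v \<le> \<rho> (rf (a, v)) (snd (hd Y))"
  shows "ready D v"
proof -
  interpret m: merged_faces V E R L s t "\<lambda>v. rev (ins v)" "\<lambda>v. rev (outs v)" rf lf outer rp lp \<rho>
    by (rule merged_mirror)
  have mi: "m.inner = inner" by (auto simp: m.inner_def inner_def)
  have mfv: "m.fverts = fverts" by (auto simp: m.fverts_def fverts_def fun_eq_iff)
  have mD: "m.closed D" using D by (auto simp: m.closed_def closed_def m.downset_def downset_def mi mfv)
  have mC: "m.cut D (rev C)" using C(1) unfolding m.cut_def cut_def
    by (auto simp: path_edges_rev hd_rev last_rev)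
  have aC: "(a, v) \<in> set C" using C by simp
  have avE: "(a, v) \<in> E" "a \<in> D" "v \<notin> D" using aC C(1) by (auto simp: cut_mem)
  have v: "v \<in> V" using avE EV by auto
  obtain P Q where PQ: "ins v = P @ a # Q" using ins_set[OF v] avE by (metis mem_Collect_eq split_list)
  have P: "(u, v) \<in> set C \<and> (u, v) \<in> L" if "u \<in> set P \<or> u = a" for u
    using left_chain[OF D C(1) aC av PQ] that aC av by auto
  have Q: "(u, v) \<in> set C \<and> (u, v) \<in> R" if uQ: "u \<in> set Q" for u
  proof -
    obtain w Q' where w: "Q = w # Q'" using uQ by (cases Q) auto
    have adj: "(a, w) \<in> path_edges (ins v)" using PQ w by (auto simp: path_edges_iff)
    obtain f where f_def: "rf (a, v) = f" by blast
    note f = ins_adj[OF v adj, unfolded f_def]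
    have wE: "(w, v) \<in> E" using path_edges_set[OF adj] ins_set[OF v] by auto
    have fi: "f \<in> inner" using innerI[OF avE(1)] f f_def by blast
    have "Y \<noteq> []"
    proof
      assume "Y = []" then have "rf (a, v) = outer" using C by (auto simp: cut_def)
      then show False using f f_def by metis
    qed
    then obtain a' b' Y' where Y': "Y = (a', b') # Y'" by (metis list.exhaust surj_pair)
    then have "((a, v), (a', b')) \<in> path_edges C" using C by (auto simp: path_edges_iff)
    note cd = cut_adjD[OF C(1) this]
    have lab: "lf (a', b') = f" using cd(8) f_def by simp
    have lwv: "lf (w, v) = f" using f by simp
    have fv: "v \<in> set (rp f)" "b' \<in> set (rp f)"
      using fverts_edge(2)[OF fi wE lwv] fverts_edge(2)[OF fi cd(2) lab] by blast+
    \<comment> \<open>The next cut edge lies on the right path of \<open>f\<close>, as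
      \<open>(w, v)\<close> does. Its head does not rank below \<open>v\<close> by hypothesis, and
      not above \<open>v\<close> because \<open>v\<close> is outside \<open>D\<close>; so the two
      edges coincide.\<close>
    have "\<rho> f v \<le> \<rho> f b'" using Y Y' f_def by auto
    moreover have "\<rho> f b' \<le> \<rho> f v"
      using rho_split_r[OF fi cd(2) lab fv(1)] cd(4) avE D downset_rtrancl unfolding closed_def by metis
    ultimately have "b' = v" using rho_inj[OF fi] fv by (metis Un_iff dual_order.antisym inj_onD)
    moreover have "a' = w"
      using path_edges_in[OF inner_path(8)[OF fi], of a' v w] inner_path(6)[OF fi] cd(2) lab wE lwv \<open>b' = v\<close> by auto
    ultimately have w': "(w, v) \<in> set C" "(w, v) \<in> R" using C Y' Y by auto
    have "rev (ins v) = rev Q' @ w # rev (P @ [a])" using PQ w by simp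
    then show ?thesis using m.left_chain[OF mD mC _ w'(2), of "rev Q'"] w' uQ w by auto
  qed
  have all: "u \<in> D" if "(u, v) \<in> E" for u
  proof -
    have "u \<in> set P \<or> u = a \<or> u \<in> set Q" using that ins_set[OF v] PQ by auto
    then show ?thesis using P Q C(1) by (auto simp: cut_mem)
  qed
  show ?thesis unfolding ready_def
  proof (intro conjI ballI impI allI)
    fix f x assume f: "f \<in> inner" and x: "x \<in> fverts f" "v \<in> fverts f" "\<rho> f x < \<rho> f v"
    \<comment> \<open>The source of a face has the least rank, so \<open>v\<close> is not the source
      of \<open>f\<close> and some edge of \<open>f\<close> enters it.\<close>
    have "v \<noteq> hd (lp f)" using rho_hd[OF f x(1)] x(3) by auto
    then obtain u where u: "(u, v) \<in> E" "rf (u, v) = f \<or> lf (u, v) = f"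
      using path_edges_prev[of v "lp f"] path_edges_prev[of v "rp f"] x(2) inner_path[OF f]
      by (auto simp: fverts_def)
    have uD: "u \<in> D" using all u by auto
    have ui: "u \<in> set (ins v)" using u ins_set[OF v] by auto
    from u(2) show "x \<in> D"
    proof
      assume r: "rf (u, v) = f"
      show ?thesis
      proof (cases "u = last (ins v)")
        case False
        then obtain w where w: "(u, w) \<in> path_edges (ins v)" using path_edges_next ui by metis
        then have "(w, v) \<in> E" "lf (w, v) = f" using path_edges_set[OF w] ins_set[OF v] ins_adj[OF v w] r by auto
        then show ?thesis using sink_face[OF D f u(1) r uD] all x by blast
      next
        case last: True
        show ?thesis
        proof (cases "Q = []")
          case False
          then have "u \<in> set Q" using last PQ by auto
          then have "(u, v) \<in> set (rev C)" "(u, v) \<in> R" using Q by auto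
          then show ?thesis using m.left_flat[OF mD mC _ _ r] f x by (simp add: mi mfv)
        next
          case True
          then have "u = a" using last PQ by simp
          have "Y \<noteq> []"
          proof
            assume "Y = []" then have "rf (a, v) = outer" using C by (auto simp: cut_def)
            then show False using f r \<open>u = a\<close> by (simp add: inner_def)
          qed
          then obtain a' b' Y' where Y': "Y = (a', b') # Y'" by (metis list.exhaust surj_pair)
          then have "((a, v), (a', b')) \<in> path_edges C" using C by (auto simp: path_edges_iff)
          note cd = cut_adjD[OF C(1) this]
          have lab: "lf (a', b') = f" using cd r \<open>u = a\<close> by simp
          have le: "\<rho> f v \<le> \<rho> f b'" using Y Y' r \<open>u = a\<close> by auto
          have dd: "downset D" using D by (simp add: closed_def)
          from x(1) consider "x \<in> set (lp f)" | "x \<in> set (rp f)" by (auto simp: fverts_def)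
          then show ?thesis
          proof cases
            case 1 then show ?thesis using rho_split_l[OF f u(1) r 1] x uD downset_rtrancl[OF dd] by auto
          next
            case 2 then show ?thesis using rho_split_r[OF f cd(2) lab 2] x le cd downset_rtrancl[OF dd] by fastforce
          qed
        qed
      qed
    next
      assume l: "lf (u, v) = f"
      show ?thesis
      proof (cases "u = hd (ins v)")
        case False
        then obtain w where w: "(w, u) \<in> path_edges (ins v)" using path_edges_prev ui by metis
        then have "(w, v) \<in> E" "rf (w, v) = f" using path_edges_set[OF w] ins_set[OF v] ins_adj[OF v w] l by auto
        then show ?thesis using sink_face[OF D f _ _ _ u(1) l uD] all x by blast
      next
        case True
        then have "u \<in> set P \<or> u = a" using PQ by (cases P) auto
        then show ?thesis using left_flat[OF D C(1) _ _ l f] P x by blast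
      qed
    qed
  qed (use all in auto)
qed

text \<open>Otherwise a right edge \<open>(a, b)\<close> is followed by a left edge
  \<open>(c, d)\<close>; let \<open>f\<close> be the face between them. If the tails differ, the one
  of higher rank is not enclosed by the other edge, so it ranks at least as high as the head of that
  edge, although tails are in the closed set and heads are not. If the tails coincide, the edges are
  neighbours at their common source, where 4-modality forbids this order.\<close>

lemma cut_modal:
  assumes D: "closed D" and C: "cut D C" and e: "(e, e') \<in> path_edges C" and R: "e \<in> R"
  shows "e' \<in> R"
proof (rule ccontr)
  assume nR: "e' \<notin> R"
  obtain a b c d where ab: "e = (a, b)" "e' = (c, d)" by (metis surj_pair)
  note h = cut_adjD[OF C e[unfolded ab]]
  obtain f where f_def: "rf (a, b) = f" by blast
  have f: "f \<in> inner" "rf (a, b) = f" "lf (c, d) = f" "f \<noteq> outer"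
    using h(7,8) f_def by (auto simp: inner_def)
  have L: "(c, d) \<in> L" using nR ab h E_eq by auto
  have fv: "a \<in> set (lp f)" "b \<in> set (lp f)" "c \<in> set (rp f)" "d \<in> set (rp f)"
    using fverts_edge(1)[OF f(1) h(1) f(2)] fverts_edge(2)[OF f(1) h(2) f(3)] by blast+
  consider "a = c" | "\<rho> f a < \<rho> f c" | "\<rho> f c < \<rho> f a"
    using rho_inj[OF f(1)] fv by (metis Un_iff inj_onD nat_neq_iff)
  then show False
  proof cases
    case 1
    then have "(b, d) \<in> path_edges (outs a)" using source_adj[OF f(4) h(1) _ f(2)] h f by simp
    then show False using outs_adj_modal[of a b d] R nR ab h EV 1 by auto
  next
    case 2
    then have "\<rho> f b \<le> \<rho> f c" using rho_l[OF f(1) _ f(2) fv(3)] R ab by auto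
    moreover have "\<rho> f c < \<rho> f b" using closedD[OF D f(1), of b c] fv h by (auto simp: fverts_def)
    ultimately show False by simp
  next
    case 3
    then have "\<rho> f d \<le> \<rho> f a" using rho_r[OF f(1) L f(3) fv(1)] by auto
    moreover have "\<rho> f a < \<rho> f d" using closedD[OF D f(1), of d a] fv h by (auto simp: fverts_def)
    ultimately show False by simp
  qed
qed

lemma cut_parts:
  assumes D: "closed D" and C: "cut D C"
  shows "\<exists>A B. C = A @ B \<and> set A \<subseteq> L \<and> set B \<subseteq> R"
proof -
  have "set C \<subseteq> E" using C by (auto simp: cut_def)
  moreover have "\<forall>e e'. (e, e') \<in> path_edges C \<longrightarrow> e \<in> R \<longrightarrow> e' \<in> R" using cut_modal[OF D C] by blast
  ultimately show ?thesis
  proof (induction C)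
    case (Cons e C)
    have "\<forall>e e'. (e, e') \<in> path_edges C \<longrightarrow> e \<in> R \<longrightarrow> e' \<in> R" using Cons.prems by (cases C) auto
    then obtain A B where AB: "C = A @ B" "set A \<subseteq> L" "set B \<subseteq> R" using Cons by auto
    show ?case
    proof (cases "e \<in> R")
      case False
      then have "e # C = (e # A) @ B \<and> set (e # A) \<subseteq> L \<and> set B \<subseteq> R" using AB Cons.prems E_eq by auto
      then show ?thesis by blast
    next
      case True
      have "A = []"
      proof (rule ccontr)
        assume "A \<noteq> []"
        then obtain a A' where A: "A = a # A'" by (cases A) auto
        then have "a \<in> R" using Cons.prems(2) True AB by (metis append_Cons insertI1 path_edges_simps(3))
        then show False using A AB LR by auto
      qed
      then have "e # C = [] @ (e # C) \<and> set [] \<subseteq> L \<and> set (e # C) \<subseteq> R" using AB True by auto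
      then show ?thesis by blast
    qed
  qed simp
qed

text \<open>The last left edge and the first right edge of the cut share a face.
  \<open>ready_left\<close> or its reflection applies to the one whose head does not rank above the
  other head in this face. If only one page occurs in the cut, the comparison is void.\<close>

lemma ex_ready:
  assumes D: "closed D"
  shows "\<exists>v \<in> V - D. ready D v"
proof -
  interpret m: merged_faces V E R L s t "\<lambda>v. rev (ins v)" "\<lambda>v. rev (outs v)" rf lf outer rp lp \<rho>
    by (rule merged_mirror)
  have mi: "m.inner = inner" by (auto simp: m.inner_def inner_def)
  have mfv: "m.fverts = fverts" by (auto simp: m.fverts_def fverts_def fun_eq_iff)
  have mD: "m.closed D" using D by (auto simp: m.closed_def closed_def m.downset_def downset_def mi mfv)
  have mr: "m.ready D v \<longleftrightarrow> ready D v" for v by (auto simp: m.ready_def ready_def mi mfv)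
  obtain C where C: "cut D C" using ex_cut[of D] D unfolding closed_def by blast
  have mC: "m.cut D (rev C)" using C unfolding m.cut_def cut_def
    by (auto simp: path_edges_rev hd_rev last_rev)
  obtain A B where AB: "C = A @ B" "set A \<subseteq> L" "set B \<subseteq> R" using cut_parts[OF D C] by blast
  have left: ?thesis if A: "A = A' @ [(a, v)]" and "B \<noteq> [] \<Longrightarrow> \<rho> (rf (a, v)) v \<le> \<rho> (rf (a, v)) (snd (hd B))" for A' a v
  proof -
    have "ready D v" using ready_left[OF D C, of A' a v B] that AB by (cases B) auto
    moreover have "(a, v) \<in> set C" using A AB by simp
    ultimately show ?thesis using C EV by (auto simp: cut_mem)
  qed
  have right: ?thesis if B: "B = (a, v) # B'" and "A \<noteq> [] \<Longrightarrow> \<rho> (lf (a, v)) v \<le> \<rho> (lf (a, v)) (snd (last A))" for B' a v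
  proof -
    have "m.ready D v"
      using m.ready_left[OF mD mC, of "rev B'" a v "rev A"] that AB by (cases A rule: rev_cases) auto
    moreover have "(a, v) \<in> set C" using B AB by simp
    ultimately show ?thesis using C EV mr by (auto simp: cut_mem)
  qed
  consider "A = []" "B = []" | A' a v where "A = A' @ [(a, v)]" "B = []" | a v B' where "A = []" "B = (a, v) # B'"
    | A' a v a' v' B' where "A = A' @ [(a, v)]" "B = (a', v') # B'"
    by (metis list.exhaust rev_exhaust surj_pair)
  then show ?thesis
  proof cases
    case 1 then show ?thesis using C AB by (auto simp: cut_def)
  next
    case 2 then show ?thesis using left by blast
  next
    case 3 then show ?thesis using right by blast
  next
    case 4
    then have "((a, v), (a', v')) \<in> path_edges C" using AB by (auto simp: path_edges_append)
    then have "lf (a', v') = rf (a, v)" by (rule cut_adjD(8)[OF C])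
    then show ?thesis using left[OF 4(1)] right[OF 4(2)] 4 by (cases "\<rho> (rf (a, v)) v \<le> \<rho> (rf (a, v)) v'") auto
  qed
qed

end

text \<open>Vertices are appended one at a time to a set closed under \<open>T\<close>. The
  hypothesis is the existence of a next vertex and not acyclicity of \<open>T\<close>, because for
  the union of all face orders acyclicity is only known through this property.\<close>

lemma linear_extension:
  fixes V :: "'a set" and T :: "'a rel"
  assumes fin: "finite V"
    and step: "\<And>D. D \<subseteq> V \<Longrightarrow> D \<noteq> V \<Longrightarrow> (\<forall>(x, y) \<in> T. y \<in> D \<longrightarrow> x \<in> D) \<Longrightarrow>
      \<exists>v \<in> V - D. \<forall>x. (x, v) \<in> T \<longrightarrow> x \<in> D"
  shows "\<exists>\<pi>. bij_betw \<pi> V {1..card V} \<and> (\<forall>(x, y) \<in> T. y \<in> V \<longrightarrow> \<pi> x < \<pi> y)"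
proof -
  have "\<exists>D \<pi>. D \<subseteq> V \<and> card D = k \<and> (\<forall>(x, y) \<in> T. y \<in> D \<longrightarrow> x \<in> D) \<and>
      bij_betw \<pi> D {1..k} \<and> (\<forall>(x, y) \<in> T. y \<in> D \<longrightarrow> \<pi> x < (\<pi> y :: nat))" if "k \<le> card V" for k
    using that
  proof (induction k)
    case 0
    show ?case by (intro exI[of _ "{}"] exI[of _ "\<lambda>_. 0"]) (auto simp: bij_betw_def)
  next
    case (Suc k)
    then obtain D and \<pi> :: "'a \<Rightarrow> nat" where D: "D \<subseteq> V" "card D = k" "\<forall>(x, y) \<in> T. y \<in> D \<longrightarrow> x \<in> D"
      "bij_betw \<pi> D {1..k}" "\<forall>(x, y) \<in> T. y \<in> D \<longrightarrow> \<pi> x < \<pi> y" by auto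
    have "D \<noteq> V" using D Suc by auto
    then obtain v where v: "v \<in> V - D" "\<forall>x. (x, v) \<in> T \<longrightarrow> x \<in> D" using step[OF D(1)] D(3) by blast
    have finD: "finite D" using D fin finite_subset by blast
    have le: "\<pi> x \<le> k" if "x \<in> D" for x using bij_betwE[OF D(4)] that by auto
    have im: "\<pi> ` D = {1..k}" using D(4) by (simp add: bij_betw_def)
    have "bij_betw (\<pi>(v := Suc k)) (insert v D) {1..Suc k}"
      unfolding bij_betw_def
    proof
      have DD: "D \<inter> {x. x \<noteq> v} = D" using v by auto
      have "inj_on (\<pi>(v := Suc k)) D" using D(4) im by (intro inj_on_fun_updI) (auto simp: bij_betw_def)
      then show "inj_on (\<pi>(v := Suc k)) (insert v D)" 
        unfolding inj_on_insert using le v(1) by (auto dest!: le)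
      show "(\<pi>(v := Suc k)) ` insert v D = {1..Suc k}"
        using im v(1) DD by (simp add: fun_upd_image atLeastAtMostSuc_conv)
    qed
    moreover have "\<forall>(x, y) \<in> T. y \<in> insert v D \<longrightarrow> (\<pi>(v := Suc k)) x < (\<pi>(v := Suc k)) y"
    proof (safe)
      fix x assume "(x, v) \<in> T"
      then have "x \<in> D" using v by blast
      then show "(\<pi>(v := Suc k)) x < (\<pi>(v := Suc k)) v" using v le[of x] by auto
    next
      fix x y assume xy: "(x, y) \<in> T" "y \<in> D"
      then have "x \<in> D" "\<pi> x < \<pi> y" using D by auto
      then show "(\<pi>(v := Suc k)) x < (\<pi>(v := Suc k)) y" using v xy by auto
    qed
    moreover have "\<forall>(x, y) \<in> T. y \<in> insert v D \<longrightarrow> x \<in> insert v D" using D(3) v(2) by blast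
    moreover have "insert v D \<subseteq> V" "card (insert v D) = Suc k" using D v finD by auto
    ultimately show ?case by blast
  qed
  from this[of "card V"] show ?thesis using card_subset_eq[OF fin] by blast
qed

text \<open>Supplies the order of the vertices within each block of a merged face order.\<close>

lemma acyclic_linear_extension:
  assumes "finite V" "E \<subseteq> V \<times> V" "acyclic E"
  shows "\<exists>\<tau> :: 'a \<Rightarrow> nat. inj_on \<tau> V \<and> (\<forall>(x, y) \<in> E. \<tau> x < \<tau> y)"
proof -
  have "finite E" using assms finite_subset by blast
  then have wf: "wf E" using assms(3) by (rule finite_acyclic_wf)
  have "\<exists>\<pi> :: 'a \<Rightarrow> nat. bij_betw \<pi> V {1..card V} \<and> (\<forall>(x, y) \<in> E. y \<in> V \<longrightarrow> \<pi> x < \<pi> y)"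
  proof (rule linear_extension[OF assms(1)])
    fix D assume "D \<subseteq> V" "D \<noteq> V"
    then obtain z where "z \<in> V - D" by blast
    then obtain v where "v \<in> V - D" "\<And>x. (x, v) \<in> E \<Longrightarrow> x \<notin> V - D" using wf by (metis wfE_min)
    then show "\<exists>v \<in> V - D. \<forall>x. (x, v) \<in> E \<longrightarrow> x \<in> D" using assms(2) by blast
  qed
  then obtain \<pi> :: "'a \<Rightarrow> nat" where "bij_betw \<pi> V {1..card V}" "\<forall>(x, y) \<in> E. y \<in> V \<longrightarrow> \<pi> x < \<pi> y" by blast
  then have "inj_on \<pi> V \<and> (\<forall>(x, y) \<in> E. \<pi> x < \<pi> y)" using assms(2) by (auto simp: bij_betw_def)
  then show ?thesis by blast
qed

section \<open>Merging the two bounding paths of a face\<close>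

definition merge_ok :: "'a list \<Rightarrow> 'a list \<Rightarrow> 'a rel \<Rightarrow> 'a rel \<Rightarrow> ('a \<Rightarrow> nat) \<Rightarrow> bool" where
  "merge_ok l r L R \<rho> \<longleftrightarrow> inj_on \<rho> (set l \<union> set r) \<and>
    (\<forall>(a, b) \<in> path_edges l \<union> path_edges r. \<rho> a < \<rho> b) \<and>
    (\<forall>(a, b) \<in> path_edges l \<inter> R. \<forall>x \<in> set r. \<not> (\<rho> a < \<rho> x \<and> \<rho> x < \<rho> b)) \<and>
    (\<forall>(a, b) \<in> path_edges r \<inter> L. \<forall>x \<in> set l. \<not> (\<rho> a < \<rho> x \<and> \<rho> x < \<rho> b))"

lemma merge_ok_swap: "merge_ok l r L R \<rho> \<longleftrightarrow> merge_ok r l R L \<rho>"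
  unfolding merge_ok_def by (simp add: Un_commute) blast

lemma sorted_wrt_bounds:
  fixes f :: "'a \<Rightarrow> nat"
  assumes "sorted_wrt (\<lambda>a b. f a < f b) l" "x \<in> set l"
  shows "f (hd l) \<le> f x" "f x \<le> f (last l)"
  using assms by (induction l) (auto intro: less_imp_le)

text \<open>All inner vertices of \<open>r\<close> are inserted between \<open>p\<close> and \<open>q\<close>.\<close>

lemma merge_split:
  fixes \<tau> :: "'a \<Rightarrow> nat"
  assumes tau: "inj_on \<tau> (set l \<union> set r)" "\<And>a b. (a, b) \<in> path_edges l \<union> path_edges r \<Longrightarrow> \<tau> a < \<tau> b"
    and dist: "distinct l" "distinct r" and ends: "r \<noteq> []" "hd l = hd r" "last l = last r"
    and meet: "set l \<inter> set r \<subseteq> {hd l, last l}"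
    and l: "l = p @ q" "p \<noteq> []" "q \<noteq> []" and split: "(last p, hd q) \<notin> R"
    and first: "\<And>b. (hd r, b) \<in> path_edges r \<Longrightarrow> (hd r, b) \<in> L \<Longrightarrow> length p = 1"
    and last: "\<And>a. (a, last r) \<in> path_edges r \<Longrightarrow> (a, last r) \<in> L \<Longrightarrow> length q = 1"
  shows "\<exists>\<rho>. merge_ok l r L R \<rho>"
proof -
  \<comment> \<open>\<open>N\<close> exceeds all values of \<open>\<tau>\<close>, so
    \<open>\<rho>\<close> has three layers: \<open>p\<close> below \<open>N\<close>, the inner
    vertices of \<open>r\<close> from \<open>N\<close> on, and \<open>q\<close> from
    \<open>2 * N\<close> on. Within a layer \<open>\<tau>\<close> decides.\<close>
  define N where "N = Suc (Max (\<tau> ` (set l \<union> set r)))"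
  have N: "\<tau> x < N" if "x \<in> set l \<union> set r" for x
    unfolding N_def using that by (intro le_imp_less_Suc Max_ge) auto
  define \<rho> where "\<rho> x = (if x \<in> set p then \<tau> x else if x \<in> set q then 2 * N + \<tau> x else N + \<tau> x)" for x
  have dj: "set p \<inter> set q = {}" using dist l by auto
  have hl: "hd l = hd p" "last l = last q" "hd p \<in> set p" "last q \<in> set q" using l by auto
  have pr: "x = hd l" if "x \<in> set p" "x \<in> set r" for x
  proof -
    have "x \<in> {hd l, last l}" "x \<noteq> last l" using that meet hl dj l(1) by auto
    then show ?thesis by blast
  qed
  have qr: "x = last l" if "x \<in> set q" "x \<in> set r" for x
  proof -
    have "x \<in> {hd l, last l}" "x \<noteq> hd l" using that meet hl dj l(1) by auto
    then show ?thesis by blast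
  qed
  have srt: "sorted_wrt (\<lambda>a b. \<tau> a < \<tau> b) l" using tau(2) by (intro sorted_wrt_path_edges) auto
  note min = sorted_wrt_bounds(1)[OF srt] and max = sorted_wrt_bounds(2)[OF srt]
  have inj: "inj_on \<rho> (set l \<union> set r)"
  proof (rule inj_onI)
    fix x y assume xy: "x \<in> set l \<union> set r" "y \<in> set l \<union> set r" "\<rho> x = \<rho> y"
    then have "\<tau> x = \<tau> y" using N[OF xy(1)] N[OF xy(2)] unfolding \<rho>_def by (auto split: if_splits)
    then show "x = y" using tau(1) xy by (meson inj_onD)
  qed
  have pl: "path_edges l = path_edges p \<union> path_edges q \<union> {(last p, hd q)}" using l by (simp add: path_edges_append)
  have mono_l: "\<rho> a < \<rho> b" if ab: "(a, b) \<in> path_edges l" for a b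
  proof -
    have t: "\<tau> a < \<tau> b" using tau(2) ab by auto
    from ab consider "a \<in> set p" "b \<in> set p" | "a \<in> set q" "b \<in> set q" | "a \<in> set p" "b \<in> set q"
      unfolding pl using path_edges_set l by fastforce
    then show ?thesis using t dj N[of a] N[of b] l by cases (auto simp: \<rho>_def)
  qed
  have mono_r: "\<rho> a < \<rho> b" if ab: "(a, b) \<in> path_edges r" for a b
  proof -
    have t: "\<tau> a < \<tau> b" using tau(2) ab by auto
    have s: "a \<in> set r" "b \<in> set r" using path_edges_set[of a b r] ab by auto
    have "b \<notin> set p" using pr[of b] s path_edges_hd[OF dist(2), of a] ab ends by auto
    moreover have "a \<notin> set q" using qr[of a] s path_edges_last[OF dist(2), of b] ab ends by auto
    ultimately show ?thesis using t N[of a] N[of b] s by (auto simp: \<rho>_def)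
  qed
  have "\<not> (\<rho> a < \<rho> x \<and> \<rho> x < \<rho> b)" if ab: "(a, b) \<in> path_edges l" "(a, b) \<in> R" and x: "x \<in> set r" for a b x
  proof
    assume bt: "\<rho> a < \<rho> x \<and> \<rho> x < \<rho> b"
    \<comment> \<open>The only edge of \<open>l\<close> between different layers is the split edge,
      which is not a right edge. An edge within a layer could only enclose the common source or the
      common sink, and these are extreme.\<close>
    from ab split have "(a, b) \<in> path_edges p \<or> (a, b) \<in> path_edges q" unfolding pl by auto
    then show False
    proof
      assume "(a, b) \<in> path_edges p"
      then have s: "a \<in> set p" "b \<in> set p" using path_edges_set[of a b p] by auto
      then have "x \<in> set p" "\<tau> a < \<tau> x" using bt N[of b] l by (auto simp: \<rho>_def split: if_splits)
      then show False using pr[OF _ x] min[of a] s l by auto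
    next
      assume "(a, b) \<in> path_edges q"
      then have s: "a \<in> set q" "b \<in> set q" using path_edges_set[of a b q] by auto
      then have "x \<in> set q" "\<tau> x < \<tau> b" using bt N[of x] l dj x by (auto simp: \<rho>_def split: if_splits)
      then show False using qr[OF _ x] max[of b] s l by auto
    qed
  qed
  moreover have "\<not> (\<rho> a < \<rho> x \<and> \<rho> x < \<rho> b)" if ab: "(a, b) \<in> path_edges r" "(a, b) \<in> L" and x: "x \<in> set l" for a b x
  proof
    assume bt: "\<rho> a < \<rho> x \<and> \<rho> x < \<rho> b"
    have s: "a \<in> set r" "b \<in> set r" using path_edges_set[of a b r] ab by auto
    \<comment> \<open>An edge of \<open>r\<close> can enclose a vertex of \<open>p\<close> only if
      it starts in the common source, and then \<open>first\<close> leaves \<open>p\<close> with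
      nothing but this source. The same holds for \<open>q\<close>, the sink and
      \<open>last\<close>.\<close>
    from x l have "x \<in> set p \<or> x \<in> set q" by auto
    then show False
    proof
      assume xp: "x \<in> set p"
      then have "a \<in> set p" using bt N[of x] x by (auto simp: \<rho>_def split: if_splits)
      then have "a = hd r" using pr s ends by auto
      then have "length p = 1" using first ab by auto
      then have "p = [hd p]" by (cases p) auto
      then have "x = hd p" using xp by (metis empty_iff insert_iff list.set)
      then show False using bt \<open>a = hd r\<close> hl ends by auto
    next
      assume xq: "x \<in> set q"
      then have "b \<in> set q" using bt N[of b] s dj by (auto simp: \<rho>_def split: if_splits)
      then have "b = last r" using qr s ends by auto
      then have "length q = 1" using last ab by auto
      then have "q = [last q]" by (cases q) auto
      then have "x = last q" using xq by (metis empty_iff insert_iff list.set)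
      then show False using bt \<open>b = last r\<close> hl ends by auto
    qed
  qed
  ultimately have "merge_ok l r L R \<rho>" using inj mono_l mono_r unfolding merge_ok_def by blast
  then show ?thesis by blast
qed

text \<open>A discrete intermediate value theorem. It finds the edge of one path that passes the
  height of a vertex of the other.\<close>

lemma path_between:
  fixes g :: "'a \<Rightarrow> nat"
  assumes "p \<noteq> []" "g (hd p) < c" "c < g (last p)" "\<forall>x \<in> set p. g x \<noteq> c"
  shows "\<exists>(x, y) \<in> path_edges p. g x < c \<and> c < g y"
  using assms
proof (induction p rule: induct_list012)
  case (3 x y p)
  show ?case
  proof (cases "g y < c")
    case True then show ?thesis using 3 by auto
  next
    case False then show ?thesis using 3 by (auto simp: nat_neq_iff)
  qed
qed auto

context st_faces
begin

text \<open>The inner vertices of one path go between two consecutive vertices of the other. The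
  split edge must be a left edge of the left path or a right edge of the right path, and the first
  and last edge of the inserted path may not enclose vertices on their own side. 4-modality passes
  right edges at the source and the sink from the left path to the right one (\<open>M1\<close>,
  \<open>M2\<close>), which always leaves a place: an end of the left path, a left edge inside it, a
  right edge of the right path, or, if a path is monochromatic in the forbidden way, the single edge
  that the hypotheses then grant for the other.\<close>

lemma ex_merge:
  assumes f: "f \<in> inner"
    and NI1: "\<not> (path_edges (lp f) \<subseteq> R \<and> length (rp f) \<noteq> 2)"
    and NI2: "\<not> (path_edges (rp f) \<subseteq> L \<and> length (lp f) \<noteq> 2)"
  shows "\<exists>\<rho>. merge_ok (lp f) (rp f) L R \<rho>"
proof -
  note p = inner_path[OF f]
  have fo: "f \<noteq> outer" using f by (auto simp: inner_def)
  let ?l = "lp f" and ?r = "rp f"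
  have len: "2 \<le> length ?l" "2 \<le> length ?r" using p by (auto simp: directed_path_def)
  obtain \<tau> :: "'a \<Rightarrow> nat" where tau: "inj_on \<tau> V" "\<And>x y. (x, y) \<in> E \<Longrightarrow> \<tau> x < \<tau> y"
    using acyclic_linear_extension[OF finV EV acyc] by auto
  have pE: "path_edges ?l \<subseteq> E" "path_edges ?r \<subseteq> E" using p by auto
  have pV: "set q \<subseteq> V" if "path_edges q \<subseteq> E" "2 \<le> length q" "distinct q" for q
  proof
    fix x assume x: "x \<in> set q"
    have "hd q \<noteq> last q" using that(2,3) by (cases q rule: remdups_adj.cases) auto
    then show "x \<in> V" using path_edges_next[OF x] path_edges_prev[OF x] that(1) EV
      by (metis mem_Sigma_iff subsetD)
  qed
  have t1: "inj_on \<tau> (set ?l \<union> set ?r)" using tau(1) pV[OF pE(1) len(1) p(7)] pV[OF pE(2) len(2) p(8)]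
    by (meson Un_least inj_on_subset)
  have t2: "\<tau> a < \<tau> b" if "(a, b) \<in> path_edges ?l \<union> path_edges ?r" for a b using that pE tau(2) by blast
  have meet: "set ?l \<inter> set ?r \<subseteq> {hd ?l, last ?l}"
  proof (rule subsetI, rule ccontr)
    fix x assume x: "x \<in> set ?l \<inter> set ?r" "x \<notin> {hd ?l, last ?l}"
    then obtain a b c d where "(a, x) \<in> path_edges ?l" "(x, b) \<in> path_edges ?l" "(c, x) \<in> path_edges ?r" "(x, d) \<in> path_edges ?r"
      using path_edges_next[of x ?l] path_edges_prev[of x ?l] path_edges_next[of x ?r] path_edges_prev[of x ?r] p(3,4)
      by auto
    then show False using face_paths_disjoint[OF fo, of a x b c d] unfolding p(5,6) by auto
  qed
  have split_l: ?thesis if "?l = q @ q'" "q \<noteq> []" "q' \<noteq> []" "(last q, hd q') \<notin> R"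
    "\<And>b. (hd ?r, b) \<in> path_edges ?r \<Longrightarrow> (hd ?r, b) \<in> L \<Longrightarrow> length q = 1"
    "\<And>a. (a, last ?r) \<in> path_edges ?r \<Longrightarrow> (a, last ?r) \<in> L \<Longrightarrow> length q' = 1" for q q'
    by (rule merge_split[OF t1 t2 p(7,8,10,3,4) meet that]) auto
  have split_r: ?thesis if "?r = q @ q'" "q \<noteq> []" "q' \<noteq> []" "(last q, hd q') \<notin> L"
    "\<And>b. (hd ?l, b) \<in> path_edges ?l \<Longrightarrow> (hd ?l, b) \<in> R \<Longrightarrow> length q = 1"
    "\<And>a. (a, last ?l) \<in> path_edges ?l \<Longrightarrow> (a, last ?l) \<in> R \<Longrightarrow> length q' = 1" for q q'
  proof -
    have "\<exists>\<rho>. merge_ok ?r ?l R L \<rho>"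
      by (rule merge_split[OF _ _ p(8,7,9) p(3)[symmetric] p(4)[symmetric] _ that])
        (use t1 t2 meet p(3,4) in \<open>auto simp: Un_commute Int_commute\<close>)
    then show ?thesis by (simp add: merge_ok_swap)
  qed
  obtain l1 l2 r1 r2 where e: "(hd ?l, l1) \<in> path_edges ?l" "(l2, last ?l) \<in> path_edges ?l"
    "(hd ?r, r1) \<in> path_edges ?r" "(r2, last ?r) \<in> path_edges ?r"
  proof -
    have hl: "hd q \<noteq> last q" "q \<noteq> []" if "2 \<le> length q" "distinct q" for q :: "'a list"
      using that by (cases q rule: remdups_adj.cases; auto)+
    show thesis
      using that path_edges_next[OF hd_in_set hl(1)] path_edges_prev[OF last_in_set hl(1)[symmetric]] len p(7-10) by metis
  qed
  have u: "b = l1" if "(hd ?l, b) \<in> path_edges ?l" for b using path_edges_out p(7) e that by metis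
  have u2: "b = l2" if "(b, last ?l) \<in> path_edges ?l" for b using path_edges_in p(7) e that by metis
  have u3: "b = r1" if "(hd ?r, b) \<in> path_edges ?r" for b using path_edges_out p(8) e that by metis
  have u4: "b = r2" if "(b, last ?r) \<in> path_edges ?r" for b using path_edges_in p(8) e that by metis
  have LR': "x \<in> E \<Longrightarrow> x \<notin> R \<longleftrightarrow> x \<in> L" for x using E_eq LR by auto
  have eE: "(hd ?l, l1) \<in> E" "(l2, last ?l) \<in> E" "(hd ?r, r1) \<in> E" "(r2, last ?r) \<in> E" using e pE by auto
  have M1: "(hd ?r, r1) \<in> R" if "(hd ?l, l1) \<in> R"
    using source_adj[OF fo, of "hd ?l" l1 r1] outs_adj_modal[of "hd ?l" l1 r1] that e EV eE p(3) unfolding p(5,6) by auto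
  have M2: "(r2, last ?r) \<in> R" if "(l2, last ?l) \<in> R"
    using sink_adj[OF fo, of l2 "last ?l" r2] ins_adj_modal[of "last ?l" l2 r2] that e EV eE p(4) unfolding p(5,6) by auto
  have hdtl: "?l = [hd ?l] @ tl ?l" "tl ?l \<noteq> []" "hd (tl ?l) = l1"
    "?l = butlast ?l @ [last ?l]" "butlast ?l \<noteq> []" "last (butlast ?l) = l2"
  proof -
    show a: "?l = [hd ?l] @ tl ?l" "?l = butlast ?l @ [last ?l]" using p(9) by auto
    show b: "tl ?l \<noteq> []" "butlast ?l \<noteq> []" using len by (cases ?l rule: remdups_adj.cases; auto)+
    have "(hd ?l, hd (tl ?l)) \<in> path_edges ?l" using b(1) by (subst (3) a(1)) (simp add: path_edges_append del: append_Cons)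
    then show "hd (tl ?l) = l1" by (rule u)
    have "(last (butlast ?l), last ?l) \<in> path_edges ?l" using b(2) by (subst (3) a(2)) (simp add: path_edges_append)
    then show "last (butlast ?l) = l2" by (rule u2)
  qed
  have two: "\<exists>a b. q = [a, b]" if "length q = 2" for q :: "'a list" using that by (cases q rule: remdups_adj.cases) auto
  show ?thesis
  proof (cases "(hd ?r, r1) \<in> R")
    case r1: True
    show ?thesis
    proof (cases "(l2, last ?l) \<in> R")
      case False
      show ?thesis
        by (rule split_l[OF hdtl(4,5)]) (use False hdtl(6) u3 r1 LR in auto)
    next
      case True
      then have r2: "(r2, last ?r) \<in> R" by (rule M2)
      show ?thesis
      proof (cases "path_edges ?l \<subseteq> R")
        case False
        then obtain c d where cd: "(c, d) \<in> path_edges ?l" "(c, d) \<notin> R" by auto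
        then obtain xs ys where "?l = (xs @ [c]) @ (d # ys)" by (auto simp: path_edges_iff)
        then show ?thesis by (rule split_l) (use cd u3 u4 r1 r2 LR in auto)
      next
        case True
        then have "length ?r = 2" using NI1 by blast
        then obtain a b where ab: "?r = [a] @ [b]" using two[of ?r] by auto
        then show ?thesis by (rule split_r) (use ab r1 e LR in auto)
      qed
    qed
  next
    case r1: False
    then have l1: "(hd ?l, l1) \<notin> R" using M1 by blast
    show ?thesis
    proof (cases "(r2, last ?r) \<in> R")
      case True
      show ?thesis by (rule split_l[OF hdtl(1) _ hdtl(2)]) (use l1 hdtl(3) u4 True LR in auto)
    next
      case False
      then have l2: "(l2, last ?l) \<notin> R" using M2 by blast
      show ?thesis
      proof (cases "path_edges ?r \<subseteq> L")
        case False
        then obtain c d where cd: "(c, d) \<in> path_edges ?r" "(c, d) \<notin> L" by auto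
        then obtain xs ys where "?r = (xs @ [c]) @ (d # ys)" by (auto simp: path_edges_iff)
        then show ?thesis by (rule split_r) (use cd u u2 l1 l2 in auto)
      next
        case True
        then have "length ?l = 2" using NI2 by blast
        then obtain a b where ab: "?l = [a] @ [b]" using two[of ?l] by auto
        then show ?thesis by (rule split_l) (use ab l1 e in auto)
      qed
    qed
  qed
qed

text \<open>The first edge of \<open>r\<close> is a right edge by 4-modality and reaches higher than
  the first edge of \<open>l\<close>. Its head \<open>r1\<close> is an inner vertex of
  \<open>r\<close>, hence not on \<open>l\<close>, and it is below the common sink, so a later edge
  of \<open>l\<close> passes its height. This right edge starts strictly between the source and
  \<open>r1\<close> and thus crosses the first edge of \<open>r\<close>. The paths are arbitrary, as
  in the definition of an impossible face.\<close>

lemma impossible_contra: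
  fixes \<pi> :: "'a \<Rightarrow> nat"
  assumes f: "f \<noteq> outer" and l: "directed_path E l" and r: "directed_path E r"
    and ends: "hd l = hd r" "last l = last r"
    and le: "path_edges l = {e \<in> E. rf e = f}" and re: "path_edges r = {e \<in> E. lf e = f}"
    and lR: "path_edges l \<subseteq> R" and len: "length r \<noteq> 2"
    and mono: "\<And>a b. (a, b) \<in> E \<Longrightarrow> \<pi> a < \<pi> b" and inj: "inj_on \<pi> V"
    and nc: "\<And>a b c d. (a, b) \<in> R \<Longrightarrow> (c, d) \<in> R \<Longrightarrow> \<pi> a < \<pi> c \<Longrightarrow> \<pi> c < \<pi> b \<Longrightarrow> \<pi> b < \<pi> d \<Longrightarrow> False"
    and ord: "\<And>v x y. v \<in> V \<Longrightarrow> (x, y) \<in> path_edges (outs v) \<Longrightarrow> (v, x) \<in> R \<Longrightarrow> (v, y) \<in> R \<Longrightarrow> \<pi> x < \<pi> y"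
  shows False
proof -
  have d: "distinct l" "distinct r" "2 \<le> length l" "2 \<le> length r" "l \<noteq> []" "r \<noteq> []"
    using l r by (auto simp: directed_path_def)
  define l1 r1 where "l1 = l ! 1" and "r1 = r ! 1"
  have el: "(hd r, l1) \<in> path_edges l" and er: "(hd r, r1) \<in> path_edges r"
    using path_edges_nth1[OF d(3)] path_edges_nth1[OF d(4)] ends by (auto simp: l1_def r1_def)
  have E: "(hd r, l1) \<in> E" "rf (hd r, l1) = f" "(hd r, r1) \<in> E" "lf (hd r, r1) = f" using el er le re by auto
  have v: "hd r \<in> V" "r1 \<in> V" using E EV by auto
  have adj: "(l1, r1) \<in> path_edges (outs (hd r))" using source_adj[OF f E(1,3,2,4)] .
  have R: "(hd r, l1) \<in> R" "(hd r, r1) \<in> R" using el lR outs_adj_modal[OF v(1) adj] by auto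
  have lt: "\<pi> l1 < \<pi> r1" using ord[OF v(1) adj R] .
  have r1_last: "r1 \<noteq> last r"
  proof
    assume "r1 = last r"
    then have "r ! 1 = r ! (length r - 1)" using d by (simp add: r1_def last_conv_nth)
    then show False using d len nth_eq_iff_index_eq[OF d(2), of 1 "length r - 1"] by simp
  qed
  have r1_set: "r1 \<in> set r" using path_edges_set er by metis
  have r1_hd: "r1 \<noteq> hd r" using er path_edges_hd d by metis
  have r1l: "r1 \<notin> set l"
  proof
    assume "r1 \<in> set l"
    then obtain a b where "(a, r1) \<in> path_edges l" "(r1, b) \<in> path_edges l"
      using path_edges_next[of r1 l] path_edges_prev[of r1 l] r1_hd r1_last ends by auto
    moreover obtain c where "(r1, c) \<in> path_edges r" using path_edges_next[OF r1_set r1_last] by blast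
    ultimately show False using face_paths_disjoint[OF f, of a r1 b "hd r" c] E unfolding le re by auto
  qed
  have up: "sorted_wrt (\<lambda>a b. \<pi> a < \<pi> b) p" if "path_edges p \<subseteq> E" for p
    using that mono by (intro sorted_wrt_path_edges) auto
  have lV: "set l \<subseteq> V"
  proof
    fix x assume x: "x \<in> set l"
    show "x \<in> V"
      using path_edges_prev[OF x] v(1) ends le EV by fastforce
  qed
  have "\<pi> r1 < \<pi> (last l)"
  proof -
    have "sorted_wrt (\<lambda>a b. \<pi> a < \<pi> b) (butlast r @ [last r])" using up[of r] re d by simp
    moreover have "r1 \<in> set (butlast r)" using r1_set r1_last d(6) append_butlast_last_id[of r] 
      by (metis (no_types, lifting) Un_iff empty_iff insert_iff list.set set_append)
    ultimately show ?thesis using ends by (simp add: sorted_wrt_append)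
  qed
  moreover have "\<pi> (hd l) < \<pi> r1" using mono E ends by auto
  moreover have "\<forall>x \<in> set l. \<pi> x \<noteq> \<pi> r1" using r1l lV inj v(2) by (metis inj_onD subsetD)
  ultimately obtain x y where xy: "(x, y) \<in> path_edges l" "\<pi> x < \<pi> r1" "\<pi> r1 < \<pi> y"
    using path_between[OF d(5)] by blast
  have "x \<noteq> hd r" using path_edges_out[OF d(1) el, of y] xy lt by auto
  moreover have "sorted_wrt (\<lambda>a b. \<pi> a < \<pi> b) (hd l # tl l)" using up[of l] le d by simp
  moreover have "x \<in> set (hd l # tl l)" using path_edges_set[OF xy(1)] d by simp
  ultimately have "\<pi> (hd r) < \<pi> x" using ends by auto
  then show False using nc[OF R(2), of x y] xy lR by auto
qed

end

section \<open>One order that respects all faces\<close>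

context merged_faces
begin

definition constraints :: "'a rel" where
  "constraints = E \<union> {(x, y). \<exists>f \<in> inner. x \<in> fverts f \<and> y \<in> fverts f \<and> \<rho> f x < \<rho> f y}"

text \<open>A nonempty proper \<open>D\<close> contains \<open>s\<close>, which reaches everything,
  and misses \<open>t\<close>, which everything reaches, so \<open>ex_ready\<close> applies. The
  empty set is followed by \<open>s\<close>, which has no predecessor and has the least rank in each
  face containing it.\<close>

lemma constraints_step:
  assumes D: "D \<subseteq> V" "D \<noteq> V" and cl: "\<forall>(x, y) \<in> constraints. y \<in> D \<longrightarrow> x \<in> D"
  shows "\<exists>v \<in> V - D. \<forall>x. (x, v) \<in> constraints \<longrightarrow> x \<in> D"
proof (cases "D = {}")
  case True
  have no: "(x, s) \<notin> E" for x using ins_Nil[OF sV] ins_set[OF sV] by auto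
  have "(x, s) \<notin> constraints" for x
  proof
    assume "(x, s) \<in> constraints"
    then obtain f where f: "f \<in> inner" "x \<in> fverts f" "s \<in> fverts f" "\<rho> f x < \<rho> f s"
      using no by (auto simp: constraints_def)
    have "s \<noteq> hd (lp f)" using rho_hd[OF f(1,2)] f(4) by auto
    then obtain u where "(u, s) \<in> E"
      using path_edges_prev[of s "lp f"] path_edges_prev[of s "rp f"] f(3) inner_path[OF f(1)]
      by (auto simp: fverts_def)
    then show False using no by blast
  qed
  then show ?thesis using True sV by blast
next
  case False
  have E: "u \<in> D" if "(u, v) \<in> E" "v \<in> D" for u v using that cl by (auto simp: constraints_def)
  have down: "u \<in> D" if "(u, v) \<in> E\<^sup>*" "v \<in> D" for u v
    using that by (induction rule: converse_rtrancl_induct) (auto intro: E)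
  have "s \<in> D" using False reach_s down D(1) by blast
  moreover have "t \<notin> D" using reach_t down D by blast
  ultimately have "downset D" using D(1) E by (auto simp: downset_def)
  then have "closed D" using cl unfolding closed_def constraints_def by blast
  then obtain v where "v \<in> V - D" "ready D v" using ex_ready by blast
  then show ?thesis unfolding ready_def constraints_def by blast
qed

end

text \<open>What a single order of all vertices inherits from the rankings of the faces. Apart from
  the bijection onto an interval, this is all that the drawing uses of the constructed
  order.\<close>

locale ordered_faces = st_faces V E L R s t ins outs lf rf outer lp rp
  for V :: "'a set" and E L R s t ins outs
    and lf rf :: "'a \<times> 'a \<Rightarrow> 'f" and outer lp rp +
  fixes \<pi> :: "'a \<Rightarrow> nat"
  assumes pi_inj: "inj_on \<pi> V"
    and pi_mono: "(a, b) \<in> E \<Longrightarrow> \<pi> a < \<pi> b"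
    and pi_l: "f \<in> inner \<Longrightarrow> (a, b) \<in> R \<Longrightarrow> rf (a, b) = f \<Longrightarrow> x \<in> set (rp f) \<Longrightarrow>
      \<not> (\<pi> a < \<pi> x \<and> \<pi> x < \<pi> b)"
    and pi_r: "f \<in> inner \<Longrightarrow> (a, b) \<in> L \<Longrightarrow> lf (a, b) = f \<Longrightarrow> x \<in> set (lp f) \<Longrightarrow>
      \<not> (\<pi> a < \<pi> x \<and> \<pi> x < \<pi> b)"

context st_faces
begin

lemma fverts_V: "f \<in> inner \<Longrightarrow> fverts f \<subseteq> V"
proof
  fix x assume f: "f \<in> inner" and x: "x \<in> fverts f"
  note p = inner_path[OF f]
  have ne: "hd q \<noteq> last q" if "2 \<le> length q" "distinct q" for q :: "'a list"
    using that by (cases q rule: remdups_adj.cases) auto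
  obtain q where q: "directed_path E q" "x \<in> set q" using x p by (auto simp: fverts_def)
  then have "(\<exists>y. (x, y) \<in> path_edges q) \<or> (\<exists>y. (y, x) \<in> path_edges q)"
    using path_edges_next path_edges_prev ne unfolding directed_path_def by metis
  then show "x \<in> V" using directed_path_edges[OF q(1)] EV by blast
qed

theorem ex_ordered:
  assumes NI: "\<And>f. f \<in> inner \<Longrightarrow> \<not> (path_edges (lp f) \<subseteq> R \<and> length (rp f) \<noteq> 2) \<and>
      \<not> (path_edges (rp f) \<subseteq> L \<and> length (lp f) \<noteq> 2)"
  shows "\<exists>\<pi>. bij_betw \<pi> V {1..card V} \<and> ordered_faces V E L R s t ins outs lf rf outer lp rp \<pi>"
proof -
  have "\<forall>f. \<exists>\<rho>. f \<in> inner \<longrightarrow> merge_ok (lp f) (rp f) L R \<rho>" using ex_merge NI by blast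
  then obtain \<rho> where \<rho>: "\<And>f. f \<in> inner \<Longrightarrow> merge_ok (lp f) (rp f) L R (\<rho> f)" by metis
  interpret merged_faces V E L R s t ins outs lf rf outer lp rp \<rho>
  proof
    fix f a b x assume f: "f \<in> inner"
    note p = inner_path(5,6)[OF f]
    note m = \<rho>[OF f, unfolded merge_ok_def p]
    show "inj_on (\<rho> f) (set (lp f) \<union> set (rp f))" using m by blast
    show "\<rho> f a < \<rho> f b" if "(a, b) \<in> E" "lf (a, b) = f \<or> rf (a, b) = f" using m that by blast
    show "\<not> (\<rho> f a < \<rho> f x \<and> \<rho> f x < \<rho> f b)"
      if "(a, b) \<in> R" "rf (a, b) = f" "x \<in> set (rp f)" using m that E_eq by blast
    show "\<not> (\<rho> f a < \<rho> f x \<and> \<rho> f x < \<rho> f b)"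
      if "(a, b) \<in> L" "lf (a, b) = f" "x \<in> set (lp f)" using m that E_eq by blast
  qed
  have "\<exists>\<pi> :: 'a \<Rightarrow> nat. bij_betw \<pi> V {1..card V} \<and> (\<forall>(x, y) \<in> constraints. y \<in> V \<longrightarrow> \<pi> x < \<pi> y)"
    by (rule linear_extension[OF finV constraints_step])
  then obtain \<pi> :: "'a \<Rightarrow> nat" where pi: "bij_betw \<pi> V {1..card V}"
    "\<And>x y. (x, y) \<in> constraints \<Longrightarrow> y \<in> V \<Longrightarrow> \<pi> x < \<pi> y" by blast
  have mono: "\<pi> a < \<pi> b" if "(a, b) \<in> E" for a b using pi(2)[of a b] that EV by (auto simp: constraints_def)
  \<comment> \<open>A face ranking is total on the vertices of its face and all its pairs are
    constraints, so \<open>\<pi>\<close> induces exactly this ranking there.\<close>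
  have less: "\<rho> f x < \<rho> f y" if f: "f \<in> inner" and x: "x \<in> fverts f" "y \<in> fverts f" and l: "\<pi> x < \<pi> y" for f x y
  proof (rule ccontr)
    assume "\<not> \<rho> f x < \<rho> f y"
    moreover have "x \<noteq> y" using l by auto
    then have "\<rho> f x \<noteq> \<rho> f y" using rho_inj[OF f] x unfolding fverts_def by (metis inj_onD)
    ultimately have "\<rho> f y < \<rho> f x" by simp
    then have "(y, x) \<in> constraints" using f x by (auto simp: constraints_def)
    then have "\<pi> y < \<pi> x" using pi(2) x fverts_V[OF f] by blast
    then show False using l by simp
  qed
  have "ordered_faces V E L R s t ins outs lf rf outer lp rp \<pi>"
  proof
    show "inj_on \<pi> V" using pi(1) by (simp add: bij_betw_def)
    show "(a, b) \<in> E \<Longrightarrow> \<pi> a < \<pi> b" for a b by (rule mono)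
    show "\<not> (\<pi> a < \<pi> x \<and> \<pi> x < \<pi> b)"
      if "f \<in> inner" "(a, b) \<in> R" "rf (a, b) = f" "x \<in> set (rp f)" for f a b x
      using rho_l[OF that] less[OF that(1), of a x] less[OF that(1), of x b] that fverts_edge(1)[OF that(1), of a b] E_eq
      unfolding fverts_def by blast
    show "\<not> (\<pi> a < \<pi> x \<and> \<pi> x < \<pi> b)"
      if "f \<in> inner" "(a, b) \<in> L" "lf (a, b) = f" "x \<in> set (lp f)" for f a b x
      using rho_r[OF that] less[OF that(1), of a x] less[OF that(1), of x b] that fverts_edge(2)[OF that(1), of a b] E_eq
      unfolding fverts_def by blast
  qed
  then show ?thesis using pi(1) by blast
qed

end

section \<open>The edges met by a horizontal line\<close>

context ordered_faces
begin

text \<open>With \<open>\<pi>\<close> as the ranking of every face, its initial segments between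
  \<open>s\<close> and \<open>t\<close> are closed sets, which makes the theory of cuts available at
  every height.\<close>

sublocale merged_faces V E L R s t ins outs lf rf outer lp rp "\<lambda>_. \<pi>"
proof
  fix f a b x assume f: "f \<in> inner"
  show "inj_on \<pi> (set (lp f) \<union> set (rp f))"
    using fverts_V[OF f] pi_inj inj_on_subset unfolding fverts_def by blast
qed (use pi_mono pi_l pi_r in auto)

lemma ordered_mirror:
  "ordered_faces V E R L s t (\<lambda>v. rev (ins v)) (\<lambda>v. rev (outs v)) rf lf outer rp lp \<pi>"
proof -
  interpret m: st_faces V E R L s t "\<lambda>v. rev (ins v)" "\<lambda>v. rev (outs v)" rf lf outer rp lp
    by (rule mirror)
  have i: "m.inner = inner" by (auto simp: m.inner_def inner_def)
  show ?thesis
    by unfold_locales (use pi_inj pi_mono pi_l pi_r in \<open>auto simp: i\<close>)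
qed

text \<open>The cut of \<open>lower i\<close> lists from west to east the edges met by a horizontal
  line between the heights \<open>i\<close> and \<open>i + 1\<close>.\<close>

definition lower :: "nat \<Rightarrow> 'a set" where "lower i = {v \<in> V. \<pi> v \<le> i}"

lemma pi_rtrancl: "(a, b) \<in> E\<^sup>* \<Longrightarrow> \<pi> a \<le> \<pi> b"
  by (induction rule: rtrancl_induct) (auto dest: pi_mono)

lemma edge_range: "(a, b) \<in> E \<Longrightarrow> \<pi> s \<le> \<pi> a \<and> \<pi> a < \<pi> b \<and> \<pi> b \<le> \<pi> t"
  using pi_rtrancl[OF reach_s, of a] pi_rtrancl[OF reach_t, of b] pi_mono[of a b] EV by auto

lemma closed_lower: "\<pi> s \<le> i \<Longrightarrow> i < \<pi> t \<Longrightarrow> closed (lower i)"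
  unfolding closed_def downset_def
proof (intro conjI)
  assume i: "\<pi> s \<le> i" "i < \<pi> t"
  show "\<forall>(u, v) \<in> E. v \<in> lower i \<longrightarrow> u \<in> lower i"
  proof clarify
    fix u v assume "(u, v) \<in> E" "v \<in> lower i"
    then show "u \<in> lower i" using pi_mono[of u v] EV by (auto simp: lower_def)
  qed
  show "\<forall>f \<in> inner. \<forall>x \<in> fverts f. \<forall>y \<in> fverts f. \<pi> x < \<pi> y \<longrightarrow> y \<in> lower i \<longrightarrow> x \<in> lower i"
    using fverts_V unfolding lower_def by fastforce
qed (use sV tV in \<open>auto simp: lower_def\<close>)

lemma level_cut:
  assumes "\<pi> s \<le> i" "i < \<pi> t"
  shows "\<exists>A B. cut (lower i) (A @ B) \<and> set A \<subseteq> L \<and> set B \<subseteq> R"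
proof -
  have "downset (lower i)" using closed_lower[OF assms] by (simp add: closed_def)
  then show ?thesis using ex_cut cut_parts[OF closed_lower[OF assms]] by metis
qed

lemma level_cut_mem:
  "cut (lower i) C \<Longrightarrow> (a, b) \<in> set C \<longleftrightarrow> (a, b) \<in> E \<and> \<pi> a \<le> i \<and> i < \<pi> b"
  using EV by (auto simp: cut_mem lower_def)

text \<open>Both ends of \<open>(a, b)\<close> are on the left path of the common face, and the left
  edge \<open>(c, d)\<close> on its right path encloses neither of them. As both edges pass the
  level \<open>i\<close>, the second is nested in the first.\<close>

lemma level_adj:
  assumes C: "cut (lower i) C" and e: "((a, b), (c, d)) \<in> path_edges C" and L: "(c, d) \<in> L"
  shows "\<pi> a \<le> \<pi> c \<and> \<pi> d \<le> \<pi> b"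
proof -
  note h = cut_adjD[OF C e]
  have i: "\<pi> a \<le> i" "i < \<pi> b" "\<pi> c \<le> i" "i < \<pi> d" using level_cut_mem[OF C] path_edges_set[OF e] by auto
  have "a \<in> set (lp (rf (a, b)))" "b \<in> set (lp (rf (a, b)))" using fverts_edge(1)[OF h(7,1)] by auto
  then show ?thesis using pi_r[OF h(7) L h(8), of a] pi_r[OF h(7) L h(8), of b] i by auto
qed

lemma level_nested:
  assumes C: "cut (lower i) (A @ B)" and A: "set A \<subseteq> L"
  shows "sorted_wrt (\<lambda>e e'. \<pi> (fst e) \<le> \<pi> (fst e') \<and> \<pi> (snd e') \<le> \<pi> (snd e)) A"
proof -
  have "transp (\<lambda>e e'. \<pi> (fst e) \<le> \<pi> (fst e') \<and> \<pi> (snd e') \<le> \<pi> (snd e))"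
    by (auto intro: transpI)
  moreover have "successively (\<lambda>e e'. \<pi> (fst e) \<le> \<pi> (fst e') \<and> \<pi> (snd e') \<le> \<pi> (snd e)) A"
    unfolding successively_iff_path_edges
  proof clarify
    fix a b c d assume e: "((a, b), (c, d)) \<in> path_edges A"
    then have "((a, b), (c, d)) \<in> path_edges (A @ B)" by (simp add: path_edges_append)
    then show "\<pi> (fst (a, b)) \<le> \<pi> (fst (c, d)) \<and> \<pi> (snd (c, d)) \<le> \<pi> (snd (a, b))"
      using level_adj[OF C] path_edges_set[OF e] A by auto
  qed
  ultimately show ?thesis by (simp add: successively_conv_sorted_wrt)
qed

text \<open>Both edges are in the left part of the cut at level \<open>i\<close>, which is ordered
  by nesting.\<close>

lemma L_nested:
  assumes e: "(a, b) \<in> L" "(c, d) \<in> L" and i: "\<pi> a \<le> i" "i < \<pi> b" "\<pi> c \<le> i" "i < \<pi> d"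
  shows "\<pi> a \<le> \<pi> c \<and> \<pi> d \<le> \<pi> b \<or> \<pi> c \<le> \<pi> a \<and> \<pi> b \<le> \<pi> d"
proof -
  have E: "(a, b) \<in> E" "(c, d) \<in> E" using e E_eq by auto
  obtain A B where AB: "cut (lower i) (A @ B)" "set A \<subseteq> L" "set B \<subseteq> R"
    using level_cut[of i] edge_range[OF E(1)] i by (meson order.trans less_le_trans)
  have "(a, b) \<in> set (A @ B)" "(c, d) \<in> set (A @ B)" using level_cut_mem[OF AB(1)] E i by auto
  then have "(a, b) \<in> set A" "(c, d) \<in> set A" using AB e LR by auto
  then obtain j k where "j < length A" "A ! j = (a, b)" "k < length A" "A ! k = (c, d)" by (metis in_set_conv_nth)
  then show ?thesis using sorted_wrt_nth_less[OF level_nested[OF AB(1,2)], of j k]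
      sorted_wrt_nth_less[OF level_nested[OF AB(1,2)], of k j] by (cases j k rule: linorder_cases) auto
qed

lemma no_cross_L:
  "(a, b) \<in> L \<Longrightarrow> (c, d) \<in> L \<Longrightarrow> \<pi> a < \<pi> c \<Longrightarrow> \<pi> c < \<pi> b \<Longrightarrow> \<pi> b < \<pi> d \<Longrightarrow> False"
  using L_nested[of a b c d "\<pi> c"] by auto

lemma no_cross_R:
  "(a, b) \<in> R \<Longrightarrow> (c, d) \<in> R \<Longrightarrow> \<pi> a < \<pi> c \<Longrightarrow> \<pi> c < \<pi> b \<Longrightarrow> \<pi> b < \<pi> d \<Longrightarrow> False"
proof -
  interpret m: ordered_faces V E R L s t "\<lambda>v. rev (ins v)" "\<lambda>v. rev (outs v)" rf lf outer rp lp \<pi>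
    by (rule ordered_mirror)
  show "(a, b) \<in> R \<Longrightarrow> (c, d) \<in> R \<Longrightarrow> \<pi> a < \<pi> c \<Longrightarrow> \<pi> c < \<pi> b \<Longrightarrow> \<pi> b < \<pi> d \<Longrightarrow> False" by (rule m.no_cross_L)
qed

text \<open>The face between the two edges has \<open>x\<close> on its left path and the left edge
  \<open>(v, y)\<close> on its right path, so \<open>x\<close> is not below \<open>y\<close>. Read
  clockwise, left semicircles going up from \<open>v\<close> become shorter.\<close>

lemma outs_order_L:
  assumes v: "v \<in> V" and xy: "(x, y) \<in> path_edges (outs v)" and L: "(v, y) \<in> L"
  shows "\<pi> y < \<pi> x"
proof -
  have E: "(v, x) \<in> E" "(v, y) \<in> E" using path_edges_set[OF xy] outs_set[OF v] by auto
  note adj = outs_adj[OF v xy]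
  have f: "rf (v, x) \<in> inner" using innerI[OF E(1)] adj by blast
  have "x \<in> set (lp (rf (v, x)))" using fverts_edge(1)[OF f E(1)] by auto
  then have "\<pi> y \<le> \<pi> x" using pi_r[OF f L] adj pi_mono[OF E(1)] by fastforce
  moreover have "x \<noteq> y" using path_edges_in outs_dist[OF v] xy
    by (metis path_edges_iff distinct_append distinct_length_2_or_more)
  ultimately show ?thesis using pi_inj E EV by (metis inj_onD le_neq_implies_less mem_Sigma_iff subsetD)
qed

lemma ins_order_L:
  assumes v: "v \<in> V" and xy: "(x, y) \<in> path_edges (ins v)" and L: "(y, v) \<in> L"
  shows "\<pi> x < \<pi> y"
proof -
  have E: "(x, v) \<in> E" "(y, v) \<in> E" using path_edges_set[OF xy] ins_set[OF v] by auto
  note adj = ins_adj[OF v xy]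
  have f: "rf (x, v) \<in> inner" using innerI[OF E(1)] adj by blast
  have "x \<in> set (lp (rf (x, v)))" using fverts_edge(1)[OF f E(1)] by auto
  then have "\<pi> x \<le> \<pi> y" using pi_r[OF f L] adj pi_mono[OF E(1)] by fastforce
  moreover have "x \<noteq> y" using path_edges_in ins_dist[OF v] xy
    by (metis path_edges_iff distinct_append distinct_length_2_or_more)
  ultimately show ?thesis using pi_inj E EV by (metis inj_onD le_neq_implies_less mem_Sigma_iff subsetD)
qed

lemma outs_order_R: "v \<in> V \<Longrightarrow> (x, y) \<in> path_edges (outs v) \<Longrightarrow> (v, x) \<in> R \<Longrightarrow> \<pi> x < \<pi> y"
proof -
  interpret m: ordered_faces V E R L s t "\<lambda>v. rev (ins v)" "\<lambda>v. rev (outs v)" rf lf outer rp lp \<pi>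
    by (rule ordered_mirror)
  show "v \<in> V \<Longrightarrow> (x, y) \<in> path_edges (outs v) \<Longrightarrow> (v, x) \<in> R \<Longrightarrow> \<pi> x < \<pi> y"
    by (rule m.outs_order_L) (auto simp: path_edges_rev)
qed

lemma ins_order_R: "v \<in> V \<Longrightarrow> (x, y) \<in> path_edges (ins v) \<Longrightarrow> (x, v) \<in> R \<Longrightarrow> \<pi> y < \<pi> x"
proof -
  interpret m: ordered_faces V E R L s t "\<lambda>v. rev (ins v)" "\<lambda>v. rev (outs v)" rf lf outer rp lp \<pi>
    by (rule ordered_mirror)
  show "v \<in> V \<Longrightarrow> (x, y) \<in> path_edges (ins v) \<Longrightarrow> (x, v) \<in> R \<Longrightarrow> \<pi> y < \<pi> x"
    by (rule m.ins_order_L) (auto simp: path_edges_rev)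
qed

lemma outer_first:
  assumes "cut D C" "e \<in> set C" "lf e = outer"
  shows "e = hd C"
proof (rule ccontr)
  assume "e \<noteq> hd C"
  then obtain e' where "(e', e) \<in> path_edges C" using path_edges_prev assms by metis
  then show False using assms by (auto simp: cut_def)
qed

text \<open>An edge with the outer face on its left is the first one in the cut at every level that
  it passes, and the left edges after it are nested in it.\<close>

lemma outer_left_L:
  assumes e: "(u, v) \<in> L" "lf (u, v) = outer" and cd: "(c, d) \<in> L" "\<pi> c \<le> \<pi> u" "\<pi> v \<le> \<pi> d"
  shows "(c, d) = (u, v)"
proof -
  have E: "(u, v) \<in> E" "(c, d) \<in> E" using e cd E_eq by auto
  note ran = edge_range[OF E(1)] edge_range[OF E(2)]
  obtain A B where AB: "cut (lower (\<pi> u)) (A @ B)" "set A \<subseteq> L" "set B \<subseteq> R"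
    using level_cut[of "\<pi> u"] ran by auto
  have m: "(u, v) \<in> set (A @ B)" "(c, d) \<in> set (A @ B)"
    using level_cut_mem[OF AB(1)] E cd ran by auto
  then have m': "(u, v) \<in> set A" "(c, d) \<in> set A" using AB e cd LR by auto
  then obtain A' where A: "A = (u, v) # A'" using outer_first[OF AB(1) m(1) e(2)] by (cases A) auto
  show ?thesis
  proof (rule ccontr)
    assume ne: "(c, d) \<noteq> (u, v)"
    then have "(c, d) \<in> set A'" using m' A by auto
    then have "\<pi> u \<le> \<pi> c \<and> \<pi> d \<le> \<pi> v" using level_nested[OF AB(1,2)] A by auto
    then have "\<pi> c = \<pi> u" "\<pi> d = \<pi> v" using cd by auto
    then show False using ne pi_inj E EV by (auto dest: inj_onD)
  qed
qed

text \<open>West of the apex of a right edge is the region under its semicircle, so the view to the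
  west is free only if no left edge spans the edge and no vertex lies between its ends. At each
  level that it passes, the edge comes first in the cut, which therefore has no left edges. The
  edges into a vertex \<open>w\<close> at an intermediate height would form a block of the cut just
  below \<open>w\<close>; the right edge before this block has \<open>w\<close> on the right path of
  the face to its right, and encloses \<open>w\<close>.\<close>

lemma outer_left_R:
  assumes e: "(u, v) \<in> R" "lf (u, v) = outer"
  shows "w \<in> V \<Longrightarrow> \<not> (\<pi> u < \<pi> w \<and> \<pi> w < \<pi> v)"
    and "(c, d) \<in> L \<Longrightarrow> \<not> (\<pi> c \<le> \<pi> u \<and> \<pi> v \<le> \<pi> d)"
proof -
  have E: "(u, v) \<in> E" using e E_eq by auto
  note ran = edge_range[OF E]
  have hd: "A = []" if "cut (lower i) (A @ B)" "set A \<subseteq> L" "\<pi> u \<le> i" "i < \<pi> v" for A B i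
  proof (rule ccontr)
    assume "A \<noteq> []"
    then have "hd (A @ B) \<in> L" using that by auto
    moreover have "(u, v) \<in> set (A @ B)" using level_cut_mem[OF that(1)] E that by auto
    then have "(u, v) = hd (A @ B)" using outer_first[OF that(1) _ e(2)] by blast
    ultimately show False using e LR by auto
  qed
  have noL: False if n: "(c, d) \<in> L" "\<pi> u \<le> i" "i < \<pi> v" "\<pi> c \<le> i" "i < \<pi> d" for c d i
  proof -
    obtain A B where AB: "cut (lower i) (A @ B)" "set A \<subseteq> L" "set B \<subseteq> R"
      using level_cut[of i] ran n by auto
    have "A = []" using hd AB n by blast
    moreover have "(c, d) \<in> set (A @ B)" using level_cut_mem[OF AB(1)] n E_eq by auto
    ultimately show False using AB n LR by auto
  qed
  show "\<not> (\<pi> c \<le> \<pi> u \<and> \<pi> v \<le> \<pi> d)" if "(c, d) \<in> L" using noL[OF that, of "\<pi> u"] ran by auto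
  show "\<not> (\<pi> u < \<pi> w \<and> \<pi> w < \<pi> v)" if w: "w \<in> V"
  proof
    assume uwv: "\<pi> u < \<pi> w \<and> \<pi> w < \<pi> v"
    \<comment> \<open>The level just below \<open>w\<close>. The subtraction is not truncated since
      \<open>\<pi> w\<close> exceeds \<open>\<pi> u\<close>.\<close>
    define i where "i = \<pi> w - 1"
    have i: "\<pi> u \<le> i" "i < \<pi> w" "i < \<pi> v" "\<And>x. \<pi> x < \<pi> w \<Longrightarrow> \<pi> x \<le> i" using uwv by (auto simp: i_def)
    obtain A B where AB: "cut (lower i) (A @ B)" "set A \<subseteq> L" "set B \<subseteq> R"
      using level_cut[of i] ran i by auto
    have "A = []" using hd[OF AB(1,2) i(1,3)] .
    then have B: "cut (lower i) B" using AB by simp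
    have uB: "(u, v) \<in> set B" using level_cut_mem[OF B] E i by auto
    then have hdB: "(u, v) = hd B" by (rule outer_first[OF B _ e(2)])
    have wl: "w \<notin> lower i" using i by (auto simp: lower_def)
    have ws: "w \<noteq> s" using ran uwv by auto
    have cl: "downset (lower i)" using closed_lower[of i] ran i by (auto simp: closed_def)
    obtain X Y where XY: "B = X @ map (\<lambda>u. (u, w)) (ins w) @ Y"
      using cut_step[OF cl B w wl] pi_mono i(4) EV unfolding lower_def by blast
    have ne: "ins w \<noteq> []" using ins_Nil w ws by auto
    have "v \<noteq> w" using uwv by auto
    then have "X \<noteq> []" using hdB XY ne by (cases "ins w") auto
    then have adj: "(last X, (hd (ins w), w)) \<in> path_edges B"
      unfolding XY path_edges_append using ne by (auto simp: hd_map)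
    obtain c d where cd: "last X = (c, d)" by fastforce
    note h = cut_adjD[OF B adj[unfolded cd]]
    have "(c, d) \<in> R" using AB(3) path_edges_set[OF adj] cd by auto
    moreover have "w \<in> set (rp (rf (c, d)))" using fverts_edge(2)[OF h(7,2,8)] by auto
    moreover have "\<pi> c \<le> i" "i < \<pi> d" using level_cut_mem[OF B] path_edges_set[OF adj] cd by auto
    moreover have "d \<noteq> w"
    proof
      assume "d = w"
      then have "last X \<in> set (map (\<lambda>u. (u, w)) (ins w))" using cd h ins_set[OF w] by auto
      moreover have "distinct B" using B by (simp add: cut_def)
      ultimately show False using XY last_in_set[OF \<open>X \<noteq> []\<close>] by auto
    qed
    then have "\<pi> d \<noteq> \<pi> w" using pi_inj h(1) w EV by (metis inj_onD mem_Sigma_iff subsetD)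
    ultimately show False using pi_l[OF h(7), of c d w] i(2) i(4)[of d] by auto
  qed
qed

end

section \<open>Faces of a bimodal plane st-graph\<close>

lemma cyc_next_append: "x \<notin> set p \<Longrightarrow> cyc_next (p @ x # q) x = hd (q @ p @ [x])"
proof -
  assume "x \<notin> set p"
  then have "dropWhile (\<lambda>y. y \<noteq> x) (p @ x # q) = x # q" by (induction p) auto
  then show ?thesis unfolding cyc_next_def by (cases q; cases p) auto
qed

lemma cyc_next_path_edges: "distinct xs \<Longrightarrow> (x, y) \<in> path_edges xs \<Longrightarrow> cyc_next xs x = y"
  by (auto simp: path_edges_iff cyc_next_append)

lemma cyc_next_last: "distinct xs \<Longrightarrow> xs \<noteq> [] \<Longrightarrow> cyc_next xs (last xs) = hd xs"
  by (cases xs rule: rev_cases) (auto simp: cyc_next_append hd_append)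

lemma cyc_next_cases:
  assumes "distinct xs" "x \<in> set xs"
  shows "(x, cyc_next xs x) \<in> path_edges xs \<or> x = last xs \<and> cyc_next xs x = hd xs"
  using assms path_edges_next[of x xs] cyc_next_path_edges[of xs x] cyc_next_last[of xs] by fastforce

lemma cyc_next_rotate1: "distinct xs \<Longrightarrow> x \<in> set xs \<Longrightarrow> cyc_next (rotate1 xs) x = cyc_next xs x"
proof (cases xs)
  case (Cons a ys)
  assume d: "distinct xs" "x \<in> set xs"
  show ?thesis
  proof (cases "x = a")
    case True
    then show ?thesis using Cons d cyc_next_append[of a ys "[]"] cyc_next_append[of a "[]" ys] by simp
  next
    case False
    then obtain p q where "ys = p @ x # q" "x \<notin> set p" using d Cons by (metis set_ConsD split_list_first)
    then show ?thesis using Cons False cyc_next_append[of x p "q @ [a]"] cyc_next_append[of x "a # p" q]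
      by (cases q) auto
  qed
qed simp

lemma cyc_next_rotate: "distinct xs \<Longrightarrow> x \<in> set xs \<Longrightarrow> cyc_next (rotate k xs) x = cyc_next xs x"
  by (induction k) (auto simp: cyc_next_rotate1)

lemma cyc_next_in: "distinct xs \<Longrightarrow> x \<in> set xs \<Longrightarrow> cyc_next xs x \<in> set xs"
  using cyc_next_cases[of xs x] path_edges_set[of x "cyc_next xs x" xs] by (metis hd_in_set length_pos_if_in_set list.size(3) less_irrefl)

text \<open>Every member is the successor of some member, so the map is onto a finite set and hence
  injective.\<close>

lemma cyc_next_inj: "distinct xs \<Longrightarrow> inj_on (cyc_next xs) (set xs)"
proof (rule eq_card_imp_inj_on)
  assume d: "distinct xs"
  have "cyc_next xs ` set xs = set xs"
  proof
    show "cyc_next xs ` set xs \<subseteq> set xs" using cyc_next_in[OF d] by auto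
    show "set xs \<subseteq> cyc_next xs ` set xs"
    proof
      fix y assume y: "y \<in> set xs"
      show "y \<in> cyc_next xs ` set xs"
      proof (cases "y = hd xs")
        case True
        then have "y = cyc_next xs (last xs)" using cyc_next_last[OF d] y by fastforce
        then show ?thesis using y by (metis empty_iff imageI last_in_set list.set(1))
      next
        case False
        then obtain x where x: "(x, y) \<in> path_edges xs" using path_edges_prev[OF y] by blast
        then show ?thesis using cyc_next_path_edges[OF d x] path_edges_set[OF x] by blast
      qed
    qed
  qed
  then show "card (cyc_next xs ` set xs) = card (set xs)" by simp
qed simp

text \<open>The rotation at \<open>v\<close> is cut open so that the outgoing edges come first.
  Clockwise order runs through the outgoing edges from left to right and through the incoming edges
  from right to left. At \<open>s\<close> and \<open>t\<close> one list is empty and every shift has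
  this form; \<open>s_dart\<close> and \<open>t_dart\<close> place the cut at the large
  angle.\<close>

locale bimodal =
  fixes V :: "'a set" and E :: "'a rel" and s t :: 'a and rot outer
    and outs cin :: "'a \<Rightarrow> 'a list"
  assumes plane: "plane_st_graph V E s t rot outer"
    and bim: "v \<in> V \<Longrightarrow> \<exists>k. rotate k (rot v) = outs v @ cin v"
    and outs_set: "v \<in> V \<Longrightarrow> set (outs v) = {w. (v, w) \<in> E}"
    and cin_set: "v \<in> V \<Longrightarrow> set (cin v) = {u. (u, v) \<in> E}"
    and s_dart: "(s, hd (outs s)) \<in> outer"
    and t_dart: "(t, hd (cin t)) \<in> outer"
begin

text \<open>Rotation by a half turn, which preserves the clockwise orders and the faces.\<close>

lemma dual: "bimodal V (E\<inverse>) t s rot outer cin outs"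
proof
  have d: "darts (E\<inverse>) = darts E" by (auto simp: darts_def)
  have "{v \<in> V. is_source (E\<inverse>) v} = {v \<in> V. is_sink E v}" "{v \<in> V. is_sink (E\<inverse>) v} = {v \<in> V. is_source E v}"
    by (auto simp: is_source_def is_sink_def)
  moreover have "rotation_system V (E\<inverse>) rot \<longleftrightarrow> rotation_system V E rot"
    unfolding rotation_system_def by (simp add: disj_commute)
  ultimately show "plane_st_graph V (E\<inverse>) t s rot outer"
    using plane unfolding plane_st_graph_def faces_def d by auto
  show "\<exists>k. rotate k (rot v) = cin v @ outs v" if v: "v \<in> V" for v
  proof -
    obtain k where k: "rotate k (rot v) = outs v @ cin v" using bim[OF v] by blast
    have "rotate (length (outs v)) (rotate k (rot v)) = cin v @ outs v" unfolding k by (rule rotate_append)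
    then show ?thesis by (auto simp: rotate_rotate)
  qed
qed (use outs_set cin_set s_dart t_dart in auto)

lemma basic:
  shows "finite V" "E \<subseteq> V \<times> V" "acyclic E" "s \<noteq> t" "s \<in> V" "t \<in> V"
    "card V + card (faces E rot) = card E + 2" "outer \<in> faces E rot" "finite E"
proof -
  show *: "finite V" "E \<subseteq> V \<times> V" "acyclic E" "s \<noteq> t"
    "card V + card (faces E rot) = card E + 2" "outer \<in> faces E rot"
    using plane by (auto simp: plane_st_graph_def)
  have "{v \<in> V. is_source E v} = {s}" "{v \<in> V. is_sink E v} = {t}" using plane by (auto simp: plane_st_graph_def)
  then show "s \<in> V" "t \<in> V" by auto
  show "finite E" using * finite_subset by blast
qed

lemma cin_Nil: "v \<in> V \<Longrightarrow> cin v = [] \<longleftrightarrow> v = s"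
proof -
  assume v: "v \<in> V"
  have "{v \<in> V. is_source E v} = {s}" using plane by (auto simp: plane_st_graph_def)
  then have "is_source E v \<longleftrightarrow> v = s" using v by auto
  then show ?thesis using cin_set[OF v] by (auto simp: is_source_def simp flip: set_empty)
qed

lemma outs_Nil: "v \<in> V \<Longrightarrow> outs v = [] \<longleftrightarrow> v = t"
proof -
  interpret d: bimodal V "E\<inverse>" t s rot outer cin outs by (rule dual)
  show "v \<in> V \<Longrightarrow> outs v = [] \<longleftrightarrow> v = t" by (rule d.cin_Nil)
qed

section \<open>Faces as cycles of a permutation of the darts\<close>

abbreviation "step \<equiv> face_step rot"
abbreviation "face \<equiv> orbit step"

lemma rot_facts:
  assumes "v \<in> V"
  shows "distinct (outs v @ cin v)" "set (rot v) = set (outs v) \<union> set (cin v)"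
    "x \<in> set (rot v) \<Longrightarrow> cyc_next (rot v) x = cyc_next (outs v @ cin v) x"
proof -
  obtain k where k: "rotate k (rot v) = outs v @ cin v" using bim[OF assms] by blast
  have d: "distinct (rot v)" using plane assms by (auto simp: plane_st_graph_def rotation_system_def)
  then show "distinct (outs v @ cin v)" by (metis k distinct_rotate)
  show "set (rot v) = set (outs v) \<union> set (cin v)" by (metis k set_append set_rotate)
  show "x \<in> set (rot v) \<Longrightarrow> cyc_next (rot v) x = cyc_next (outs v @ cin v) x"
    using cyc_next_rotate[OF d, of x k] k by simp
qed

lemma dart_V: "(u, v) \<in> darts E \<Longrightarrow> v \<in> V \<and> u \<in> set (rot v) \<and> u \<in> V"
  using basic(2) rot_facts(2)[of v] outs_set[of v] cin_set[of v] by (auto simp: darts_def)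

lemma step_pair: "step (u, v) = (v, cyc_next (rot v) u)" by (simp add: face_step_def)

lemma fst_step: "fst (step d) = snd d" by (cases d) (simp add: step_pair)

lemma step_in: "d \<in> darts E \<Longrightarrow> step d \<in> darts E"
proof -
  assume d: "d \<in> darts E"
  obtain u v where uv: "d = (u, v)" by (cases d)
  note v = dart_V[OF d[unfolded uv]]
  have "cyc_next (rot v) u \<in> set (rot v)" using v rot_facts[of v] cyc_next_in[of "outs v @ cin v" u] by auto
  then show ?thesis using v rot_facts(2)[of v] outs_set[of v] cin_set[of v] by (auto simp: uv step_pair darts_def)
qed

lemma step_inj: "inj_on step (darts E)"
proof (rule inj_onI)
  fix d e assume d: "d \<in> darts E" and e: "e \<in> darts E" and eq: "step d = step e"
  obtain u v u' v' where uv: "d = (u, v)" "e = (u', v')" by (cases d; cases e)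
  have v: "v' = v" "cyc_next (rot v) u = cyc_next (rot v) u'" using eq by (auto simp: uv step_pair)
  note h = dart_V[OF d[unfolded uv]] dart_V[OF e[unfolded uv]]
  then have "u = u'"
    using v rot_facts[of v] cyc_next_inj[of "outs v @ cin v"] unfolding inj_on_def by auto
  then show "d = e" using uv v by simp
qed

lemma finite_darts: "finite (darts E)" using basic(9) by (simp add: darts_def)

text \<open>Extended by the identity to a permutation of the whole type, to which the general facts
  on orbits apply.\<close>

definition "step' d = (if d \<in> darts E then step d else d)"

lemma step'_permutes: "step' permutes darts E"
proof (rule bij_imp_permutes)
  have "step' ` darts E = step ` darts E" "inj_on step' (darts E)"
    using step_inj by (auto simp: step'_def inj_on_def)
  moreover have "step ` darts E = darts E"
    using step_in step_inj finite_darts by (intro endo_inj_surj) auto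
  ultimately show "bij_betw step' (darts E) (darts E)" by (simp add: bij_betw_def)
qed (simp add: step'_def)

lemma face_step': "d \<in> darts E \<Longrightarrow> face d = orbit step' d"
  by (rule orbit_cong0) (auto simp: step'_def step_in)

lemma perm: "permutation step'"
  using step'_permutes finite_darts permutation_permutes by blast

lemma face_sub: "d \<in> darts E \<Longrightarrow> face d \<subseteq> darts E"
  using permutes_orbit_subset[OF step'_permutes] face_step' by simp

lemma face_self: "d \<in> darts E \<Longrightarrow> d \<in> face d"
  using permutation_self_in_orbit[OF perm] face_step' by simp

lemma face_eq: "d \<in> darts E \<Longrightarrow> e \<in> face d \<Longrightarrow> face e = face d"
  using orbit_cyclic_eq3[OF cyclic_on_orbit'[OF perm]] face_step' face_sub by (metis subsetD)

lemma face_step: "d \<in> darts E \<Longrightarrow> face (step d) = face d"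
  by (rule face_eq) (auto intro: orbit.intros)

lemma faces_mem: "f \<in> faces E rot \<Longrightarrow> d \<in> f \<longleftrightarrow> d \<in> darts E \<and> face d = f"
  unfolding faces_def using face_eq face_self face_sub by blast

lemma face_funpow: "d \<in> darts E \<Longrightarrow> face d = {(step ^^ n) d | n. True}"
  using face_self orbit_altdef_self_in by metis

lemma E_disj: "d \<in> E \<Longrightarrow> d \<notin> E\<inverse>"
proof
  assume "d \<in> E" "d \<in> E\<inverse>"
  then have "(fst d, snd d) \<in> E" "(snd d, fst d) \<in> E" by (cases d; simp)+
  then have "(fst d, fst d) \<in> E\<^sup>+" by (rule trancl_into_trancl[OF r_into_trancl])
  then show False using basic(3) by (simp add: acyclic_def)
qed

text \<open>The angles at \<open>v\<close>: small ones within each list, flat ones where the lists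
  meet, and at \<open>s\<close> and \<open>t\<close> the large angle, which is the wrap-around of
  the only nonempty list.\<close>

lemma step_out_in:
  assumes v: "v \<in> V"
  shows "(x, y) \<in> path_edges (outs v) \<Longrightarrow> step (x, v) = (v, y)"
    and "(x, y) \<in> path_edges (cin v) \<Longrightarrow> step (x, v) = (v, y)"
    and "outs v \<noteq> [] \<Longrightarrow> cin v \<noteq> [] \<Longrightarrow> step (last (outs v), v) = (v, hd (cin v))"
    and "outs v \<noteq> [] \<Longrightarrow> cin v \<noteq> [] \<Longrightarrow> step (last (cin v), v) = (v, hd (outs v))"
    and "outs v \<noteq> [] \<Longrightarrow> cin v = [] \<Longrightarrow> step (last (outs v), v) = (v, hd (outs v))"
    and "outs v = [] \<Longrightarrow> cin v \<noteq> [] \<Longrightarrow> step (last (cin v), v) = (v, hd (cin v))"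
proof -
  note r = rot_facts[OF v]
  have p: "step (x, v) = (v, y)" if "(x, y) \<in> path_edges (outs v @ cin v)" for x y
    using cyc_next_path_edges[OF r(1) that] path_edges_set[OF that] r(2,3) by (simp add: step_pair)
  show "(x, y) \<in> path_edges (outs v) \<Longrightarrow> step (x, v) = (v, y)"
    "(x, y) \<in> path_edges (cin v) \<Longrightarrow> step (x, v) = (v, y)"
    "outs v \<noteq> [] \<Longrightarrow> cin v \<noteq> [] \<Longrightarrow> step (last (outs v), v) = (v, hd (cin v))"
    by (auto intro!: p simp: path_edges_append)
  have l: "outs v @ cin v \<noteq> [] \<Longrightarrow> step (last (outs v @ cin v), v) = (v, hd (outs v @ cin v))"
    using cyc_next_last[OF r(1)] r(2,3) last_in_set[of "outs v @ cin v"] by (simp add: step_pair)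
  show "outs v \<noteq> [] \<Longrightarrow> cin v \<noteq> [] \<Longrightarrow> step (last (cin v), v) = (v, hd (outs v))"
    "outs v \<noteq> [] \<Longrightarrow> cin v = [] \<Longrightarrow> step (last (outs v), v) = (v, hd (outs v))"
    "outs v = [] \<Longrightarrow> cin v \<noteq> [] \<Longrightarrow> step (last (cin v), v) = (v, hd (cin v))"
    using l by auto
qed

text \<open>The switch angles at which a face walk turns from upward to downward.\<close>

definition peaks :: "('a \<times> 'a) set" where "peaks = {d \<in> E. step d \<in> E\<inverse>}"

text \<open>A face walk goes on upwards only through the flat angle on the left of a vertex, which
  it enters by the leftmost incoming edge, the last one of \<open>cin v\<close>. Every vertex other
  than \<open>s\<close> and \<open>t\<close> has one such angle.\<close>

lemma nonpeaks: "E - peaks = (\<lambda>v. (last (cin v), v)) ` (V - {s, t})"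
proof (intro subset_antisym subsetI)
  fix d assume d: "d \<in> E - peaks"
  obtain u v where uv: "d = (u, v)" by (cases d)
  have E: "(u, v) \<in> E" and v: "v \<in> V" "u \<in> set (cin v)" using d uv basic(2) cin_set[of v] by auto
  have np: "step (u, v) \<notin> E\<inverse>" using d uv by (auto simp: peaks_def)
  have vs: "v \<noteq> s" using v(2) cin_Nil[OF v(1)] by (metis empty_iff list.set(1))
  have u: "u = last (cin v)"
  proof (rule ccontr)
    assume "u \<noteq> last (cin v)"
    then obtain w where w: "(u, w) \<in> path_edges (cin v)" using path_edges_next v by metis
    then show False using np step_out_in(2)[OF v(1) w] path_edges_set[OF w] cin_set[OF v(1)] by auto
  qed
  moreover have "v \<noteq> t"
  proof
    assume "v = t"
    then have "outs v = []" "cin v \<noteq> []" using outs_Nil v by auto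
    then show False using np step_out_in(6)[OF v(1)] u cin_set[OF v(1)] hd_in_set[of "cin v"] by auto
  qed
  ultimately show "d \<in> (\<lambda>v. (last (cin v), v)) ` (V - {s, t})" using uv v vs by auto
next
  fix d assume "d \<in> (\<lambda>v. (last (cin v), v)) ` (V - {s, t})"
  then obtain v where v: "v \<in> V" "v \<noteq> s" "v \<noteq> t" and d: "d = (last (cin v), v)" by auto
  then have ne: "outs v \<noteq> []" "cin v \<noteq> []" using outs_Nil cin_Nil by auto
  have "step d \<in> E" using step_out_in(4)[OF v(1) ne] d outs_set[OF v(1)] hd_in_set[OF ne(1)] by auto
  moreover have "d \<in> E" using d cin_set[OF v(1)] last_in_set[OF ne(2)] by auto
  ultimately show "d \<in> E - peaks" using E_disj by (auto simp: peaks_def)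
qed

text \<open>The upward darts are the edges, of which \<open>card V - 2\<close> continue upwards; by
  Euler's formula as many remain as there are faces.\<close>

lemma card_peaks: "card peaks = card (faces E rot)"
proof -
  have "card (V - {s, t}) = card V - 2" using basic by (subst card_Diff_subset) auto
  moreover have "card (E - peaks) = card (V - {s, t})"
    unfolding nonpeaks by (rule card_image) (auto simp: inj_on_def)
  moreover have "peaks \<subseteq> E" by (auto simp: peaks_def)
  then have "card (E - peaks) = card E - card peaks" "card peaks \<le> card E"
    using basic(9) by (auto simp: card_Diff_subset finite_subset card_mono)
  moreover have "card {s, t} \<le> card V" using basic by (intro card_mono) auto
  then have "2 \<le> card V" using basic(4) by simp
  ultimately show ?thesis using basic(7) by linarith
qed

text \<open>A walk that never goes down would climb forever in a finite acyclic graph.\<close>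

lemma face_not_sub: "d \<in> darts E \<Longrightarrow> \<not> face d \<subseteq> E"
proof
  assume d: "d \<in> darts E" and sub: "face d \<subseteq> E"
  have "wf (E\<inverse>)" using basic by (intro finite_acyclic_wf_converse)
  moreover have "snd d \<in> snd ` face d" using face_self d by blast
  ultimately obtain z where z: "z \<in> snd ` face d" "\<And>y. (z, y) \<in> E \<Longrightarrow> y \<notin> snd ` face d"
    by (metis converse_iff wfE_min)
  then obtain e where e: "e \<in> face d" "snd e = z" by auto
  have "step e \<in> face d" using e by (auto intro: orbit.intros)
  then show False using z(2)[of "snd (step e)"] fst_step[of e] e sub by (metis imageI prod.collapse subsetD)
qed

lemma face_not_sub_conv: "d \<in> darts E \<Longrightarrow> \<not> face d \<subseteq> E\<inverse>"
proof -
  interpret d: bimodal V "E\<inverse>" t s rot outer cin outs by (rule dual)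
  have "darts (E\<inverse>) = darts E" by (auto simp: darts_def)
  then show "d \<in> darts E \<Longrightarrow> \<not> face d \<subseteq> E\<inverse>" using d.face_not_sub by simp
qed

text \<open>The walk has an upward dart since it cannot descend forever. If every upward dart were
  followed by an upward one, it would climb forever.\<close>

lemma face_peak: "f \<in> faces E rot \<Longrightarrow> \<exists>d \<in> f. d \<in> peaks"
proof -
  assume f: "f \<in> faces E rot"
  then obtain x where x: "x \<in> darts E" "f = face x" by (auto simp: faces_def)
  obtain d where d: "d \<in> f" "d \<in> E" using face_not_sub_conv[OF x(1)] face_sub[OF x(1)] x by (auto simp: darts_def)
  have dd: "d \<in> darts E" "face d = f" using d f faces_mem by auto
  have "\<exists>e \<in> f \<inter> E. step e \<notin> E"
  proof (rule ccontr)
    assume n: "\<not> ?thesis"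
    have "e \<in> E" if "e \<in> face d" for e
      using that
    proof induction
      case base then show ?case using n d by auto
    next
      case (step y) then show ?case using n dd by auto
    qed
    then show False using face_not_sub[OF dd(1)] by auto
  qed
  then obtain e where e: "e \<in> f" "e \<in> E" "step e \<notin> E" by auto
  have "step e \<in> E \<union> E\<inverse>" using e step_in[of e] unfolding darts_def by blast
  then have "e \<in> peaks" using e unfolding peaks_def by simp
  then show ?thesis using e(1) by (rule rev_bexI[rotated])
qed

text \<open>By Euler's formula there are exactly as many peaks as faces, so every face has only one.\<close>

lemma peak_unique: "d \<in> peaks \<Longrightarrow> e \<in> peaks \<Longrightarrow> face d = face e \<Longrightarrow> d = e"
proof -
  have pd: "peaks \<subseteq> darts E" by (auto simp: peaks_def darts_def)
  have "face ` peaks = faces E rot"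
  proof
    show "face ` peaks \<subseteq> faces E rot" using pd by (auto simp: faces_def)
    show "faces E rot \<subseteq> face ` peaks"
    proof
      fix f assume f: "f \<in> faces E rot"
      then obtain d where "d \<in> f" "d \<in> peaks" using face_peak by blast
      then show "f \<in> face ` peaks" using faces_mem[OF f] by auto
    qed
  qed
  then have "card (face ` peaks) = card peaks" using card_peaks by simp
  moreover have "finite peaks" using basic(9) by (auto simp: peaks_def)
  ultimately have "inj_on face peaks" by (rule eq_card_imp_inj_on[rotated])
  then show "d \<in> peaks \<Longrightarrow> e \<in> peaks \<Longrightarrow> face d = face e \<Longrightarrow> d = e" by (rule inj_onD)
qed

definition valleys :: "('a \<times> 'a) set" where "valleys = {d \<in> E\<inverse>. step d \<in> E}"

lemma dual_facts:
  shows "bimodal.peaks (E\<inverse>) rot = valleys" "bimodal.valleys (E\<inverse>) rot = peaks" "faces (E\<inverse>) rot = faces E rot"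
proof -
  interpret d: bimodal V "E\<inverse>" t s rot outer cin outs by (rule dual)
  show "d.peaks = valleys" "d.valleys = peaks" by (auto simp: d.peaks_def valleys_def d.valleys_def peaks_def)
  have "darts (E\<inverse>) = darts E" by (auto simp: darts_def)
  then show "faces (E\<inverse>) rot = faces E rot" by (simp add: faces_def)
qed

lemma face_valley: "f \<in> faces E rot \<Longrightarrow> \<exists>d \<in> f. d \<in> valleys"
proof -
  interpret d: bimodal V "E\<inverse>" t s rot outer cin outs by (rule dual)
  show "f \<in> faces E rot \<Longrightarrow> \<exists>d \<in> f. d \<in> valleys" using d.face_peak dual_facts by simp
qed

lemma valley_unique: "d \<in> valleys \<Longrightarrow> e \<in> valleys \<Longrightarrow> face d = face e \<Longrightarrow> d = e"
proof -
  interpret d: bimodal V "E\<inverse>" t s rot outer cin outs by (rule dual)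
  show "d \<in> valleys \<Longrightarrow> e \<in> valleys \<Longrightarrow> face d = face e \<Longrightarrow> d = e" using d.peak_unique dual_facts by simp
qed

lemma walk_path:
  assumes "\<And>i. i \<le> n \<Longrightarrow> (step ^^ i) e \<in> E"
  shows "\<exists>p. 2 \<le> length p \<and> hd p = fst e \<and> last p = snd ((step ^^ n) e) \<and>
    path_edges p = (\<lambda>i. (step ^^ i) e) ` {..n}"
  using assms
proof (induction n)
  case 0
  then show ?case by (intro exI[of _ "[fst e, snd e]"]) auto
next
  case (Suc n)
  then obtain p where p: "2 \<le> length p" "hd p = fst e" "last p = snd ((step ^^ n) e)"
    "path_edges p = (\<lambda>i. (step ^^ i) e) ` {..n}" by auto
  let ?d = "(step ^^ Suc n) e"
  have "(last p, snd ?d) = ?d" using p(3) fst_step[of "(step ^^ n) e"] by (metis comp_apply funpow.simps(2) prod.collapse)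
  moreover have "p \<noteq> []" using p by auto
  ultimately have "path_edges (p @ [snd ?d]) = insert ?d (path_edges p)" by (simp add: path_edges_append)
  then have "path_edges (p @ [snd ?d]) = (\<lambda>i. (step ^^ i) e) ` {..Suc n}" using p(4) by (simp add: atMost_Suc)
  then show ?case using p \<open>p \<noteq> []\<close> by (intro exI[of _ "p @ [snd ?d]"]) auto
qed

lemma acyclic_path_distinct: "path_edges p \<subseteq> E \<Longrightarrow> distinct p"
proof -
  assume p: "path_edges p \<subseteq> E"
  have "transp (\<lambda>a b. (a, b) \<in> E\<^sup>+)" by (auto intro: transpI)
  moreover have "successively (\<lambda>a b. (a, b) \<in> E\<^sup>+) p" using p by (auto simp: successively_iff_path_edges)
  ultimately have "sorted_wrt (\<lambda>a b. (a, b) \<in> E\<^sup>+) p" by (simp add: successively_conv_sorted_wrt)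
  then show ?thesis using basic(3) by (induction p) (auto simp: acyclic_def)
qed

text \<open>The path starts after the unique valley of the face and climbs up to the first dart that
  is not upward. A further upward run would begin with a second valley, so this run contains all
  upward darts of the face. Its ends are expressed by valley and peak because these are shared with
  the other bounding path.\<close>

lemma face_path:
  assumes f: "f \<in> faces E rot"
  shows "\<exists>p. directed_path E p \<and> path_edges p = f \<inter> E \<and>
    (\<forall>d \<in> f \<inter> valleys. snd d = hd p) \<and> (\<forall>d \<in> f \<inter> peaks. snd d = last p)"
proof -
  obtain d where d: "d \<in> f" "d \<in> valleys" using face_valley[OF f] by blast
  define e where "e = step d"
  have eE: "e \<in> E" using d by (simp add: e_def valleys_def)
  then have ed: "e \<in> darts E" by (auto simp: darts_def)
  have dd: "d \<in> darts E" "face d = f" using faces_mem[OF f] d by auto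
  have fe: "face e = f" using face_step[OF dd(1)] dd(2) by (simp add: e_def)
  have pw: "(step ^^ i) e \<in> f" for i using face_funpow[OF ed] fe by auto
  define m where "m = (LEAST i. (step ^^ i) e \<notin> E)"
  obtain x where "x \<in> face e" "x \<notin> E" using face_not_sub[OF ed] by blast
  then obtain i0 where "(step ^^ i0) e \<notin> E" using face_funpow[OF ed] by auto
  then have m: "(step ^^ m) e \<notin> E" "\<And>i. i < m \<Longrightarrow> (step ^^ i) e \<in> E"
    unfolding m_def by (rule LeastI, metis not_less_Least)
  then have "m \<noteq> 0" using eE by (metis funpow_0)
  then obtain n where n: "m = Suc n" using not0_implies_Suc by blast
  obtain p where p: "2 \<le> length p" "hd p = fst e" "last p = snd ((step ^^ n) e)"
    "path_edges p = (\<lambda>i. (step ^^ i) e) ` {..n}" using walk_path[of n e] m(2) n by auto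
  have pE: "path_edges p \<subseteq> E" using p(4) m(2) n by auto
  have dp: "directed_path E p" unfolding directed_path_def
    using p(1) acyclic_path_distinct[OF pE] pE by (auto simp: successively_iff_path_edges)
  have cover: "(step ^^ j) e \<in> path_edges p" if "(step ^^ j) e \<in> E" for j
    using that
  proof (induction j rule: less_induct)
    case (less j)
    show ?case
    proof (cases "j \<le> n")
      case True then show ?thesis using p(4) by auto
    next
      case False
      \<comment> \<open>Between the first downward dart and the upward dart number \<open>j\<close>
        the walk turns upwards somewhere. By uniqueness this happens at \<open>d\<close>, where the
        walk starts over, so \<open>j\<close> can be replaced by a smaller index.\<close>
      have "\<exists>i. m \<le> i \<and> i < j \<and> (step ^^ i) e \<notin> E \<and> (step ^^ Suc i) e \<in> E"
      proof (rule ccontr)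
        assume c: "\<not> ?thesis"
        have "m \<le> i \<Longrightarrow> i \<le> j \<Longrightarrow> (step ^^ i) e \<notin> E" for i
        proof (induction i)
          case 0 then show ?case using m n by simp
        next
          case (Suc i)
          show ?case
          proof (cases "m = Suc i")
            case False
            then have "m \<le> i" "i < j" using Suc.prems by auto
            then show ?thesis using c Suc.IH by auto
          qed (use m in simp)
        qed
        then show False using less.prems False n by auto
      qed
      then obtain i where i: "i < j" "(step ^^ i) e \<notin> E" "(step ^^ Suc i) e \<in> E" by auto
      have "(step ^^ i) e \<in> darts E" using pw faces_mem[OF f] by blast
      then have "(step ^^ i) e \<in> valleys" using i by (auto simp: valleys_def darts_def)
      then have "(step ^^ i) e = d" using valley_unique d pw faces_mem[OF f] by metis
      then have e': "(step ^^ Suc i) e = e" by (simp add: e_def)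
      have "(step ^^ j) e = (step ^^ (j - Suc i)) ((step ^^ Suc i) e)"
        using i by (metis Suc_leI funpow_add le_add_diff_inverse2 comp_apply)
      then have "(step ^^ j) e = (step ^^ (j - Suc i)) e" using e' by simp
      then show ?thesis using less.IH[of "j - Suc i"] less.prems i by (metis diff_less zero_less_Suc less_imp_diff_less Suc_leI diff_less less_le_trans zero_less_Suc)
    qed
  qed
  have "path_edges p = f \<inter> E"
  proof
    show "path_edges p \<subseteq> f \<inter> E" using pE p(4) pw by auto
    show "f \<inter> E \<subseteq> path_edges p" using cover face_funpow[OF ed] fe by auto
  qed
  moreover have "snd d' = hd p" if "d' \<in> f" "d' \<in> valleys" for d'
    using valley_unique[OF that(2) d(2)] that d faces_mem[OF f] p(2) fst_step[of d] by (simp add: e_def)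
  moreover have "snd d' = last p" if d': "d' \<in> f" "d' \<in> peaks" for d'
  proof -
    have "(step ^^ n) e \<in> peaks"
      using m n pw[of m] faces_mem[OF f] by (auto simp: peaks_def darts_def)
    then have "d' = (step ^^ n) e" using peak_unique[OF d'(2)] d' pw faces_mem[OF f] by blast
    then show ?thesis using p(3) by simp
  qed
  ultimately show ?thesis using dp by blast
qed

section \<open>The bounding paths and the two faces of an edge\<close>

definition rp :: "('a \<times> 'a) set \<Rightarrow> 'a list" where
  "rp f = (SOME p. directed_path E p \<and> path_edges p = f \<inter> E \<and>
    (\<forall>d \<in> f \<inter> valleys. snd d = hd p) \<and> (\<forall>d \<in> f \<inter> peaks. snd d = last p))"

text \<open>Taken from the reversed graph, where the downward part of the walk is an upward path and
  valleys and peaks are exchanged.\<close>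

definition lp :: "('a \<times> 'a) set \<Rightarrow> 'a list" where
  "lp f = rev (SOME p. directed_path (E\<inverse>) p \<and> path_edges p = f \<inter> E\<inverse> \<and>
    (\<forall>d \<in> f \<inter> peaks. snd d = hd p) \<and> (\<forall>d \<in> f \<inter> valleys. snd d = last p))"

lemma rp_facts:
  assumes "f \<in> faces E rot"
  shows "directed_path E (rp f)" "path_edges (rp f) = f \<inter> E"
    "d \<in> f \<Longrightarrow> d \<in> valleys \<Longrightarrow> hd (rp f) = snd d" "d \<in> f \<Longrightarrow> d \<in> peaks \<Longrightarrow> last (rp f) = snd d"
  using someI_ex[OF face_path[OF assms], folded rp_def] by auto

lemma lp_facts:
  assumes "f \<in> faces E rot"
  shows "directed_path E (lp f)" "path_edges (lp f) = (f \<inter> E\<inverse>)\<inverse>"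
    "d \<in> f \<Longrightarrow> d \<in> valleys \<Longrightarrow> hd (lp f) = snd d" "d \<in> f \<Longrightarrow> d \<in> peaks \<Longrightarrow> last (lp f) = snd d"
proof -
  interpret d: bimodal V "E\<inverse>" t s rot outer cin outs by (rule dual)
  obtain q where q: "lp f = rev q" "directed_path (E\<inverse>) q" "path_edges q = f \<inter> E\<inverse>"
    "\<forall>d \<in> f \<inter> peaks. snd d = hd q" "\<forall>d \<in> f \<inter> valleys. snd d = last q"
    using someI_ex[OF d.face_path[unfolded dual_facts, OF assms]] unfolding lp_def by blast
  show "directed_path E (lp f)" using q(1,2) by (auto simp: directed_path_def)
  show "path_edges (lp f) = (f \<inter> E\<inverse>)\<inverse>" using q(1,3) by (simp add: path_edges_rev)
  have "q \<noteq> []" using q(2) by (auto simp: directed_path_def)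
  then show "d \<in> f \<Longrightarrow> d \<in> valleys \<Longrightarrow> hd (lp f) = snd d" "d \<in> f \<Longrightarrow> d \<in> peaks \<Longrightarrow> last (lp f) = snd d"
    using q by (auto simp: hd_rev last_rev)
qed

definition lf :: "'a \<times> 'a \<Rightarrow> ('a \<times> 'a) set" where "lf e = face e"
definition rf :: "'a \<times> 'a \<Rightarrow> ('a \<times> 'a) set" where "rf e = face (snd e, fst e)"

text \<open>The large angle at \<open>t\<close> is a peak of the outer face, and a face has only
  one. Hence no small angle between incoming edges belongs to the outer face.\<close>

lemma outer_peak: "d \<in> peaks \<Longrightarrow> face d = outer \<Longrightarrow> d = (last (cin t), t)"
proof -
  assume d: "d \<in> peaks" "face d = outer"
  have ne: "outs t = []" "cin t \<noteq> []" using outs_Nil cin_Nil basic by auto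
  have E: "(last (cin t), t) \<in> E" "(hd (cin t), t) \<in> E" using cin_set[OF basic(6)] ne by auto
  have st: "step (last (cin t), t) = (t, hd (cin t))" using step_out_in(6)[OF basic(6) ne] .
  have "(last (cin t), t) \<in> peaks" using E st by (simp add: peaks_def)
  moreover have "face (last (cin t), t) = outer"
    using face_step[of "(last (cin t), t)"] st t_dart faces_mem[OF basic(8)] E by (auto simp: darts_def)
  ultimately show ?thesis using peak_unique d by metis
qed

lemma cin_adj:
  assumes v: "v \<in> V" and xy: "(y, x) \<in> path_edges (cin v)"
  shows "face (y, v) = face (v, x)" "face (y, v) \<noteq> outer" "(y, v) \<in> peaks"
proof -
  have E: "(y, v) \<in> E" "(x, v) \<in> E" using path_edges_set[OF xy] cin_set[OF v] by auto
  have st: "step (y, v) = (v, x)" using step_out_in(2)[OF v xy] .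
  show "face (y, v) = face (v, x)" using face_step[of "(y, v)"] st E by (simp add: darts_def)
  show p: "(y, v) \<in> peaks" using E st by (simp add: peaks_def)
  have "distinct (cin v)" using rot_facts(1)[OF v] by simp
  then have "y \<noteq> last (cin v)" using path_edges_last xy by metis
  then show "face (y, v) \<noteq> outer" using outer_peak[OF p] by auto
qed

lemma outs_adj:
  assumes "v \<in> V" "(x, y) \<in> path_edges (outs v)"
  shows "face (x, v) = face (v, y)" "face (x, v) \<noteq> outer" "(x, v) \<in> valleys"
proof -
  interpret d: bimodal V "E\<inverse>" t s rot outer cin outs by (rule dual)
  show "face (x, v) = face (v, y)" "face (x, v) \<noteq> outer" "(x, v) \<in> valleys"
    using d.cin_adj[OF assms] dual_facts by auto
qed

lemma s_outer: "face (s, hd (outs s)) = outer" "face (last (outs s), s) = outer"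
proof -
  have ne: "outs s \<noteq> []" "cin s = []" using outs_Nil cin_Nil basic by auto
  have E: "(s, hd (outs s)) \<in> E" "(s, last (outs s)) \<in> E" using outs_set[OF basic(5)] ne by auto
  show 1: "face (s, hd (outs s)) = outer" using s_dart faces_mem[OF basic(8)] by blast
  have "step (last (outs s), s) = (s, hd (outs s))" using step_out_in(5)[OF basic(5) ne] .
  then show "face (last (outs s), s) = outer" using face_step[of "(last (outs s), s)"] 1 E by (simp add: darts_def)
qed

lemma t_outer: "face (t, hd (cin t)) = outer" "face (last (cin t), t) = outer"
proof -
  interpret d: bimodal V "E\<inverse>" t s rot outer cin outs by (rule dual)
  show "face (t, hd (cin t)) = outer" "face (last (cin t), t) = outer" using d.s_outer by auto
qed

text \<open>The list \<open>cin\<close> is reversed because clockwise order meets the incoming edges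
  from right to left.\<close>

lemma bimodal_st_faces:
  assumes E: "E = L \<union> R" and LR: "L \<inter> R = {}"
    and om: "\<And>v. v \<in> V \<Longrightarrow> sorted_wrt (\<lambda>x y. (v, x) \<in> R \<longrightarrow> (v, y) \<in> R) (outs v)"
    and im: "\<And>v. v \<in> V \<Longrightarrow> sorted_wrt (\<lambda>x y. (y, v) \<in> R \<longrightarrow> (x, v) \<in> R) (cin v)"
  shows "st_faces V E L R s t (\<lambda>v. rev (cin v)) outs lf rf outer lp rp"
proof
  note b = basic
  have fE: "lf e \<in> faces E rot" "rf e \<in> faces E rot" if "e \<in> E" for e
    using that unfolding lf_def rf_def faces_def darts_def by (auto intro!: imageI)
  {
    fix v assume v: "v \<in> V"
    have "distinct (outs v @ cin v)" using rot_facts(1)[OF v] .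
    then show "distinct (rev (cin v))" "distinct (outs v)" by auto
    show "set (rev (cin v)) = {u. (u, v) \<in> E}" "set (outs v) = {w. (v, w) \<in> E}"
      using cin_set[OF v] outs_set[OF v] by auto
    show "(rev (cin v) = []) = (v = s)" "(outs v = []) = (v = t)" using cin_Nil[OF v] outs_Nil[OF v] by auto
    show "sorted_wrt (\<lambda>x y. (x, v) \<in> R \<longrightarrow> (y, v) \<in> R) (rev (cin v))"
      using im[OF v] by (simp add: sorted_wrt_rev)
    show "sorted_wrt (\<lambda>x y. (v, x) \<in> R \<longrightarrow> (v, y) \<in> R) (outs v)" using om[OF v] .
    fix x y
    show "rf (x, v) = lf (y, v) \<and> rf (x, v) \<noteq> outer \<and> last (lp (rf (x, v))) = v"
      if "(x, y) \<in> path_edges (rev (cin v))"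
    proof -
      have yx: "(y, x) \<in> path_edges (cin v)" using that by (simp add: path_edges_rev)
      note h = cin_adj[OF v yx]
      have E: "(y, v) \<in> E" using path_edges_set[OF yx] cin_set[OF v] by auto
      have "last (lp (lf (y, v))) = snd (y, v)"
        using lp_facts(4)[OF fE(1)[OF E] _ h(3)] face_self[of "(y, v)"] E by (simp add: lf_def darts_def)
      then show ?thesis using h by (simp add: lf_def rf_def)
    qed
    show "rf (v, x) = lf (v, y) \<and> rf (v, x) \<noteq> outer \<and> hd (lp (rf (v, x))) = v"
      if xy: "(x, y) \<in> path_edges (outs v)"
    proof -
      note h = outs_adj[OF v xy]
      have E: "(v, x) \<in> E" using path_edges_set[OF xy] outs_set[OF v] by auto
      have "hd (lp (rf (v, x))) = snd (x, v)"
        using lp_facts(3)[OF fE(2)[OF E] _ h(3)] face_self[of "(x, v)"] E by (simp add: rf_def darts_def)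
      then show ?thesis using h by (simp add: lf_def rf_def)
    qed
    assume st: "v \<noteq> s" "v \<noteq> t"
    then have ne: "outs v \<noteq> []" "cin v \<noteq> []" using outs_Nil cin_Nil v by auto
    have d: "(last (cin v), v) \<in> darts E" "(last (outs v), v) \<in> darts E"
      using cin_set[OF v] outs_set[OF v] last_in_set[OF ne(1)] last_in_set[OF ne(2)] by (auto simp: darts_def)
    show "lf (hd (rev (cin v)), v) = lf (v, hd (outs v))"
      using face_step[OF d(1)] step_out_in(4)[OF v ne] by (simp add: lf_def hd_rev)
    show "rf (last (rev (cin v)), v) = rf (v, last (outs v))"
      using face_step[OF d(2)] step_out_in(3)[OF v ne] by (simp add: rf_def last_rev)
  }
  show "lf (s, hd (outs s)) = outer" "rf (s, last (outs s)) = outer"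
    "lf (hd (rev (cin t)), t) = outer" "rf (last (rev (cin t)), t) = outer"
    using s_outer t_outer by (auto simp: lf_def rf_def hd_rev last_rev)
  fix f assume "f \<in> lf ` E \<union> rf ` E"
  then have f: "f \<in> faces E rot" using fE by auto
  obtain d d' where d: "d \<in> f" "d \<in> valleys" "d' \<in> f" "d' \<in> peaks" using face_valley[OF f] face_peak[OF f] by blast
  have "path_edges (lp f) = {e \<in> E. rf e = f}" "path_edges (rp f) = {e \<in> E. lf e = f}"
    using lp_facts(2)[OF f] rp_facts(2)[OF f] faces_mem[OF f] by (auto simp: lf_def rf_def darts_def)
  then show "directed_path E (lp f) \<and> directed_path E (rp f) \<and> hd (lp f) = hd (rp f) \<and> last (lp f) = last (rp f) \<and>
    path_edges (lp f) = {e \<in> E. rf e = f} \<and> path_edges (rp f) = {e \<in> E. lf e = f}"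
    using lp_facts[OF f] rp_facts[OF f] d by simp
qed (use basic E LR in auto)

end

section \<open>The drawing of a book embedding\<close>

text \<open>The altitude theorem for the right triangle over the diameter between the two spine
  points. The equation does not depend on which of the two is higher.\<close>

lemma edge_arc_iff:
  "z \<in> edge_arc \<pi> L u v \<longleftrightarrow>
    (Re z)\<^sup>2 = (Im z - real (\<pi> u)) * (real (\<pi> v) - Im z) \<and> (if left_edge L u v then Re z \<le> 0 else 0 \<le> Re z)"
proof -
  let ?a = "real (\<pi> u)" and ?b = "real (\<pi> v)"
  have m: "midpoint (spine_point \<pi> u) (spine_point \<pi> v) = Complex 0 ((?a + ?b) / 2)"
    by (simp add: midpoint_def spine_point_def complex_eq_iff)
  have d: "dist (spine_point \<pi> u) (spine_point \<pi> v) = \<bar>?a - ?b\<bar>"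
    by (simp add: spine_point_def dist_norm cmod_def)
  have "dist (Complex 0 ((?a + ?b) / 2)) z = \<bar>?a - ?b\<bar> / 2 \<longleftrightarrow>
      (dist (Complex 0 ((?a + ?b) / 2)) z)\<^sup>2 = (\<bar>?a - ?b\<bar> / 2)\<^sup>2"
    by (subst power2_eq_iff_nonneg) auto
  also have "\<dots> \<longleftrightarrow> (Re z)\<^sup>2 + ((?a + ?b) / 2 - Im z)\<^sup>2 = (?a - ?b)\<^sup>2 / 4"
    by (simp add: dist_norm cmod_def power_divide)
  also have "\<dots> \<longleftrightarrow> (Re z)\<^sup>2 = (Im z - ?a) * (?b - Im z)"
    by (auto simp: power2_eq_square field_simps)
  finally show ?thesis unfolding edge_arc_def m d by (auto simp: sphere_def)
qed

lemma edge_apex_eq: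
  "edge_apex \<pi> L u v = Complex ((if left_edge L u v then - 1 else 1) * \<bar>real (\<pi> u) - real (\<pi> v)\<bar> / 2)
    ((real (\<pi> u) + real (\<pi> v)) / 2)"
  by (auto simp: edge_apex_def midpoint_def spine_point_def complex_eq_iff dist_norm cmod_def)

subsection \<open>The clockwise order around a vertex\<close>

text \<open>Semicircles leave a vertex horizontally. The quadrants are numbered clockwise from the
  ray that leads east, that is by decreasing polar angle: below right, below left, above left, above
  right.\<close>

definition quadrant :: "('a \<Rightarrow> nat) \<Rightarrow> 'a rel \<Rightarrow> 'a \<Rightarrow> 'a \<Rightarrow> nat" where
  "quadrant \<pi> L v x =
    (if \<pi> x < \<pi> v then (if left_edge L v x then 1 else 0) else (if left_edge L v x then 2 else 3))"

text \<open>Clockwise order starting at the ray that leads east.\<close>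

definition before :: "('a \<Rightarrow> nat) \<Rightarrow> 'a rel \<Rightarrow> 'a \<Rightarrow> 'a \<Rightarrow> 'a \<Rightarrow> bool" where
  "before \<pi> L v x y \<longleftrightarrow> quadrant \<pi> L v x < quadrant \<pi> L v y \<or>
    quadrant \<pi> L v x = quadrant \<pi> L v y \<and> (if left_edge L v x then \<pi> y < \<pi> x else \<pi> x < \<pi> y)"

text \<open>A chord of length \<open>\<epsilon>\<close> in a circle of diameter \<open>d\<close>
  makes the angle \<open>arcsin (\<epsilon> / d)\<close> with the tangent at its end, which is
  horizontal here; \<open>d\<close> is the distance of the two vertices.\<close>

definition acute :: "('a \<Rightarrow> nat) \<Rightarrow> 'a \<Rightarrow> real \<Rightarrow> 'a \<Rightarrow> real" where
  "acute \<pi> v \<epsilon> x = arcsin (\<epsilon> / \<bar>real (\<pi> x) - real (\<pi> v)\<bar>)"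

definition angle :: "('a \<Rightarrow> nat) \<Rightarrow> 'a rel \<Rightarrow> 'a \<Rightarrow> real \<Rightarrow> 'a \<Rightarrow> real" where
  "angle \<pi> L v \<epsilon> x =
    (if quadrant \<pi> L v x = 0 then 2 * pi - acute \<pi> v \<epsilon> x
     else if quadrant \<pi> L v x = 1 then pi + acute \<pi> v \<epsilon> x
     else if quadrant \<pi> L v x = 2 then pi - acute \<pi> v \<epsilon> x else acute \<pi> v \<epsilon> x)"

lemma acute_bounds:
  assumes "0 < \<epsilon>" "\<epsilon> < 1" "\<pi> x \<noteq> \<pi> v"
  shows "0 < \<epsilon> / \<bar>real (\<pi> x) - real (\<pi> v)\<bar>" "\<epsilon> / \<bar>real (\<pi> x) - real (\<pi> v)\<bar> < 1"
    "0 < acute \<pi> v \<epsilon> x" "acute \<pi> v \<epsilon> x < pi / 2"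
proof -
  have 1: "1 \<le> \<bar>real (\<pi> x) - real (\<pi> v)\<bar>" using assms(3) by linarith
  then show a: "0 < \<epsilon> / \<bar>real (\<pi> x) - real (\<pi> v)\<bar>" "\<epsilon> / \<bar>real (\<pi> x) - real (\<pi> v)\<bar> < 1"
    using assms by auto
  show "0 < acute \<pi> v \<epsilon> x" "acute \<pi> v \<epsilon> x < pi / 2"
    unfolding acute_def using a arcsin_less_arcsin[of 0] arcsin_less_arcsin[of _ 1] by auto
qed

lemma acute_less:
  assumes "0 < \<epsilon>" "\<epsilon> < 1" "\<pi> x \<noteq> \<pi> v" "\<pi> y \<noteq> \<pi> v"
  shows "acute \<pi> v \<epsilon> x < acute \<pi> v \<epsilon> y \<longleftrightarrow> \<bar>real (\<pi> y) - real (\<pi> v)\<bar> < \<bar>real (\<pi> x) - real (\<pi> v)\<bar>"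
proof -
  note a = acute_bounds[where \<pi>=\<pi> and x=x and v=v and \<epsilon>=\<epsilon>, OF assms(1-3)] acute_bounds[where \<pi>=\<pi> and x=y and v=v and \<epsilon>=\<epsilon>, OF assms(1,2,4)]
  have "acute \<pi> v \<epsilon> x < acute \<pi> v \<epsilon> y \<longleftrightarrow> \<epsilon> / \<bar>real (\<pi> x) - real (\<pi> v)\<bar> < \<epsilon> / \<bar>real (\<pi> y) - real (\<pi> v)\<bar>"
    unfolding acute_def using a by (intro arcsin_less_mono) auto
  also have "\<dots> \<longleftrightarrow> \<bar>real (\<pi> y) - real (\<pi> v)\<bar> < \<bar>real (\<pi> x) - real (\<pi> v)\<bar>"
    using assms by (auto simp: field_simps)
  finally show ?thesis .
qed

lemma angle_less:
  assumes "0 < \<epsilon>" "\<epsilon> < 1" "\<pi> x \<noteq> \<pi> v" "\<pi> y \<noteq> \<pi> v"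
  shows "angle \<pi> L v \<epsilon> x > angle \<pi> L v \<epsilon> y \<longleftrightarrow> before \<pi> L v x y"
proof -
  define X Y where "X = acute \<pi> v \<epsilon> x" and "Y = acute \<pi> v \<epsilon> y"
  have a: "0 < X" "X < pi / 2" "0 < Y" "Y < pi / 2"
    unfolding X_def Y_def
    using acute_bounds(3,4)[where \<pi>=\<pi> and x=x and v=v, OF assms(1-3)]
      acute_bounds(3,4)[where \<pi>=\<pi> and x=y and v=v, OF assms(1,2,4)] by auto
  have b: "Y < X \<longleftrightarrow> \<bar>real (\<pi> x) - real (\<pi> v)\<bar> < \<bar>real (\<pi> y) - real (\<pi> v)\<bar>"
    "X < Y \<longleftrightarrow> \<bar>real (\<pi> y) - real (\<pi> v)\<bar> < \<bar>real (\<pi> x) - real (\<pi> v)\<bar>"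
    unfolding X_def Y_def by (simp_all add: acute_less assms)
  consider "\<pi> x < \<pi> v" "\<pi> y < \<pi> v" | "\<pi> x < \<pi> v" "\<pi> v < \<pi> y" | "\<pi> v < \<pi> x" "\<pi> y < \<pi> v" | "\<pi> v < \<pi> x" "\<pi> v < \<pi> y"
    using assms(3,4) by linarith
  then show ?thesis
  proof cases
    case 1
    then have "Y < X \<longleftrightarrow> \<pi> y < \<pi> x" "X < Y \<longleftrightarrow> \<pi> x < \<pi> y" unfolding b by auto
    then show ?thesis using 1 a unfolding angle_def before_def quadrant_def X_def[symmetric] Y_def[symmetric]
      by auto
  next
    case 2 then show ?thesis using a unfolding angle_def before_def quadrant_def X_def[symmetric] Y_def[symmetric]
      by auto
  next
    case 3 then show ?thesis using a unfolding angle_def before_def quadrant_def X_def[symmetric] Y_def[symmetric]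
      by auto
  next
    case 4
    then have "Y < X \<longleftrightarrow> \<pi> x < \<pi> y" "X < Y \<longleftrightarrow> \<pi> y < \<pi> x" unfolding b by auto
    then show ?thesis using 4 a unfolding angle_def before_def quadrant_def X_def[symmetric] Y_def[symmetric]
      by auto
  qed
qed

text \<open>In coordinates centred at \<open>v\<close> the semicircle satisfies
  \<open>X\<^sup>2 = y * (\<delta> - y)\<close> and the small circle
  \<open>X\<^sup>2 + y\<^sup>2 = \<epsilon>\<^sup>2\<close>. Together they give
  \<open>y * \<delta> = \<epsilon>\<^sup>2\<close>, which fixes the height, and the side of the
  spine fixes the sign of \<open>X\<close>.\<close>

lemma arc_circle:
  assumes e: "0 < \<epsilon>" "\<epsilon> < 1" and xv: "\<pi> x \<noteq> \<pi> v"
  shows "edge_arc \<pi> L v x \<inter> sphere (spine_point \<pi> v) \<epsilon> = {spine_point \<pi> v + rcis \<epsilon> (angle \<pi> L v \<epsilon> x)}"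
proof -
  define \<delta> where "\<delta> = real (\<pi> x) - real (\<pi> v)"
  define \<sigma> :: real where "\<sigma> = (if left_edge L v x then - 1 else 1)"
  define c where "c = sqrt (1 - (\<epsilon> / \<delta>)\<^sup>2)"
  have d: "\<delta> \<noteq> 0" "1 \<le> \<bar>\<delta>\<bar>" using xv by (auto simp: \<delta>_def)
  note ab = acute_bounds[where \<pi>=\<pi> and x=x and v=v and \<epsilon>=\<epsilon>, OF e xv, folded \<delta>_def]
  have abs: "\<bar>\<epsilon> / \<delta>\<bar> < 1" using ab e by (simp add: abs_divide)
  then have "(\<epsilon> / \<delta>)\<^sup>2 < 1" by (simp add: abs_square_less_1)
  then have c: "0 \<le> c" "c\<^sup>2 = 1 - (\<epsilon> / \<delta>)\<^sup>2" by (auto simp: c_def)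
  have sa: "sin (acute \<pi> v \<epsilon> x) = \<epsilon> / \<bar>\<delta>\<bar>" "cos (acute \<pi> v \<epsilon> x) = c"
    unfolding acute_def \<delta>_def[symmetric] using ab by (auto simp: cos_arcsin c_def power_divide)
  have "\<bar>\<delta>\<bar> = (if \<pi> x < \<pi> v then - \<delta> else \<delta>)" by (auto simp: \<delta>_def)
  then have abs_d: "\<epsilon> / \<bar>\<delta>\<bar> = (if \<pi> x < \<pi> v then - (\<epsilon> / \<delta>) else \<epsilon> / \<delta>)" by simp
  have "sin (angle \<pi> L v \<epsilon> x) = \<epsilon> / \<delta>" "cos (angle \<pi> L v \<epsilon> x) = \<sigma> * c"
    using sa abs_d unfolding angle_def quadrant_def \<sigma>_def
    by (auto simp: cos_diff sin_diff cos_add sin_add split: if_splits)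
  then have ang: "rcis \<epsilon> (angle \<pi> L v \<epsilon> x) = Complex (\<sigma> * \<epsilon> * c) (\<epsilon>\<^sup>2 / \<delta>)"
    by (simp add: rcis_def complex_eq_iff power2_eq_square)
  have "z \<in> edge_arc \<pi> L v x \<inter> sphere (spine_point \<pi> v) \<epsilon> \<longleftrightarrow> z = spine_point \<pi> v + Complex (\<sigma> * \<epsilon> * c) (\<epsilon>\<^sup>2 / \<delta>)" for z
  proof -
    define y where "y = Im z - real (\<pi> v)"
    define X where "X = Re z"
    have "dist (spine_point \<pi> v) z = \<epsilon> \<longleftrightarrow> (dist (spine_point \<pi> v) z)\<^sup>2 = \<epsilon>\<^sup>2"
      using e by (subst power2_eq_iff_nonneg) auto
    also have "\<dots> \<longleftrightarrow> X\<^sup>2 + y\<^sup>2 = \<epsilon>\<^sup>2"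
      by (simp add: spine_point_def dist_norm cmod_def y_def X_def power2_commute)
    finally have 1: "dist (spine_point \<pi> v) z = \<epsilon> \<longleftrightarrow> X\<^sup>2 + y\<^sup>2 = \<epsilon>\<^sup>2" .
    have 2: "z \<in> edge_arc \<pi> L v x \<longleftrightarrow> X\<^sup>2 = y * (\<delta> - y) \<and> 0 \<le> \<sigma> * X"
      unfolding edge_arc_iff by (auto simp: y_def X_def \<delta>_def \<sigma>_def)
    have 3: "X\<^sup>2 = y * (\<delta> - y) \<and> 0 \<le> \<sigma> * X \<and> X\<^sup>2 + y\<^sup>2 = \<epsilon>\<^sup>2 \<longleftrightarrow> X = \<sigma> * \<epsilon> * c \<and> y = \<epsilon>\<^sup>2 / \<delta>"
    proof
      assume a: "X\<^sup>2 = y * (\<delta> - y) \<and> 0 \<le> \<sigma> * X \<and> X\<^sup>2 + y\<^sup>2 = \<epsilon>\<^sup>2"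
      then have "y * \<delta> = \<epsilon>\<^sup>2" by (simp add: power2_eq_square algebra_simps)
      then have y: "y = \<epsilon>\<^sup>2 / \<delta>" using d by (simp add: field_simps)
      have "(\<sigma> * X)\<^sup>2 = X\<^sup>2" by (simp add: \<sigma>_def)
      also have "\<dots> = \<epsilon>\<^sup>2 - (\<epsilon>\<^sup>2 / \<delta>)\<^sup>2" using a y by simp
      also have "\<dots> = (\<epsilon> * c)\<^sup>2" unfolding power_mult_distrib c(2) by (simp add: power2_eq_square field_simps)
      finally have "\<sigma> * X = \<epsilon> * c" using a e c by (subst (asm) power2_eq_iff_nonneg) auto
      then have "X = \<sigma> * \<epsilon> * c" by (auto simp: \<sigma>_def split: if_splits)
      then show "X = \<sigma> * \<epsilon> * c \<and> y = \<epsilon>\<^sup>2 / \<delta>" using y by simp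
    next
      assume a: "X = \<sigma> * \<epsilon> * c \<and> y = \<epsilon>\<^sup>2 / \<delta>"
      have s2: "\<sigma>\<^sup>2 = 1" by (simp add: \<sigma>_def)
      have "X\<^sup>2 = \<epsilon>\<^sup>2 * (1 - (\<epsilon> / \<delta>)\<^sup>2)" using a by (simp add: power_mult_distrib s2 c(2))
      also have "\<dots> = \<epsilon>\<^sup>2 - y\<^sup>2" using a by (simp add: power2_eq_square field_simps)
      finally have x2: "X\<^sup>2 = \<epsilon>\<^sup>2 - y\<^sup>2" .
      have "y * \<delta> = \<epsilon>\<^sup>2" using a d by simp
      then have "X\<^sup>2 = y * (\<delta> - y)" using x2 by (simp add: power2_eq_square algebra_simps)
      moreover have "0 \<le> \<sigma> * X" using a e c s2 by (simp add: power2_eq_square flip: mult.assoc)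
      ultimately show "X\<^sup>2 = y * (\<delta> - y) \<and> 0 \<le> \<sigma> * X \<and> X\<^sup>2 + y\<^sup>2 = \<epsilon>\<^sup>2" using x2 by simp
    qed
    have "z = spine_point \<pi> v + Complex (\<sigma> * \<epsilon> * c) (\<epsilon>\<^sup>2 / \<delta>) \<longleftrightarrow> X = \<sigma> * \<epsilon> * c \<and> y = \<epsilon>\<^sup>2 / \<delta>"
      by (auto simp: complex_eq_iff spine_point_def X_def y_def)
    then show ?thesis using 1 2 3 by auto
  qed
  then show ?thesis unfolding ang by blast
qed

lemma Arg2pi_angle:
  assumes e: "0 < \<epsilon>" "\<epsilon> < 1" and xv: "\<pi> x \<noteq> \<pi> v"
  shows "Arg2pi (rcis \<epsilon> (angle \<pi> L v \<epsilon> x)) = angle \<pi> L v \<epsilon> x"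
proof (rule Arg2pi_unique)
  show "complex_of_real \<epsilon> * exp (\<i> * complex_of_real (angle \<pi> L v \<epsilon> x)) = rcis \<epsilon> (angle \<pi> L v \<epsilon> x)"
    by (simp add: rcis_def cis_conv_exp)
  have p: "pi > 0" by simp
  show "0 \<le> angle \<pi> L v \<epsilon> x" "angle \<pi> L v \<epsilon> x < 2 * pi"
    using acute_bounds(3,4)[where \<pi>=\<pi> and x=x and v=v and \<epsilon>=\<epsilon>, OF assms] p by (auto simp: angle_def)
qed fact

text \<open>Heights are integers, so for every radius below 1 the intersections exist, are unique
  and have the same order. The limit thus disappears from the condition.\<close>

theorem clockwise_around_iff:
  assumes xs: "\<And>x. x \<in> set xs \<Longrightarrow> \<pi> x \<noteq> \<pi> v"
  shows "clockwise_around (spine_point \<pi> v) (edge_arc \<pi> L v) xs \<longleftrightarrow>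
    (\<exists>k. sorted_wrt (before \<pi> L v) (rotate k xs))"
proof -
  have eq: "(\<exists>p k. (\<forall>x \<in> set xs. edge_arc \<pi> L v x \<inter> sphere (spine_point \<pi> v) \<epsilon> = {p x}) \<and>
        sorted_wrt (\<lambda>x y. Arg2pi (p x - spine_point \<pi> v) > Arg2pi (p y - spine_point \<pi> v)) (rotate k xs)) \<longleftrightarrow>
      (\<exists>k. sorted_wrt (before \<pi> L v) (rotate k xs))" (is "?l \<longleftrightarrow> ?r") if e: "0 < \<epsilon>" "\<epsilon> < 1" for \<epsilon>
  proof -
    have srt: "sorted_wrt (\<lambda>x y. Arg2pi (p x - spine_point \<pi> v) > Arg2pi (p y - spine_point \<pi> v)) (rotate k xs) \<longleftrightarrow>
        sorted_wrt (before \<pi> L v) (rotate k xs)"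
      if p: "\<forall>x \<in> set xs. p x = spine_point \<pi> v + rcis \<epsilon> (angle \<pi> L v \<epsilon> x)" for p k
    proof -
      have "Arg2pi (p x - spine_point \<pi> v) > Arg2pi (p y - spine_point \<pi> v) \<longleftrightarrow> before \<pi> L v x y"
        if "x \<in> set (rotate k xs)" "y \<in> set (rotate k xs)" for x y
      proof -
        have xy: "x \<in> set xs" "y \<in> set xs" using that by auto
        show ?thesis using p xy by (simp add: Arg2pi_angle e xs angle_less)
      qed
      then show ?thesis by (auto intro: sorted_wrt_mono_rel[rotated])
    qed
    show ?thesis
    proof
      assume ?l
      then obtain p k where p: "\<forall>x \<in> set xs. edge_arc \<pi> L v x \<inter> sphere (spine_point \<pi> v) \<epsilon> = {p x}"
        "sorted_wrt (\<lambda>x y. Arg2pi (p x - spine_point \<pi> v) > Arg2pi (p y - spine_point \<pi> v)) (rotate k xs)" by blast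
      have "\<forall>x \<in> set xs. p x = spine_point \<pi> v + rcis \<epsilon> (angle \<pi> L v \<epsilon> x)"
        using p(1) by (simp add: arc_circle e xs)
      then show ?r using srt p(2) by blast
    next
      assume ?r
      then obtain k where k: "sorted_wrt (before \<pi> L v) (rotate k xs)" by blast
      let ?p = "\<lambda>x. spine_point \<pi> v + rcis \<epsilon> (angle \<pi> L v \<epsilon> x)"
      have "\<forall>x \<in> set xs. edge_arc \<pi> L v x \<inter> sphere (spine_point \<pi> v) \<epsilon> = {?p x}" by (simp add: arc_circle e xs)
      moreover have "sorted_wrt (\<lambda>x y. Arg2pi (?p x - spine_point \<pi> v) > Arg2pi (?p y - spine_point \<pi> v)) (rotate k xs)"
        using srt[of ?p k] k by blast
      ultimately show ?l by (intro exI[of _ ?p] exI[of _ k] conjI)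
    qed
  qed
  have ev: "\<forall>\<^sub>F \<epsilon> in at_right (0::real). 0 < \<epsilon> \<and> \<epsilon> < 1"
    by (auto simp: eventually_at_right_field intro!: exI[of _ 1])
  have "clockwise_around (spine_point \<pi> v) (edge_arc \<pi> L v) xs \<longleftrightarrow>
    (\<forall>\<^sub>F \<epsilon> in at_right (0::real). \<exists>k. sorted_wrt (before \<pi> L v) (rotate k xs))"
    unfolding clockwise_around_def by (rule eventually_subst, rule eventually_mono[OF ev]) (use eq in blast)
  then show ?thesis by simp
qed

subsection \<open>The unbounded region\<close>

definition side :: "'a rel \<Rightarrow> 'a \<times> 'a \<Rightarrow> real" where
  "side L e = (if e \<in> L then - 1 else 1)"

text \<open>The abscissa of the arc at height \<open>y\<close>. The truncation by
  \<open>max 0\<close> keeps it continuous on the whole line and zero beyond the ends of the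
  edge.\<close>

definition arc_x :: "('a \<Rightarrow> nat) \<Rightarrow> 'a rel \<Rightarrow> 'a \<times> 'a \<Rightarrow> real \<Rightarrow> real" where
  "arc_x \<pi> L e y = side L e * sqrt (max 0 ((y - real (\<pi> (fst e))) * (real (\<pi> (snd e)) - y)))"

lemma side_cases: "side L e = 1 \<or> side L e = - 1" "side L e * side L e = 1"
  by (auto simp: side_def)

text \<open>What the geometry uses of a book embedding. It is available for a given embedding and
  for the constructed order, so both directions share it.\<close>

locale book =
  fixes V :: "'a set" and L R :: "'a rel" and s t :: 'a and \<pi> :: "'a \<Rightarrow> nat"
  assumes finV: "finite V" and LR: "L \<inter> R = {}" and EV: "L \<union> R \<subseteq> V \<times> V"
    and mono: "(u, v) \<in> L \<union> R \<Longrightarrow> \<pi> u < \<pi> v" and inj: "inj_on \<pi> V"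
    and sV: "s \<in> V" and tV: "t \<in> V"
    and in_ex: "v \<in> V \<Longrightarrow> v \<noteq> s \<Longrightarrow> \<exists>u. (u, v) \<in> L \<union> R"
    and out_ex: "v \<in> V \<Longrightarrow> v \<noteq> t \<Longrightarrow> \<exists>w. (v, w) \<in> L \<union> R"
    and no_cross: "S = L \<or> S = R \<Longrightarrow> (a, b) \<in> S \<Longrightarrow> (c, d) \<in> S \<Longrightarrow> \<pi> a < \<pi> c \<Longrightarrow> \<pi> c < \<pi> b \<Longrightarrow> \<pi> b < \<pi> d \<Longrightarrow> False"
begin

abbreviation "D \<equiv> book_drawing V L R \<pi>"

lemma s_min: "v \<in> V \<Longrightarrow> \<pi> s \<le> \<pi> v"
proof (induction "\<pi> v" arbitrary: v rule: less_induct)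
  case less
  show ?case
  proof (cases "v = s")
    case False
    then obtain u where "(u, v) \<in> L \<union> R" using in_ex less by blast
    then show ?thesis using less(1)[of u] mono[of u v] EV by auto
  qed simp
qed

lemma t_max: "v \<in> V \<Longrightarrow> \<pi> v \<le> \<pi> t"
proof (induction "Max (\<pi> ` V) - \<pi> v" arbitrary: v rule: less_induct)
  case less
  show ?case
  proof (cases "v = t")
    case False
    then obtain w where w: "(v, w) \<in> L \<union> R" using out_ex less by blast
    then have "\<pi> v < \<pi> w" "w \<in> V" using mono[of v w] EV by auto
    moreover have "\<pi> w \<le> Max (\<pi> ` V)" using \<open>w \<in> V\<close> finV by simp
    ultimately have "Max (\<pi> ` V) - \<pi> w < Max (\<pi> ` V) - \<pi> v" by linarith
    then show ?thesis using less(1)[of w] \<open>w \<in> V\<close> \<open>\<pi> v < \<pi> w\<close> by auto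
  qed simp
qed

lemma left_edge_iff: "(c, d) \<in> L \<union> R \<Longrightarrow> left_edge L c d \<longleftrightarrow> (c, d) \<in> L"
  using mono[of c d] mono[of d c] by (auto simp: left_edge_def)

lemma left_edge_iff': "(c, d) \<in> L \<union> R \<Longrightarrow> left_edge L d c \<longleftrightarrow> (c, d) \<in> L"
  using mono[of c d] mono[of d c] by (auto simp: left_edge_def)

lemma arc_x_iff:
  assumes "(c, d) \<in> L \<union> R"
  shows "Complex X y \<in> edge_arc \<pi> L c d \<longleftrightarrow> real (\<pi> c) \<le> y \<and> y \<le> real (\<pi> d) \<and> X = arc_x \<pi> L (c, d) y"
proof -
  let ?p = "(y - real (\<pi> c)) * (real (\<pi> d) - y)"
  have cd: "real (\<pi> c) < real (\<pi> d)" using mono[OF assms] by simp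
  have p: "0 \<le> ?p \<longleftrightarrow> real (\<pi> c) \<le> y \<and> y \<le> real (\<pi> d)" using cd by (auto simp: zero_le_mult_iff)
  have sg: "(if left_edge L c d then X \<le> 0 else 0 \<le> X) \<longleftrightarrow> 0 \<le> side L (c, d) * X"
    using left_edge_iff[OF assms] by (auto simp: side_def)
  have "X\<^sup>2 = ?p \<and> 0 \<le> side L (c, d) * X \<longleftrightarrow> 0 \<le> ?p \<and> X = side L (c, d) * sqrt ?p"
  proof
    assume a: "X\<^sup>2 = ?p \<and> 0 \<le> side L (c, d) * X"
    then have "0 \<le> ?p" "sqrt ?p = \<bar>X\<bar>" by (metis zero_le_power2, metis real_sqrt_abs)
    then show "0 \<le> ?p \<and> X = side L (c, d) * sqrt ?p" using a by (auto simp: side_def abs_if split: if_splits)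
  next
    assume a: "0 \<le> ?p \<and> X = side L (c, d) * sqrt ?p"
    then have "X\<^sup>2 = ?p" using side_cases(1)[of L "(c, d)"] by (auto simp: power_mult_distrib)
    moreover have "0 \<le> side L (c, d) * X" using a side_cases[of L "(c, d)"] by (simp flip: mult.assoc)
    ultimately show "X\<^sup>2 = ?p \<and> 0 \<le> side L (c, d) * X" by simp
  qed
  then show ?thesis unfolding edge_arc_iff complex.sel sg arc_x_def using p by (auto simp: max_def)
qed

lemma drawing_iff:
  "Complex X y \<in> D \<longleftrightarrow> X = 0 \<and> (\<exists>v \<in> V. y = real (\<pi> v)) \<or>
    (\<exists>(c, d) \<in> L \<union> R. real (\<pi> c) \<le> y \<and> y \<le> real (\<pi> d) \<and> X = arc_x \<pi> L (c, d) y)"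
proof -
  have "Complex X y \<in> spine_point \<pi> ` V \<longleftrightarrow> X = 0 \<and> (\<exists>v \<in> V. y = real (\<pi> v))"
    by (auto simp: spine_point_def image_iff)
  moreover have "Complex X y \<in> (\<Union>(u, v) \<in> L \<union> R. edge_arc \<pi> L u v) \<longleftrightarrow>
      (\<exists>(c, d) \<in> L \<union> R. real (\<pi> c) \<le> y \<and> y \<le> real (\<pi> d) \<and> X = arc_x \<pi> L (c, d) y)"
    using arc_x_iff by fastforce
  ultimately show ?thesis by (simp add: book_drawing_def)
qed

lemma compact_D: "compact D"
proof -
  have "finite (L \<union> R)" using finV EV finite_subset by blast
  moreover have "compact (edge_arc \<pi> L u v)" for u v
    unfolding edge_arc_def by (intro compact_Int_closed compact_sphere)
      (auto simp: closed_halfspace_Re_le closed_halfspace_Re_ge)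
  ultimately have "compact (\<Union>e \<in> L \<union> R. edge_arc \<pi> L (fst e) (snd e))" by (intro compact_UN)
  moreover have "compact (spine_point \<pi> ` V)" using finV by (intro finite_imp_compact) auto
  ultimately show ?thesis unfolding book_drawing_def case_prod_beta by (intro compact_Un)
qed

lemma arc_x_continuous: "isCont (arc_x \<pi> L e) y"
  unfolding arc_x_def by (intro continuous_intros)

lemma arc_x_ends: "arc_x \<pi> L (c, d) (real (\<pi> c)) = 0" "arc_x \<pi> L (c, d) (real (\<pi> d)) = 0"
  by (auto simp: arc_x_def)

text \<open>At a vertex other than \<open>s\<close> the drawing continues downwards along an
  incoming edge; elsewhere the arc itself continues.\<close>

lemma continue_down:
  assumes p: "Complex X y \<in> D" and y: "real (\<pi> s) < y"
  shows "\<exists>(c, d) \<in> L \<union> R. real (\<pi> c) < y \<and> y \<le> real (\<pi> d) \<and> X = arc_x \<pi> L (c, d) y"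
proof -
  have vert: ?thesis if v: "v \<in> V" "y = real (\<pi> v)" "X = 0" for v
  proof -
    have "v \<noteq> s" using y v by auto
    then obtain u where u: "(u, v) \<in> L \<union> R" using in_ex v by blast
    then show ?thesis using mono[OF u] v arc_x_ends by (intro bexI[OF _ u]) auto
  qed
  from p consider v where "v \<in> V" "y = real (\<pi> v)" "X = 0"
    | c d where "(c, d) \<in> L \<union> R" "real (\<pi> c) \<le> y" "y \<le> real (\<pi> d)" "X = arc_x \<pi> L (c, d) y"
    unfolding drawing_iff by auto
  then show ?thesis
  proof cases
    case 1 then show ?thesis by (rule vert)
  next
    case 2
    show ?thesis
    proof (cases "real (\<pi> c) = y")
      case True
      then show ?thesis using vert[of c] 2 EV arc_x_ends(1)[of c d] by auto
    next
      case False then show ?thesis using 2 by (intro bexI[OF _ 2(1)]) auto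
    qed
  qed
qed

lemma continue_up:
  assumes p: "Complex X y \<in> D" and y: "y < real (\<pi> t)"
  shows "\<exists>(c, d) \<in> L \<union> R. real (\<pi> c) \<le> y \<and> y < real (\<pi> d) \<and> X = arc_x \<pi> L (c, d) y"
proof -
  have vert: ?thesis if v: "v \<in> V" "y = real (\<pi> v)" "X = 0" for v
  proof -
    have "v \<noteq> t" using y v by auto
    then obtain u where u: "(v, u) \<in> L \<union> R" using out_ex v by blast
    then show ?thesis using mono[OF u] v arc_x_ends by (intro bexI[OF _ u]) auto
  qed
  from p consider v where "v \<in> V" "y = real (\<pi> v)" "X = 0"
    | c d where "(c, d) \<in> L \<union> R" "real (\<pi> c) \<le> y" "y \<le> real (\<pi> d)" "X = arc_x \<pi> L (c, d) y"
    unfolding drawing_iff by auto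
  then show ?thesis
  proof cases
    case 1 then show ?thesis by (rule vert)
  next
    case 2
    show ?thesis
    proof (cases "real (\<pi> d) = y")
      case True
      then show ?thesis using vert[of d] 2 EV arc_x_ends(2)[of c d] by auto
    next
      case False then show ?thesis using 2 by (intro bexI[OF _ 2(1)]) auto
    qed
  qed
qed

lemma drawing_range: "Complex X y \<in> D \<Longrightarrow> real (\<pi> s) \<le> y \<and> y \<le> real (\<pi> t)"
proof -
  assume "Complex X y \<in> D"
  then consider v where "v \<in> V" "y = real (\<pi> v)" | c d where "c \<in> V" "d \<in> V" "real (\<pi> c) \<le> y" "y \<le> real (\<pi> d)"
    unfolding drawing_iff using EV by blast
  then show ?thesis
  proof cases
    case 1 then show ?thesis using s_min t_max by auto
  next
    case 2
    then have "real (\<pi> s) \<le> real (\<pi> c)" "real (\<pi> d) \<le> real (\<pi> t)" using s_min t_max by auto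
    then show ?thesis using 2 by linarith
  qed
qed

lemma drawing_extreme:
  assumes p: "Complex X y \<in> D" and y: "y = real (\<pi> s) \<or> y = real (\<pi> t)"
  shows "X = 0"
proof -
  from p consider "X = 0"
    | c d where "(c, d) \<in> L \<union> R" "real (\<pi> c) \<le> y" "y \<le> real (\<pi> d)" "X = arc_x \<pi> L (c, d) y"
    unfolding drawing_iff by auto
  then show ?thesis
  proof cases
    case 2
    have "\<pi> s \<le> \<pi> c" "\<pi> d \<le> \<pi> t" using s_min t_max 2(1) EV by auto
    then have "y = real (\<pi> c) \<or> y = real (\<pi> d)" using y 2(2,3) by auto
    then show ?thesis using 2(4) arc_x_ends by auto
  qed
qed

text \<open>For \<open>\<sigma> = 1\<close> the shadow that the drawing casts to the east, for
  \<open>\<sigma> = - 1\<close> the one to the west.\<close>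

definition strictly :: "real \<Rightarrow> complex set" where
  "strictly \<sigma> = {z. \<exists>X. Complex X (Im z) \<in> D \<and> \<sigma> * X < \<sigma> * Re z}"

definition weakly :: "real \<Rightarrow> complex set" where
  "weakly \<sigma> = {z. \<exists>X. Complex X (Im z) \<in> D \<and> \<sigma> * X \<le> \<sigma> * Re z}"

text \<open>It is the sum of the compact drawing and a closed set of horizontal vectors.\<close>

lemma closed_weakly: "closed (weakly \<sigma>)"
proof -
  have "weakly \<sigma> = (\<Union>x \<in> D. \<Union>y \<in> {w. Im w = 0 \<and> 0 \<le> \<sigma> * Re w}. {x + y})"
  proof (intro subset_antisym subsetI)
    fix z assume "z \<in> weakly \<sigma>"
    then obtain X where X: "Complex X (Im z) \<in> D" "\<sigma> * X \<le> \<sigma> * Re z" by (auto simp: weakly_def)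
    have "z = Complex X (Im z) + Complex (Re z - X) 0" by (simp add: complex_eq_iff)
    moreover have "Complex (Re z - X) 0 \<in> {w. Im w = 0 \<and> 0 \<le> \<sigma> * Re w}" using X by (simp add: right_diff_distrib)
    ultimately show "z \<in> (\<Union>x \<in> D. \<Union>y \<in> {w. Im w = 0 \<and> 0 \<le> \<sigma> * Re w}. {x + y})" using X(1) by blast
  next
    fix z assume "z \<in> (\<Union>x \<in> D. \<Union>y \<in> {w. Im w = 0 \<and> 0 \<le> \<sigma> * Re w}. {x + y})"
    then obtain x y where "x \<in> D" "Im y = 0" "0 \<le> \<sigma> * Re y" "z = x + y" by blast
    then show "z \<in> weakly \<sigma>" unfolding weakly_def by (auto intro!: exI[of _ "Re x"] simp: distrib_left)
  qed
  moreover have "closed {w. Im w = 0 \<and> 0 \<le> \<sigma> * Re w}"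
    by (intro closed_Collect_conj closed_Collect_eq closed_Collect_le continuous_intros)
  ultimately show ?thesis using compact_closed_sums[OF compact_D] by simp
qed

text \<open>The drawing point that casts its shadow on \<open>z\<close> continues along arcs both
  downwards and upwards, and by continuity these cast a shadow on all points near \<open>z\<close>.
  At the extreme heights one of the continuations is missing.\<close>

lemma strictly_nhds:
  assumes z: "z \<in> strictly \<sigma>" and y: "real (\<pi> s) < Im z" "Im z < real (\<pi> t)"
  shows "\<forall>\<^sub>F w in nhds z. w \<in> strictly \<sigma>"
proof -
  obtain X where X: "Complex X (Im z) \<in> D" "\<sigma> * X < \<sigma> * Re z" using z by (auto simp: strictly_def)
  obtain c d where cd: "(c, d) \<in> L \<union> R" "real (\<pi> c) < Im z" "Im z \<le> real (\<pi> d)" "X = arc_x \<pi> L (c, d) (Im z)"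
    using continue_down[OF X(1) y(1)] by auto
  obtain c' d' where cd': "(c', d') \<in> L \<union> R" "real (\<pi> c') \<le> Im z" "Im z < real (\<pi> d')" "X = arc_x \<pi> L (c', d') (Im z)"
    using continue_up[OF X(1) y(2)] by auto
  have lim: "((\<lambda>w. arc_x \<pi> L e (Im w)) \<longlongrightarrow> arc_x \<pi> L e (Im z)) (nhds z)" for e
    using isCont_tendsto_compose[OF arc_x_continuous tendsto_Im[OF filterlim_ident]] .
  have ev: "\<forall>\<^sub>F w in nhds z. \<sigma> * arc_x \<pi> L e (Im w) < \<sigma> * Re w" if "X = arc_x \<pi> L e (Im z)" for e
  proof -
    have "((\<lambda>w. \<sigma> * Re w - \<sigma> * arc_x \<pi> L e (Im w)) \<longlongrightarrow> \<sigma> * Re z - \<sigma> * arc_x \<pi> L e (Im z)) (nhds z)"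
      by (intro tendsto_intros lim filterlim_ident)
    moreover have "0 < \<sigma> * Re z - \<sigma> * arc_x \<pi> L e (Im z)" using X(2) that by simp
    ultimately have "\<forall>\<^sub>F w in nhds z. 0 < \<sigma> * Re w - \<sigma> * arc_x \<pi> L e (Im w)" by (rule order_tendstoD(1))
    then show ?thesis by (auto elim: eventually_mono)
  qed
  have im: "(Im \<longlongrightarrow> Im z) (nhds z)" by (intro tendsto_intros filterlim_ident)
  have "\<forall>\<^sub>F w in nhds z. real (\<pi> c) < Im w" "\<forall>\<^sub>F w in nhds z. Im w < real (\<pi> d')"
    using order_tendstoD[OF im] cd(2) cd'(3) by auto
  then show ?thesis using ev[OF cd(4)] ev[OF cd'(4)]
  proof eventually_elim
    case (elim w)
    show ?case
    proof (cases "Im w \<le> Im z")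
      case True
      then have "Complex (arc_x \<pi> L (c, d) (Im w)) (Im w) \<in> D"
        unfolding drawing_iff using cd elim by (intro disjI2 bexI[OF _ cd(1)]) auto
      then show ?thesis using elim by (auto simp: strictly_def)
    next
      case False
      then have "Complex (arc_x \<pi> L (c', d') (Im w)) (Im w) \<in> D"
        unfolding drawing_iff using cd' elim by (intro disjI2 bexI[OF _ cd'(1)]) auto
      then show ?thesis using elim by (auto simp: strictly_def)
    qed
  qed
qed

text \<open>The points off the drawing that have points of the drawing both to their west and to their
  east form a bounded set that is open and closed in the complement of the drawing: through every
  point of the drawing between the lowest and the highest vertex it extends upwards and downwards.\<close>

lemma not_outside:
  assumes z: "Complex X\<^sub>1 (Im z) \<in> D" "X\<^sub>1 < Re z" "Complex X\<^sub>2 (Im z) \<in> D" "Re z < X\<^sub>2"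
  shows "z \<notin> outside D"
proof
  assume "z \<in> outside D"
  then have zD: "z \<in> - D" and unb: "\<not> bounded (connected_component_set (- D) z)"
    by (auto simp: outside_def)
  define U where "U = - D \<inter> strictly 1 \<inter> strictly (- 1)"
  \<comment> \<open>Together with the drawing, \<open>U\<close> is an intersection of closed
    shadows, so the rest of the complement is open.\<close>
  have U_alt: "U \<union> D = weakly 1 \<inter> weakly (- 1)"
  proof (intro subset_antisym subsetI)
    fix w assume "w \<in> U \<union> D"
    then show "w \<in> weakly 1 \<inter> weakly (- 1)"
      unfolding U_def strictly_def weakly_def by (auto intro: exI[of _ "Re w"] less_imp_le)
  next
    fix w assume "w \<in> weakly 1 \<inter> weakly (- 1)"
    then obtain X Y where XY: "Complex X (Im w) \<in> D" "X \<le> Re w" "Complex Y (Im w) \<in> D" "Re w \<le> Y"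
      by (auto simp: weakly_def)
    show "w \<in> U \<union> D"
    proof (cases "w \<in> D")
      case False
      then have "X \<noteq> Re w" "Y \<noteq> Re w" using XY by auto
      then have "1 * X < 1 * Re w" "- 1 * Y < - 1 * Re w" using XY by auto
      then have "w \<in> strictly 1" "w \<in> strictly (- 1)" using XY unfolding strictly_def by blast+
      then show ?thesis using False by (simp add: U_def)
    qed simp
  qed
  have openD: "open (- D)" using compact_D compact_imp_closed by blast
  have "open (- D - U)"
  proof -
    have "- D - U = - (weakly 1 \<inter> weakly (- 1))" using U_alt by blast
    then show ?thesis using closed_weakly by (auto intro: open_Compl)
  qed
  moreover have "open U"
    unfolding open_subopen[of U]
  proof
    fix w assume w: "w \<in> U"
    then obtain X Y where XY: "Complex X (Im w) \<in> D" "X < Re w" "Complex Y (Im w) \<in> D" "Re w < Y"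
      by (auto simp: U_def strictly_def)
    \<comment> \<open>At the heights of \<open>s\<close> and \<open>t\<close> the drawing is a
      single point, which cannot be on both sides of \<open>w\<close>.\<close>
    have "Im w \<noteq> real (\<pi> s)" "Im w \<noteq> real (\<pi> t)"
      using drawing_extreme[OF XY(1)] drawing_extreme[OF XY(3)] XY by auto
    then have y: "real (\<pi> s) < Im w" "Im w < real (\<pi> t)" using drawing_range[OF XY(1)] by auto
    have "\<forall>\<^sub>F x in nhds w. x \<in> - D" using w by (intro eventually_nhds_in_open openD) (auto simp: U_def)
    moreover have "\<forall>\<^sub>F x in nhds w. x \<in> strictly 1" "\<forall>\<^sub>F x in nhds w. x \<in> strictly (- 1)"
      using strictly_nhds[OF _ y] w by (auto simp: U_def)
    ultimately have "\<forall>\<^sub>F x in nhds w. x \<in> U" unfolding U_def by eventually_elim simp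
    then show "\<exists>T. open T \<and> w \<in> T \<and> T \<subseteq> U" unfolding eventually_nhds by blast
  qed
  moreover have zU: "z \<in> U" using z zD unfolding U_def strictly_def by (auto intro: exI[of _ X\<^sub>1] exI[of _ X\<^sub>2])
  let ?C = "connected_component_set (- D) z"
  have C: "connected ?C" "?C \<subseteq> - D" "z \<in> ?C" using zD by (auto simp: connected_component_subset)
  ultimately have "U \<inter> ?C = {} \<or> (- D - U) \<inter> ?C = {}" using connectedD[OF C(1)] by blast
  then have CU: "?C \<subseteq> U" using zU C by blast
  obtain B where B: "\<And>x. x \<in> D \<Longrightarrow> norm x \<le> B" using compact_imp_bounded[OF compact_D] by (auto simp: bounded_iff)
  have "norm w \<le> B + B" if w: "w \<in> U" for w
  proof -
    obtain X Y where XY: "Complex X (Im w) \<in> D" "X < Re w" "Complex Y (Im w) \<in> D" "Re w < Y"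
      using w by (auto simp: U_def strictly_def)
    have "\<bar>X\<bar> \<le> B" "\<bar>Y\<bar> \<le> B" "\<bar>Im w\<bar> \<le> B"
      using B[OF XY(1)] B[OF XY(3)] abs_Re_le_cmod[of "Complex X (Im w)"] abs_Re_le_cmod[of "Complex Y (Im w)"]
        abs_Im_le_cmod[of "Complex X (Im w)"] by auto
    then have "\<bar>Re w\<bar> + \<bar>Im w\<bar> \<le> B + B" using XY by linarith
    then show ?thesis using cmod_le[of w] by linarith
  qed
  then have "bounded U" by (auto simp: bounded_iff)
  then show False using unb CU bounded_subset by blast
qed

text \<open>The ray is connected, unbounded and free of the drawing, so the component of
  \<open>z\<close> is unbounded.\<close>

lemma ray_outside:
  assumes \<sigma>: "\<sigma> = 1 \<or> \<sigma> = - 1" and ray: "\<And>x. 0 \<le> x \<Longrightarrow> z + of_real (\<sigma> * x) \<notin> D"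
  shows "z \<in> outside D"
proof -
  define T where "T = (\<lambda>x. z + of_real (\<sigma> * x)) ` {0..}"
  have "z \<in> T" unfolding T_def by (auto intro!: image_eqI[of _ _ 0])
  have "connected T" unfolding T_def
    by (intro connected_continuous_image continuous_intros) (simp add: convex_connected)
  moreover have "T \<subseteq> - D" using ray by (auto simp: T_def)
  ultimately have sub: "T \<subseteq> connected_component_set (- D) z"
    using \<open>z \<in> T\<close> by (intro connected_component_maximal)
  have "\<not> bounded T"
  proof
    assume "bounded T"
    then obtain B where B: "\<And>w. w \<in> T \<Longrightarrow> norm w \<le> B" by (auto simp: bounded_iff)
    define x where "x = \<bar>B\<bar> + norm z + 1"
    have "0 \<le> x" by (simp add: x_def)
    then have "z + of_real (\<sigma> * x) \<in> T" unfolding T_def by auto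
    then have "norm (z + of_real (\<sigma> * x)) \<le> B" by (rule B)
    moreover have "norm (complex_of_real (\<sigma> * x)) = x" using \<sigma> \<open>0 \<le> x\<close> by (auto simp: norm_of_real simp del: of_real_mult)
    then have "x - norm z \<le> norm (z + of_real (\<sigma> * x))" by (metis add.commute norm_diff_ineq)
    ultimately show False by (simp add: x_def)
  qed
  then have "\<not> bounded (connected_component_set (- D) z)" using sub bounded_subset by blast
  then show ?thesis using \<open>z \<in> T\<close> \<open>T \<subseteq> - D\<close> by (auto simp: outside_def)
qed

section \<open>The regions next to the apex of an arc\<close>

definition mid :: "'a \<times> 'a \<Rightarrow> real" where "mid e = (real (\<pi> (fst e)) + real (\<pi> (snd e))) / 2"
definition rad :: "'a \<times> 'a \<Rightarrow> real" where "rad e = (real (\<pi> (snd e)) - real (\<pi> (fst e))) / 2"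

lemma arc_mid:
  assumes "(u, v) \<in> L \<union> R"
  shows "0 < rad (u, v)" "real (\<pi> u) < mid (u, v)" "mid (u, v) < real (\<pi> v)"
    "arc_x \<pi> L (u, v) (mid (u, v)) = side L (u, v) * rad (u, v)"
    "edge_apex \<pi> L u v = Complex (side L (u, v) * rad (u, v)) (mid (u, v))"
    "edge_apex \<pi> L v u = Complex (side L (u, v) * rad (u, v)) (mid (u, v))"
proof -
  have uv: "real (\<pi> u) < real (\<pi> v)" using mono[OF assms] by simp
  then show r: "0 < rad (u, v)" "real (\<pi> u) < mid (u, v)" "mid (u, v) < real (\<pi> v)"
    by (auto simp: rad_def mid_def)
  have "(mid (u, v) - real (\<pi> u)) * (real (\<pi> v) - mid (u, v)) = (rad (u, v))\<^sup>2"
    by (simp add: rad_def mid_def power2_eq_square field_simps)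
  then show "arc_x \<pi> L (u, v) (mid (u, v)) = side L (u, v) * rad (u, v)"
    using r(1) by (simp add: arc_x_def max_def)
  show "edge_apex \<pi> L u v = Complex (side L (u, v) * rad (u, v)) (mid (u, v))"
    "edge_apex \<pi> L v u = Complex (side L (u, v) * rad (u, v)) (mid (u, v))"
    using uv left_edge_iff[OF assms] left_edge_iff'[OF assms]
    by (auto simp: edge_apex_eq rad_def mid_def side_def)
qed

text \<open>Multiplication by the side gives the distance from the spine, which is the root of the
  product of the height differences to the two ends. Both factors grow with the interval.\<close>

lemma arc_x_wider:
  assumes y: "real (\<pi> c) < y" "y < real (\<pi> d)" and cd: "\<pi> a \<le> \<pi> c" "\<pi> d \<le> \<pi> b"
  shows "side L (c, d) * arc_x \<pi> L (c, d) y \<le> side L (a, b) * arc_x \<pi> L (a, b) y"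
    "\<pi> a \<noteq> \<pi> c \<or> \<pi> d \<noteq> \<pi> b \<Longrightarrow> side L (c, d) * arc_x \<pi> L (c, d) y < side L (a, b) * arc_x \<pi> L (a, b) y"
    "0 < side L (c, d) * arc_x \<pi> L (c, d) y"
proof -
  have e: "side L e * arc_x \<pi> L e y = sqrt (max 0 ((y - real (\<pi> (fst e))) * (real (\<pi> (snd e)) - y)))" for e
    unfolding arc_x_def using side_cases(2)[of L e] by (simp flip: mult.assoc)
  have p: "0 < (y - real (\<pi> c)) * (real (\<pi> d) - y)" using y by simp
  have ab: "real (\<pi> a) \<le> real (\<pi> c)" "real (\<pi> d) \<le> real (\<pi> b)" using cd by auto
  have le: "(y - real (\<pi> c)) * (real (\<pi> d) - y) \<le> (y - real (\<pi> a)) * (real (\<pi> b) - y)"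
    using y ab by (intro mult_mono) auto
  then show "side L (c, d) * arc_x \<pi> L (c, d) y \<le> side L (a, b) * arc_x \<pi> L (a, b) y" unfolding e by auto
  show "0 < side L (c, d) * arc_x \<pi> L (c, d) y" unfolding e using p by simp
  assume "\<pi> a \<noteq> \<pi> c \<or> \<pi> d \<noteq> \<pi> b"
  then have "(y - real (\<pi> c)) * (real (\<pi> d) - y) < (y - real (\<pi> a)) * (real (\<pi> b) - y)"
  proof
    assume "\<pi> a \<noteq> \<pi> c"
    then have "real (\<pi> a) < real (\<pi> c)" using cd by simp
    then show ?thesis using y ab by (intro mult_less_le_imp_less) auto
  next
    assume "\<pi> d \<noteq> \<pi> b"
    then have "real (\<pi> d) < real (\<pi> b)" using cd by simp
    then show ?thesis using y ab by (intro mult_le_less_imp_less) auto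
  qed
  then show "side L (c, d) * arc_x \<pi> L (c, d) y < side L (a, b) * arc_x \<pi> L (a, b) y" unfolding e using p by auto
qed

lemma side_eq: "S = L \<or> S = R \<Longrightarrow> e \<in> S \<Longrightarrow> e' \<in> L \<union> R \<Longrightarrow> side L e' = side L e \<longleftrightarrow> e' \<in> S"
  using LR by (auto simp: side_def)

text \<open>The ray runs away from the spine. An arc that meets it is on the same page and passes
  the middle height, so it is nested with \<open>(u, v)\<close>. By \<open>cov\<close> no other edge
  spans \<open>(u, v)\<close>, and a nested one stays within the distance
  \<open>rad (u, v)\<close>.\<close>

lemma outside_beyond:
  assumes S: "S = L \<or> S = R" and uv: "(u, v) \<in> S"
    and cov: "\<And>c d. (c, d) \<in> S \<Longrightarrow> \<pi> c \<le> \<pi> u \<Longrightarrow> \<pi> v \<le> \<pi> d \<Longrightarrow> (c, d) = (u, v)" and \<delta>: "0 < \<delta>"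
  shows "Complex (side L (u, v) * (rad (u, v) + \<delta>)) (mid (u, v)) \<in> outside D"
proof (rule ray_outside[OF side_cases(1)[of L "(u, v)"]])
  fix x :: real assume x: "0 \<le> x"
  have E: "(u, v) \<in> L \<union> R" using S uv by auto
  note m = arc_mid[OF E]
  let ?\<sigma> = "side L (u, v)" and ?h = "mid (u, v)"
  have s1: "?\<sigma> * ?\<sigma> = 1" by (rule side_cases)
  define X where "X = ?\<sigma> * (rad (u, v) + \<delta> + x)"
  have X: "?\<sigma> * X = rad (u, v) + \<delta> + x" unfolding X_def using s1 by (simp flip: mult.assoc)
  have "Complex X ?h \<notin> D"
  proof
    assume "Complex X ?h \<in> D"
    moreover have "X \<noteq> 0" using X m(1) \<delta> x by auto
    ultimately obtain c d where cd: "(c, d) \<in> L \<union> R" "real (\<pi> c) \<le> ?h" "?h \<le> real (\<pi> d)" "X = arc_x \<pi> L (c, d) ?h"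
      unfolding drawing_iff by auto
    have lt: "real (\<pi> c) < ?h" "?h < real (\<pi> d)"
      using cd arc_x_ends[of c d] \<open>X \<noteq> 0\<close> by (auto simp: order.order_iff_strict)
    have "0 < side L (c, d) * X" using arc_x_wider(3)[OF lt, of c d] cd by auto
    moreover have "0 < ?\<sigma> * X" using X m(1) \<delta> x by linarith
    ultimately have sd: "side L (c, d) = ?\<sigma>"
      using side_cases(1)[of L "(c, d)"] side_cases(1)[of L "(u, v)"] by auto
    then have cdS: "(c, d) \<in> S" using side_eq[OF S uv cd(1)] by simp
    have o: "\<pi> c < \<pi> v" "\<pi> u < \<pi> d" using lt m(2,3) by linarith+
    have nc: "\<not> (\<pi> c < \<pi> u \<and> \<pi> u < \<pi> d \<and> \<pi> d < \<pi> v)" "\<not> (\<pi> u < \<pi> c \<and> \<pi> c < \<pi> v \<and> \<pi> v < \<pi> d)"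
      using no_cross[OF S] uv cdS by blast+
    have "\<pi> u \<le> \<pi> c \<and> \<pi> d \<le> \<pi> v"
    proof (rule ccontr)
      assume n: "\<not> ?thesis"
      then have "\<pi> c \<le> \<pi> u" "\<pi> v \<le> \<pi> d" using nc o by auto
      then show False using cov[OF cdS] n by auto
    qed
    then have "side L (c, d) * X \<le> ?\<sigma> * arc_x \<pi> L (u, v) ?h"
      using arc_x_wider(1)[OF lt, of u v] cd(4) by auto
    then show False using sd X m(4) s1 \<delta> x by (simp flip: mult.assoc)
  qed
  moreover have "Complex (?\<sigma> * (rad (u, v) + \<delta>)) ?h + of_real (?\<sigma> * x) = Complex X ?h"
    by (simp add: X_def complex_eq_iff distrib_left)
  ultimately show "Complex (?\<sigma> * (rad (u, v) + \<delta>)) ?h + of_real (?\<sigma> * x) \<notin> D" by simp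
qed

text \<open>The ray runs to the spine and across it. With no vertex between the ends, every arc at
  the middle height spans \<open>(u, v)\<close>: on the same page it is at least as far out as the
  apex, and on the other page there is none by \<open>cov\<close>.\<close>

lemma outside_below:
  assumes S: "S = L \<and> S' = R \<or> S = R \<and> S' = L" and uv: "(u, v) \<in> S"
    and cov: "\<And>c d. (c, d) \<in> S' \<Longrightarrow> \<not> (\<pi> c \<le> \<pi> u \<and> \<pi> v \<le> \<pi> d)"
    and btw: "\<And>w. w \<in> V \<Longrightarrow> \<not> (\<pi> u < \<pi> w \<and> \<pi> w < \<pi> v)" and \<delta>: "0 < \<delta>"
  shows "Complex (side L (u, v) * (rad (u, v) - \<delta>)) (mid (u, v)) \<in> outside D"
proof -
  have E: "(u, v) \<in> L \<union> R" using S uv by auto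
  note m = arc_mid[OF E]
  let ?\<sigma> = "side L (u, v)" and ?h = "mid (u, v)"
  have s1: "?\<sigma> * ?\<sigma> = 1" by (rule side_cases)
  show ?thesis
  proof (rule ray_outside[of "- ?\<sigma>"])
    show "- ?\<sigma> = 1 \<or> - ?\<sigma> = - 1" using side_cases(1)[of L "(u, v)"] by auto
    fix x :: real assume x: "0 \<le> x"
    define X where "X = ?\<sigma> * (rad (u, v) - \<delta> - x)"
    have X: "?\<sigma> * X = rad (u, v) - \<delta> - x" unfolding X_def using s1 by (simp flip: mult.assoc)
    have nv: "?h \<noteq> real (\<pi> w)" if "w \<in> V" for w using btw[OF that] m(2,3) by auto
    have "Complex X ?h \<notin> D"
    proof
      assume "Complex X ?h \<in> D"
      then obtain c d where cd: "(c, d) \<in> L \<union> R" "real (\<pi> c) \<le> ?h" "?h \<le> real (\<pi> d)" "X = arc_x \<pi> L (c, d) ?h"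
        unfolding drawing_iff using nv by auto
      have V: "c \<in> V" "d \<in> V" using cd EV by auto
      have "real (\<pi> c) \<noteq> ?h" "?h \<noteq> real (\<pi> d)" using nv V by metis+
      then have lt: "real (\<pi> c) < ?h" "?h < real (\<pi> d)" using cd by auto
      then have "\<pi> c < \<pi> v" "\<pi> u < \<pi> d" using m(2,3) by linarith+
      then have cv: "\<pi> c \<le> \<pi> u" "\<pi> v \<le> \<pi> d" using btw[OF V(1)] btw[OF V(2)] by auto
      then have "(c, d) \<notin> S'" using cov by blast
      then have "(c, d) \<in> S" using cd S by auto
      then have sd: "side L (c, d) = ?\<sigma>" using side_eq[of S "(u, v)" "(c, d)"] S uv cd by auto
      have "?\<sigma> * arc_x \<pi> L (u, v) ?h \<le> side L (c, d) * X"
        using arc_x_wider(1)[OF m(2,3) cv] cd(4) by auto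
      then show False using sd X m(4) s1 \<delta> x by (simp flip: mult.assoc)
    qed
    moreover have "Complex (?\<sigma> * (rad (u, v) - \<delta>)) ?h + of_real (- ?\<sigma> * x) = Complex X ?h"
      by (simp add: X_def complex_eq_iff right_diff_distrib)
    ultimately show "Complex (?\<sigma> * (rad (u, v) - \<delta>)) ?h + of_real (- ?\<sigma> * x) \<notin> D" by simp
  qed
qed

lemma left_point:
  assumes E: "(u, v) \<in> L \<union> R"
  shows "edge_apex \<pi> L u v - of_real (sgn (real (\<pi> v) - real (\<pi> u)) * \<delta>) =
      Complex (side L (u, v) * rad (u, v) - \<delta>) (mid (u, v))"
    "edge_apex \<pi> L v u - of_real (sgn (real (\<pi> u) - real (\<pi> v)) * \<delta>) =
      Complex (side L (u, v) * rad (u, v) + \<delta>) (mid (u, v))"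
  using mono[OF E] arc_mid(5,6)[OF E] by (auto simp: complex_eq_iff)

text \<open>West of the apex means beyond the arc for a left edge and under the arc for a right
  edge.\<close>

lemma left_region_up:
  assumes E: "(u, v) \<in> L \<union> R"
    and L: "(u, v) \<in> L \<Longrightarrow> \<forall>(c, d) \<in> L. \<pi> c \<le> \<pi> u \<longrightarrow> \<pi> v \<le> \<pi> d \<longrightarrow> (c, d) = (u, v)"
    and R: "(u, v) \<in> R \<Longrightarrow> (\<forall>(c, d) \<in> L. \<not> (\<pi> c \<le> \<pi> u \<and> \<pi> v \<le> \<pi> d)) \<and> (\<forall>w \<in> V. \<not> (\<pi> u < \<pi> w \<and> \<pi> w < \<pi> v))"
  shows "left_region_unbounded V L R \<pi> (u, v)"
proof -
  have "Complex (side L (u, v) * rad (u, v) - \<delta>) (mid (u, v)) \<in> outside D" if "0 < \<delta>" for \<delta>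
  proof (cases "(u, v) \<in> L")
    case True
    then have "side L (u, v) * rad (u, v) - \<delta> = side L (u, v) * (rad (u, v) + \<delta>)" by (simp add: side_def)
    moreover have "Complex (side L (u, v) * (rad (u, v) + \<delta>)) (mid (u, v)) \<in> outside D"
      by (rule outside_beyond[of L]) (use L True that in auto)
    ultimately show ?thesis by (simp only:)
  next
    case False
    then have "side L (u, v) * rad (u, v) - \<delta> = side L (u, v) * (rad (u, v) - \<delta>)" by (simp add: side_def)
    moreover have "Complex (side L (u, v) * (rad (u, v) - \<delta>)) (mid (u, v)) \<in> outside D"
      by (rule outside_below[of R L]) (use R E False that in auto)
    ultimately show ?thesis by (simp only:)
  qed
  then show ?thesis unfolding left_region_unbounded_def prod.case left_point(1)[OF E]
    by (auto simp: eventually_at_right_field intro!: exI[of _ 1])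
qed

lemma left_region_down:
  assumes E: "(u, v) \<in> L \<union> R"
    and R: "(u, v) \<in> R \<Longrightarrow> \<forall>(c, d) \<in> R. \<pi> c \<le> \<pi> u \<longrightarrow> \<pi> v \<le> \<pi> d \<longrightarrow> (c, d) = (u, v)"
    and L: "(u, v) \<in> L \<Longrightarrow> (\<forall>(c, d) \<in> R. \<not> (\<pi> c \<le> \<pi> u \<and> \<pi> v \<le> \<pi> d)) \<and> (\<forall>w \<in> V. \<not> (\<pi> u < \<pi> w \<and> \<pi> w < \<pi> v))"
  shows "left_region_unbounded V L R \<pi> (v, u)"
proof -
  have "Complex (side L (u, v) * rad (u, v) + \<delta>) (mid (u, v)) \<in> outside D" if "0 < \<delta>" for \<delta>
  proof (cases "(u, v) \<in> L")
    case False
    then have "side L (u, v) * rad (u, v) + \<delta> = side L (u, v) * (rad (u, v) + \<delta>)" by (simp add: side_def)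
    moreover have "Complex (side L (u, v) * (rad (u, v) + \<delta>)) (mid (u, v)) \<in> outside D"
      by (rule outside_beyond[of R]) (use R E False that in auto)
    ultimately show ?thesis by (simp only:)
  next
    case True
    then have "side L (u, v) * rad (u, v) + \<delta> = side L (u, v) * (rad (u, v) - \<delta>)" by (simp add: side_def)
    moreover have "Complex (side L (u, v) * (rad (u, v) - \<delta>)) (mid (u, v)) \<in> outside D"
      by (rule outside_below[of L R]) (use L True that in auto)
    ultimately show ?thesis by (simp only:)
  qed
  then show ?thesis unfolding left_region_unbounded_def prod.case left_point(2)[OF E]
    by (auto simp: eventually_at_right_field intro!: exI[of _ 1])
qed

text \<open>Points just west of the apex have the apex to their east and the drawing point with
  abscissa \<open>X\<close> to their west, so they are enclosed.\<close>

lemma not_left_region_up: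
  assumes E: "(u, v) \<in> L \<union> R" and X: "Complex X (mid (u, v)) \<in> D" "X < side L (u, v) * rad (u, v)"
  shows "\<not> left_region_unbounded V L R \<pi> (u, v)"
proof
  note m = arc_mid[OF E]
  assume "left_region_unbounded V L R \<pi> (u, v)"
  then obtain b where b: "0 < b" "\<And>\<delta>. 0 < \<delta> \<Longrightarrow> \<delta> < b \<Longrightarrow>
      Complex (side L (u, v) * rad (u, v) - \<delta>) (mid (u, v)) \<in> outside D"
    unfolding left_region_unbounded_def prod.case left_point(1)[OF E] eventually_at_right_field by auto
  \<comment> \<open>Small enough to stay in the neighbourhood of the assumption and strictly east of
    \<open>X\<close>.\<close>
  define \<delta> where "\<delta> = min b (side L (u, v) * rad (u, v) - X) / 2"
  have d: "0 < \<delta>" "\<delta> < b" "X < side L (u, v) * rad (u, v) - \<delta>" using b X by (auto simp: \<delta>_def min_def field_simps)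
  have "Complex (side L (u, v) * rad (u, v)) (mid (u, v)) \<in> D"
    unfolding drawing_iff using m by (intro disjI2 bexI[OF _ E]) auto
  then have "Complex (side L (u, v) * rad (u, v) - \<delta>) (mid (u, v)) \<notin> outside D"
    using not_outside[of X "Complex (side L (u, v) * rad (u, v) - \<delta>) (mid (u, v))" "side L (u, v) * rad (u, v)"] X d by simp
  then show False using b(2)[OF d(1,2)] by blast
qed

lemma not_left_region_down:
  assumes E: "(u, v) \<in> L \<union> R" and X: "Complex X (mid (u, v)) \<in> D" "side L (u, v) * rad (u, v) < X"
  shows "\<not> left_region_unbounded V L R \<pi> (v, u)"
proof
  note m = arc_mid[OF E]
  assume "left_region_unbounded V L R \<pi> (v, u)"
  then obtain b where b: "0 < b" "\<And>\<delta>. 0 < \<delta> \<Longrightarrow> \<delta> < b \<Longrightarrow>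
      Complex (side L (u, v) * rad (u, v) + \<delta>) (mid (u, v)) \<in> outside D"
    unfolding left_region_unbounded_def prod.case left_point(2)[OF E] eventually_at_right_field by auto
  define \<delta> where "\<delta> = min b (X - side L (u, v) * rad (u, v)) / 2"
  have d: "0 < \<delta>" "\<delta> < b" "side L (u, v) * rad (u, v) + \<delta> < X" using b X by (auto simp: \<delta>_def min_def field_simps)
  have "Complex (side L (u, v) * rad (u, v)) (mid (u, v)) \<in> D"
    unfolding drawing_iff using m by (intro disjI2 bexI[OF _ E]) auto
  then have "Complex (side L (u, v) * rad (u, v) + \<delta>) (mid (u, v)) \<notin> outside D"
    using not_outside[of "side L (u, v) * rad (u, v)" "Complex (side L (u, v) * rad (u, v) + \<delta>) (mid (u, v))" X] X d by simp
  then show False using b(2)[OF d(1,2)] by blast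
qed

lemma drawing_arc: "(c, d) \<in> L \<union> R \<Longrightarrow> real (\<pi> c) < y \<Longrightarrow> y < real (\<pi> d) \<Longrightarrow> Complex (arc_x \<pi> L (c, d) y) y \<in> D"
  unfolding drawing_iff by (intro disjI2 bexI[of _ "(c, d)"]) auto

lemma drawing_vertex: "w \<in> V \<Longrightarrow> Complex 0 (real (\<pi> w)) \<in> D"
  unfolding drawing_iff by auto

text \<open>At the height of the apex of \<open>(s, x)\<close> there is a drawing point further
  west. A left edge \<open>(s, x)\<close> is spanned by the longer left edge \<open>(s, y)\<close>.
  For a right edge, a vertex at this height will do, or else an edge that starts in the highest
  vertex below it: the edge \<open>(s, y)\<close> if this is \<open>s\<close>, and otherwise any
  outgoing edge, which is west of the spine or, since right edges do not cross, nested under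
  \<open>(s, x)\<close>.\<close>

lemma left_region_source:
  assumes x: "(s, x) \<in> L \<union> R" and y: "(s, y) \<in> L \<union> R" and b: "before \<pi> L s y x"
  shows "\<not> left_region_unbounded V L R \<pi> (s, x)"
proof -
  note m = arc_mid[OF x]
  let ?h = "mid (s, x)"
  have lx: "\<pi> s < \<pi> x" "\<pi> s < \<pi> y" using mono x y by auto
  have b': "(s, y) \<in> L \<and> ((s, x) \<in> L \<longrightarrow> \<pi> x < \<pi> y) \<or> (s, y) \<in> R \<and> (s, x) \<in> R \<and> \<pi> y < \<pi> x"
    using b lx left_edge_iff[OF x] left_edge_iff[OF y] x y LR unfolding before_def quadrant_def
    by (auto split: if_splits)
  have "\<exists>X. Complex X ?h \<in> D \<and> X < side L (s, x) * rad (s, x)"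
  proof (cases "(s, x) \<in> L")
    case True
    then have yL: "(s, y) \<in> L" "\<pi> x < \<pi> y" using b' LR by auto
    have "?h < real (\<pi> y)" using m(3) yL by linarith
    then have "Complex (arc_x \<pi> L (s, y) ?h) ?h \<in> D" using drawing_arc[OF y m(2)] by blast
    moreover have "side L (s, x) * arc_x \<pi> L (s, x) ?h < side L (s, y) * arc_x \<pi> L (s, y) ?h"
      using arc_x_wider(2)[OF m(2,3), of s y] yL by auto
    then have "arc_x \<pi> L (s, y) ?h < side L (s, x) * rad (s, x)" using m(4) True yL by (simp add: side_def)
    ultimately show ?thesis by blast
  next
    case False
    then have xR: "(s, x) \<in> R" "side L (s, x) = 1" using x by (auto simp: side_def)
    show ?thesis
    proof (cases "\<exists>w \<in> V. real (\<pi> w) = ?h")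
      case True
      then show ?thesis using drawing_vertex m(1) xR by (metis mult_1)
    next
      case nv: False
      have nv': "?h < real (\<pi> w)" if "w \<in> V" "\<not> real (\<pi> w) < ?h" for w using nv that by force
      define W where "W = {w \<in> V. real (\<pi> w) < ?h}"
      have W: "finite W" "W \<noteq> {}" using finV sV m(2) by (auto simp: W_def)
      obtain w where w: "w \<in> W" "\<And>u. u \<in> W \<Longrightarrow> \<pi> u \<le> \<pi> w"
        using Max_in[of "\<pi> ` W"] Max_ge[of "\<pi> ` W"] W by (metis (no_types, lifting) finite_imageI image_iff image_is_empty)
      have wV: "w \<in> V" "real (\<pi> w) < ?h" using w by (auto simp: W_def)
      have up: "?h < real (\<pi> w')" if "w' \<in> V" "\<pi> w < \<pi> w'" for w'
        using nv'[OF that(1)] w(2)[of w'] that by (auto simp: W_def)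
      have arcL: ?thesis if e: "(a, c) \<in> L" "real (\<pi> a) < ?h" "?h < real (\<pi> c)" for a c
      proof -
        have "0 < side L (a, c) * arc_x \<pi> L (a, c) ?h" using arc_x_wider(3)[OF e(2,3)] by auto
        then have "arc_x \<pi> L (a, c) ?h < side L (s, x) * rad (s, x)" using e(1) xR m(1) by (simp add: side_def)
        moreover have "Complex (arc_x \<pi> L (a, c) ?h) ?h \<in> D" using drawing_arc e by auto
        ultimately show ?thesis by blast
      qed
      have arcR: ?thesis if e: "(a, c) \<in> R" "real (\<pi> a) < ?h" "?h < real (\<pi> c)" "\<pi> c \<le> \<pi> x" "\<pi> a \<noteq> \<pi> s \<or> \<pi> c \<noteq> \<pi> x" for a c
      proof -
        have "\<pi> s \<le> \<pi> a" using s_min e(1) EV by auto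
        then have "side L (a, c) * arc_x \<pi> L (a, c) ?h < side L (s, x) * arc_x \<pi> L (s, x) ?h"
          using arc_x_wider(2)[OF e(2,3) _ e(4), of s] e(5) by auto
        moreover have "side L (a, c) = 1" using e(1) LR by (auto simp: side_def)
        ultimately have "arc_x \<pi> L (a, c) ?h < side L (s, x) * rad (s, x)" using xR m(4) by simp
        moreover have "Complex (arc_x \<pi> L (a, c) ?h) ?h \<in> D" using drawing_arc e by auto
        ultimately show ?thesis by blast
      qed
      show ?thesis
      proof (cases "w = s")
        case True
        have "?h < real (\<pi> y)" using up[of y] y EV lx True by auto
        then show ?thesis using arcL[of s y] arcR[of s y] b' m(2) xR LR by auto
      next
        case False
        have "\<pi> x \<le> \<pi> t" using t_max x EV by auto
        then have "w \<noteq> t" using wV m(3) by auto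
        then obtain w' where w': "(w, w') \<in> L \<union> R" using out_ex wV by blast
        have h: "?h < real (\<pi> w')" using up[of w'] mono[OF w'] w' EV by auto
        have sw: "\<pi> s < \<pi> w" using s_min[OF wV(1)] False inj sV wV by (metis inj_onD le_neq_implies_less)
        show ?thesis
        proof (cases "(w, w') \<in> L")
          case True then show ?thesis using arcL wV h by blast
        next
          case False
          then have R: "(w, w') \<in> R" using w' by auto
          have "\<pi> w < \<pi> x" using wV m(3) by linarith
          then have "\<pi> w' \<le> \<pi> x" using no_cross[of R s x w w'] xR R sw by force
          then show ?thesis using arcR[OF R wV(2) h] sw by auto
        qed
      qed
    qed
  qed
  then show ?thesis using not_left_region_up[OF x] by blast
qed

text \<open>The argument of \<open>left_region_source\<close> turned by a half turn: the lowest
  vertex above the height of the apex and an edge into it, with drawing points to the east.\<close>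

lemma left_region_sink:
  assumes x: "(x, t) \<in> L \<union> R" and y: "(y, t) \<in> L \<union> R" and b: "before \<pi> L t y x"
  shows "\<not> left_region_unbounded V L R \<pi> (t, x)"
proof -
  note m = arc_mid[OF x]
  let ?h = "mid (x, t)"
  have lx: "\<pi> x < \<pi> t" "\<pi> y < \<pi> t" using mono x y by auto
  have b': "(y, t) \<in> R \<and> ((x, t) \<in> R \<longrightarrow> \<pi> y < \<pi> x) \<or> (y, t) \<in> L \<and> (x, t) \<in> L \<and> \<pi> x < \<pi> y"
    using b lx left_edge_iff'[OF x] left_edge_iff'[OF y] x y LR unfolding before_def quadrant_def
    by (auto split: if_splits)
  have "\<exists>X. Complex X ?h \<in> D \<and> side L (x, t) * rad (x, t) < X"
  proof (cases "(x, t) \<in> R")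
    case True
    then have yR: "(y, t) \<in> R" "\<pi> y < \<pi> x" using b' LR by auto
    have sd: "side L (x, t) = 1" "side L (y, t) = 1" using True yR LR by (auto simp: side_def)
    have "real (\<pi> y) < ?h" using m(2) yR by linarith
    then have "Complex (arc_x \<pi> L (y, t) ?h) ?h \<in> D" using drawing_arc[OF y _ m(3)] by blast
    moreover have "side L (x, t) * arc_x \<pi> L (x, t) ?h < side L (y, t) * arc_x \<pi> L (y, t) ?h"
      using arc_x_wider(2)[OF m(2,3), of y t] yR by auto
    then have "side L (x, t) * rad (x, t) < arc_x \<pi> L (y, t) ?h" using m(4) sd by simp
    ultimately show ?thesis by blast
  next
    case False
    then have xL: "(x, t) \<in> L" "side L (x, t) = - 1" using x by (auto simp: side_def)
    show ?thesis
    proof (cases "\<exists>w \<in> V. real (\<pi> w) = ?h")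
      case True
      then obtain w where "w \<in> V" "real (\<pi> w) = ?h" by blast
      then show ?thesis using drawing_vertex[of w] m(1) xL by (intro exI[of _ 0]) auto
    next
      case nv: False
      have nv': "real (\<pi> w) < ?h" if "w \<in> V" "\<not> ?h < real (\<pi> w)" for w using nv that by force
      define W where "W = {w \<in> V. ?h < real (\<pi> w)}"
      have W: "finite W" "W \<noteq> {}" using finV tV m(3) by (auto simp: W_def)
      obtain w where w: "w \<in> W" "\<And>u. u \<in> W \<Longrightarrow> \<pi> w \<le> \<pi> u"
        using Min_in[of "\<pi> ` W"] Min_le[of "\<pi> ` W"] W by (metis (no_types, lifting) finite_imageI image_iff image_is_empty)
      have wV: "w \<in> V" "?h < real (\<pi> w)" using w by (auto simp: W_def)
      have down: "real (\<pi> w') < ?h" if "w' \<in> V" "\<pi> w' < \<pi> w" for w'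
        using nv'[OF that(1)] w(2)[of w'] that by (auto simp: W_def)
      have arcR: ?thesis if e: "(a, c) \<in> R" "real (\<pi> a) < ?h" "?h < real (\<pi> c)" for a c
      proof -
        have "side L (a, c) = 1" using e(1) LR by (auto simp: side_def)
        then have "0 < arc_x \<pi> L (a, c) ?h" using arc_x_wider(3)[OF e(2,3), of a c] by auto
        then have "side L (x, t) * rad (x, t) < arc_x \<pi> L (a, c) ?h" using xL m(1) by simp
        moreover have "Complex (arc_x \<pi> L (a, c) ?h) ?h \<in> D" using drawing_arc e by auto
        ultimately show ?thesis by blast
      qed
      have arcL: ?thesis if e: "(a, c) \<in> L" "real (\<pi> a) < ?h" "?h < real (\<pi> c)" "\<pi> x \<le> \<pi> a" "\<pi> a \<noteq> \<pi> x \<or> \<pi> c \<noteq> \<pi> t" for a c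
      proof -
        have "\<pi> c \<le> \<pi> t" using t_max e(1) EV by auto
        then have "side L (a, c) * arc_x \<pi> L (a, c) ?h < side L (x, t) * arc_x \<pi> L (x, t) ?h"
          using arc_x_wider(2)[OF e(2,3,4), of t] e(5) by auto
        moreover have "side L (a, c) = - 1" using e(1) by (auto simp: side_def)
        ultimately have "side L (x, t) * rad (x, t) < arc_x \<pi> L (a, c) ?h" using xL m(4) by simp
        moreover have "Complex (arc_x \<pi> L (a, c) ?h) ?h \<in> D" using drawing_arc e by auto
        ultimately show ?thesis by blast
      qed
      show ?thesis
      proof (cases "w = t")
        case True
        have "real (\<pi> y) < ?h" using down[of y] y EV lx True by auto
        then show ?thesis using arcL[of y t] arcR[of y t] b' m(3) xL LR by auto
      next
        case False
        have "\<pi> s \<le> \<pi> x" using s_min x EV by auto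
        then have "w \<noteq> s" using wV m(2) by auto
        then obtain w' where w': "(w', w) \<in> L \<union> R" using in_ex wV by blast
        have h: "real (\<pi> w') < ?h" using down[of w'] mono[OF w'] w' EV by auto
        have sw: "\<pi> w < \<pi> t" using t_max[OF wV(1)] False inj tV wV by (metis inj_onD le_neq_implies_less)
        show ?thesis
        proof (cases "(w', w) \<in> R")
          case True then show ?thesis using arcR wV h by blast
        next
          case False
          then have R: "(w', w) \<in> L" using w' by auto
          have "\<pi> x < \<pi> w" using wV m(2) by linarith
          then have "\<pi> x \<le> \<pi> w'" using no_cross[of L w' w x t] xL R sw by force
          then show ?thesis using arcL[OF R h wV(2)] sw by auto
        qed
      qed
    qed
  qed
  then show ?thesis using not_left_region_down[OF x] by blast
qed

end

section \<open>4-modality and the rotation system\<close>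

definition modal_lists :: "'a set \<Rightarrow> 'a rel \<Rightarrow> ('a \<Rightarrow> 'a list) \<Rightarrow> ('a \<Rightarrow> 'a list) \<Rightarrow> bool" where
  "modal_lists V R outs cin \<longleftrightarrow>
    (\<forall>v \<in> V. sorted_wrt (\<lambda>x y. (v, x) \<in> R \<longrightarrow> (v, y) \<in> R) (outs v) \<and>
      sorted_wrt (\<lambda>x y. (y, v) \<in> R \<longrightarrow> (x, v) \<in> R) (cin v))"

lemma sorted_wrt_filter_split:
  assumes "sorted_wrt P xs" "\<And>x y. x \<in> set xs \<Longrightarrow> y \<in> set xs \<Longrightarrow> P x y \<Longrightarrow> Q y \<Longrightarrow> Q x"
  shows "xs = filter Q xs @ filter (\<lambda>x. \<not> Q x) xs"
  using assms
proof (induction xs)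
  case (Cons a xs)
  then have IH: "xs = filter Q xs @ filter (\<lambda>x. \<not> Q x) xs" by auto
  show ?case
  proof (cases "Q a")
    case False
    then have "filter Q xs = []" using Cons.prems by (auto simp: filter_empty_conv)
    then show ?thesis using False IH by simp
  qed (use IH in simp)
qed simp

lemma sorted_wrt_total: "(\<And>x y. x \<in> set xs \<Longrightarrow> y \<in> set xs \<Longrightarrow> P x y) \<Longrightarrow> sorted_wrt P xs"
  by (induction xs) auto

locale partitioned_st =
  fixes V :: "'a set" and L R :: "'a rel" and s t :: 'a and rot outer
  assumes part: "partitioned_digraph V L R" and st: "plane_st_graph V (L \<union> R) s t rot outer"
begin

abbreviation "E \<equiv> L \<union> R"

lemma graph:
  shows "finite V" "E \<subseteq> V \<times> V" "acyclic E" "L \<inter> R = {}" "s \<in> V" "t \<in> V" "s \<noteq> t"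
    "v \<in> V \<Longrightarrow> is_source E v \<longleftrightarrow> v = s" "v \<in> V \<Longrightarrow> is_sink E v \<longleftrightarrow> v = t"
    "v \<in> V \<Longrightarrow> distinct (rot v)" "v \<in> V \<Longrightarrow> set (rot v) = {w. (v, w) \<in> E \<or> (w, v) \<in> E}"
    "(u, v) \<in> E \<Longrightarrow> (v, u) \<notin> E"
proof -
  show *: "finite V" "E \<subseteq> V \<times> V" "acyclic E" "L \<inter> R = {}" "s \<noteq> t"
    "v \<in> V \<Longrightarrow> distinct (rot v)" "v \<in> V \<Longrightarrow> set (rot v) = {w. (v, w) \<in> E \<or> (w, v) \<in> E}"
    using part st unfolding partitioned_digraph_def plane_st_graph_def rotation_system_def by blast+
  have so: "{v \<in> V. is_source E v} = {s}" and si: "{v \<in> V. is_sink E v} = {t}"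
    using st unfolding plane_st_graph_def by blast+
  show "s \<in> V" "t \<in> V" using so si by auto
  show "v \<in> V \<Longrightarrow> is_source E v \<longleftrightarrow> v = s" "v \<in> V \<Longrightarrow> is_sink E v \<longleftrightarrow> v = t" using so si by auto
  show "(u, v) \<in> E \<Longrightarrow> (v, u) \<notin> E"
  proof
    assume "(u, v) \<in> E" "(v, u) \<in> E"
    then have "(u, u) \<in> E\<^sup>+" by (rule trancl_into_trancl[OF r_into_trancl])
    then show False using *(3) by (simp add: acyclic_def)
  qed
qed

text \<open>Shown from the rotation system alone, because it serves to establish bimodality.\<close>

lemma outer_darts: "outer \<subseteq> darts E"
proof
  fix e assume e: "e \<in> outer"
  obtain d where d: "d \<in> darts E" "outer = orbit (face_step rot) d"
    using st by (auto simp: plane_st_graph_def faces_def)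
  have step: "face_step rot d \<in> darts E" if "d \<in> darts E" for d
  proof -
    obtain u v where uv: "d = (u, v)" by (cases d)
    have v: "v \<in> V" "u \<in> set (rot v)" using that uv graph(2) graph(11)[of v] by (auto simp: darts_def)
    have "cyc_next (rot v) u \<in> set (rot v)" by (rule cyc_next_in[OF graph(10)[OF v(1)] v(2)])
    then show ?thesis using graph(11)[OF v(1)] by (auto simp: uv face_step_def darts_def)
  qed
  from e show "e \<in> darts E" unfolding d(2) by induction (use d(1) step in blast)+
qed

text \<open>The three cases of \<open>four_modal_vertex\<close> take a common form, because the
  incoming lists are empty at the source and the outgoing lists at the sink.\<close>

lemma four_modal_lists:
  assumes "four_modal V L R rot outer"
  shows "\<exists>outs cin. bimodal V E s t rot outer outs cin \<and> modal_lists V R outs cin"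
proof -
  have "\<exists>outs cin. (\<exists>k. rotate k (rot v) = outs @ cin) \<and> set outs = {w. (v, w) \<in> E} \<and> set cin = {u. (u, v) \<in> E} \<and>
      (v = s \<longrightarrow> (s, hd outs) \<in> outer) \<and> (v = t \<longrightarrow> (t, hd cin) \<in> outer) \<and>
      sorted_wrt (\<lambda>x y. (v, x) \<in> R \<longrightarrow> (v, y) \<in> R) outs \<and> sorted_wrt (\<lambda>x y. (y, v) \<in> R \<longrightarrow> (x, v) \<in> R) cin"
    if v: "v \<in> V" for v
  proof -
    from assms v have "four_modal_vertex L R rot outer v" by (simp add: four_modal_def)
    then obtain k ol or ir il where m: "set ol \<subseteq> {w. (v, w) \<in> L}" "set or \<subseteq> {w. (v, w) \<in> R}"
        "set ir \<subseteq> {w. (w, v) \<in> R}" "set il \<subseteq> {w. (w, v) \<in> L}"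
        "if v = s then rotate k (rot v) = ol @ or \<and> (v, hd (ol @ or)) \<in> outer
         else if v = t then rotate k (rot v) = ir @ il \<and> (v, hd (ir @ il)) \<in> outer
         else rotate k (rot v) = ol @ or @ ir @ il"
      unfolding four_modal_vertex_def graph(8)[OF v] graph(9)[OF v] by blast
    have "ir @ il = []" if "v = s"
    proof -
      have "(w, v) \<notin> E" for w using graph(8)[OF v] that by (simp add: is_source_def)
      then have "set ir = {}" "set il = {}" using m(3,4) by auto
      then show ?thesis by simp
    qed
    moreover have "ol @ or = []" if "v = t"
    proof -
      have "(v, w) \<notin> E" for w using graph(9)[OF v] that by (simp add: is_sink_def)
      then have "set ol = {}" "set or = {}" using m(1,2) by auto
      then show ?thesis by simp
    qed
    ultimately have k: "rotate k (rot v) = (ol @ or) @ (ir @ il)"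
      "v = s \<longrightarrow> (s, hd (ol @ or)) \<in> outer" "v = t \<longrightarrow> (t, hd (ir @ il)) \<in> outer"
      using m(5) graph(7) by (auto split: if_splits)
    \<comment> \<open>4-modality only gives inclusions of the lists in the sets of neighbours.
      Equality follows because the lists exhaust the rotation and no two vertices are joined in both
      directions.\<close>
    have "set (ol @ or) \<union> set (ir @ il) = {w. (v, w) \<in> E \<or> (w, v) \<in> E}"
      using graph(11)[OF v] k(1) by (metis set_append set_rotate)
    moreover have "set (ol @ or) \<subseteq> {w. (v, w) \<in> E}" "set (ir @ il) \<subseteq> {u. (u, v) \<in> E}" using m(1-4) by auto
    ultimately have sets: "set (ol @ or) = {w. (v, w) \<in> E}" "set (ir @ il) = {u. (u, v) \<in> E}"
      using graph(12) by blast+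
    have "sorted_wrt (\<lambda>x y. (v, x) \<in> R \<longrightarrow> (v, y) \<in> R) (ol @ or)"
      unfolding sorted_wrt_append using m(1,2) graph(4) by (auto intro!: sorted_wrt_total)
    moreover have "sorted_wrt (\<lambda>x y. (y, v) \<in> R \<longrightarrow> (x, v) \<in> R) (ir @ il)"
      unfolding sorted_wrt_append using m(3,4) graph(4) by (auto intro!: sorted_wrt_total)
    ultimately show ?thesis using k sets by blast
  qed
  then obtain outs cin where oc: "\<And>v. v \<in> V \<Longrightarrow> (\<exists>k. rotate k (rot v) = outs v @ cin v) \<and>
      set (outs v) = {w. (v, w) \<in> E} \<and> set (cin v) = {u. (u, v) \<in> E} \<and>
      (v = s \<longrightarrow> (s, hd (outs v)) \<in> outer) \<and> (v = t \<longrightarrow> (t, hd (cin v)) \<in> outer) \<and>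
      sorted_wrt (\<lambda>x y. (v, x) \<in> R \<longrightarrow> (v, y) \<in> R) (outs v) \<and> sorted_wrt (\<lambda>x y. (y, v) \<in> R \<longrightarrow> (x, v) \<in> R) (cin v)"
    by metis
  have "bimodal V E s t rot outer outs cin"
    by unfold_locales (use st oc graph(5,6) in blast)+
  moreover have "modal_lists V R outs cin" using oc unfolding modal_lists_def by blast
  ultimately show ?thesis by blast
qed

lemma modal_lists_four_modal:
  assumes b: "bimodal V E s t rot outer outs cin" and m: "modal_lists V R outs cin"
  shows "four_modal V L R rot outer"
  unfolding four_modal_def
proof
  fix v assume v: "v \<in> V"
  interpret bimodal V E s t rot outer outs cin by (rule b)
  obtain k where k: "rotate k (rot v) = outs v @ cin v" using bim[OF v] by blast
  let ?ol = "filter (\<lambda>x. (v, x) \<notin> R) (outs v)" and ?or = "filter (\<lambda>x. \<not> (v, x) \<notin> R) (outs v)"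
  let ?ir = "filter (\<lambda>x. (x, v) \<in> R) (cin v)" and ?il = "filter (\<lambda>x. \<not> (x, v) \<in> R) (cin v)"
  have srt: "sorted_wrt (\<lambda>x y. (v, x) \<in> R \<longrightarrow> (v, y) \<in> R) (outs v)"
    "sorted_wrt (\<lambda>x y. (y, v) \<in> R \<longrightarrow> (x, v) \<in> R) (cin v)" using m v by (auto simp: modal_lists_def)
  have o: "outs v = ?ol @ ?or" by (rule sorted_wrt_filter_split[OF srt(1)]) auto
  have i: "cin v = ?ir @ ?il" by (rule sorted_wrt_filter_split[OF srt(2)]) auto
  have "set ?ol \<subseteq> {w. (v, w) \<in> L}" "set ?or \<subseteq> {w. (v, w) \<in> R}" "set ?ir \<subseteq> {w. (w, v) \<in> R}" "set ?il \<subseteq> {w. (w, v) \<in> L}"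
    using outs_set[OF v] cin_set[OF v] by auto
  moreover have "if is_source E v then rotate k (rot v) = ?ol @ ?or \<and> (v, hd (?ol @ ?or)) \<in> outer
      else if is_sink E v then rotate k (rot v) = ?ir @ ?il \<and> (v, hd (?ir @ ?il)) \<in> outer
      else rotate k (rot v) = ?ol @ ?or @ ?ir @ ?il"
    unfolding graph(8)[OF v] graph(9)[OF v]
    using k cin_Nil[OF v] outs_Nil[OF v] s_dart t_dart
    by (metis append.assoc append_Nil append_Nil2 i o)
  ultimately show "four_modal_vertex L R rot outer v" unfolding four_modal_vertex_def by blast
qed

end

context bimodal
begin

text \<open>The angle condition is read off the valley: the walk arrives backwards along the first
  edge of the left path and leaves along the first edge of the right path.\<close>

lemma bounding_paths:
  assumes f: "f \<in> faces E rot" "f \<noteq> outer"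
  shows "bounding_paths E rot outer f (lp f) (rp f)"
proof -
  obtain d where d: "d \<in> f" "d \<in> valleys" using face_valley[OF f(1)] by blast
  obtain d' where d': "d' \<in> f" "d' \<in> peaks" using face_peak[OF f(1)] by blast
  note l = lp_facts[OF f(1)] and r = rp_facts[OF f(1)]
  have ends: "hd (lp f) = snd d" "hd (rp f) = snd d" "last (lp f) = last (rp f)"
    using l(3)[OF d] r(3)[OF d] l(4)[OF d'] r(4)[OF d'] by auto
  have "f \<subseteq> E \<union> E\<inverse>" using faces_mem[OF f(1)] by (auto simp: darts_def)
  then have fe: "f = path_edges (rp f) \<union> (path_edges (lp f))\<inverse>" unfolding l(2) r(2) by blast
  obtain w v where wv: "d = (w, v)" by (cases d)
  have dd: "d \<in> darts E" using d faces_mem[OF f(1)] by blast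
  have "(v, w) \<in> path_edges (lp f)" unfolding l(2) using d wv by (auto simp: valleys_def)
  moreover have "(v, lp f ! 1) \<in> path_edges (lp f)" "distinct (lp f)"
    using path_edges_nth1[of "lp f"] l(1) ends wv by (auto simp: directed_path_def)
  ultimately have w: "w = lp f ! 1" using path_edges_out by metis
  have "step d \<in> f" using d dd faces_mem[OF f(1)] step_in face_step by auto
  then have "(v, cyc_next (rot v) w) \<in> path_edges (rp f)"
    unfolding r(2) using d wv by (simp add: valleys_def step_pair)
  moreover have "(v, rp f ! 1) \<in> path_edges (rp f)" "distinct (rp f)"
    using path_edges_nth1[of "rp f"] r(1) ends wv by (auto simp: directed_path_def)
  ultimately have "cyc_next (rot v) w = rp f ! 1" using path_edges_out by metis
  then show ?thesis unfolding bounding_paths_def using l(1) r(1) ends fe f(2) w wv by simp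
qed

end

section \<open>The two directions of the equivalence\<close>

context partitioned_st
begin

lemma before_trans: "before \<pi> L v x y \<Longrightarrow> before \<pi> L v y z \<Longrightarrow> before \<pi> L v x z"
  unfolding before_def quadrant_def by (auto split: if_splits)

lemma sufficiency:
  assumes fm: "four_modal V L R rot outer"
    and ni: "\<And>f. f \<in> faces E rot \<Longrightarrow> f \<noteq> outer \<Longrightarrow> \<not> impossible_face L R rot outer f"
  shows "\<exists>\<pi>. upward_book_embedding V L R \<pi> \<and> respects_embedding V L R rot outer \<pi>"
proof -
  obtain outs cin where b: "bimodal V E s t rot outer outs cin" and m: "modal_lists V R outs cin"
    using four_modal_lists[OF fm] by blast
  interpret bimodal V E s t rot outer outs cin by (rule b)
  interpret f: st_faces V E L R s t "\<lambda>v. rev (cin v)" outs lf rf outer lp rp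
    by (rule bimodal_st_faces) (use m graph(4) in \<open>auto simp: modal_lists_def\<close>)
  have "\<not> (path_edges (lp f) \<subseteq> R \<and> length (rp f) \<noteq> 2) \<and> \<not> (path_edges (rp f) \<subseteq> L \<and> length (lp f) \<noteq> 2)"
    if "f \<in> f.inner" for f
  proof -
    have ff: "f \<in> faces E rot" "f \<noteq> outer"
      using that unfolding f.inner_def lf_def rf_def faces_def darts_def by auto
    show ?thesis using ni[OF ff] bounding_paths[OF ff] unfolding impossible_face_def by blast
  qed
  then obtain \<pi> where bij: "bij_betw \<pi> V {1..card V}"
    and o: "ordered_faces V E L R s t (\<lambda>v. rev (cin v)) outs lf rf outer lp rp \<pi>"
    using f.ex_ordered by blast
  interpret o: ordered_faces V E L R s t "\<lambda>v. rev (cin v)" outs lf rf outer lp rp \<pi> by (rule o)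
  \<comment> \<open>The reflected order handles the edges with the outer face on their
    right.\<close>
  interpret mo: ordered_faces V E R L s t "\<lambda>v. rev (rev (cin v))" "\<lambda>v. rev (outs v)" rf lf outer rp lp \<pi>
    by (rule o.ordered_mirror)
  interpret k: book V L R s t \<pi>
  proof
    show "\<exists>u. (u, v) \<in> L \<union> R" if "v \<in> V" "v \<noteq> s" for v
      using cin_set[OF that(1)] cin_Nil[OF that(1)] that(2) by (metis (no_types) ex_in_conv mem_Collect_eq set_empty)
    show "\<exists>w. (v, w) \<in> L \<union> R" if "v \<in> V" "v \<noteq> t" for v
      using outs_set[OF that(1)] outs_Nil[OF that(1)] that(2) by (metis (no_types) ex_in_conv mem_Collect_eq set_empty)
    show "S = L \<or> S = R \<Longrightarrow> (a, b) \<in> S \<Longrightarrow> (c, d) \<in> S \<Longrightarrow> \<pi> a < \<pi> c \<Longrightarrow> \<pi> c < \<pi> b \<Longrightarrow> \<pi> b < \<pi> d \<Longrightarrow> False"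
      for S a b c d using o.no_cross_L o.no_cross_R by blast
  qed (use graph(1,2,4-6) o.pi_mono o.pi_inj in blast)+
  have "upward_book_embedding V L R \<pi>" unfolding upward_book_embedding_def
  proof (intro conjI)
    show "bij_betw \<pi> V {1..card V}" by (rule bij)
    show "\<forall>(u, v) \<in> L \<union> R. \<pi> u < \<pi> v" using o.pi_mono by auto
    show "\<forall>e \<in> L. \<forall>e' \<in> L. \<not> crossing \<pi> e e'" "\<forall>e \<in> R. \<forall>e' \<in> R. \<not> crossing \<pi> e e'"
      unfolding crossing_def using o.no_cross_L o.no_cross_R by (auto; blast)+
  qed
  moreover have "respects_embedding V L R rot outer \<pi>" unfolding respects_embedding_def
  proof (intro conjI ballI)
    fix v assume v: "v \<in> V"
    have nb: "\<pi> x \<noteq> \<pi> v" if "x \<in> set (rot v)" for x using that graph(11)[OF v] o.pi_mono[of x v] o.pi_mono[of v x] by auto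
    \<comment> \<open>The relation \<open>before\<close> starts in the east and turns clockwise, so
      the incoming edges come first; the rotation is shifted accordingly.\<close>
    obtain k where "rotate k (rot v) = outs v @ cin v" using bim[OF v] by blast
    then have k: "rotate (length (outs v) + k) (rot v) = cin v @ outs v"
      by (metis rotate_append rotate_rotate)
    have li: "left_edge L v x \<longleftrightarrow> (x, v) \<in> L" "\<pi> x < \<pi> v" "(x, v) \<in> E" if "x \<in> set (cin v)" for x
      using that cin_set[OF v] k.left_edge_iff'[of x v] k.mono[of x v] by auto
    have lo: "left_edge L v x \<longleftrightarrow> (v, x) \<in> L" "\<pi> v < \<pi> x" "(v, x) \<in> E" if "x \<in> set (outs v)" for x
      using that outs_set[OF v] k.left_edge_iff[of v x] k.mono[of v x] by auto
    have tr: "transp (before \<pi> L v)" using before_trans by (rule transpI)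
    have "successively (before \<pi> L v) (cin v)" unfolding successively_iff_path_edges
    proof clarify
      fix y x assume yx: "(y, x) \<in> path_edges (cin v)"
      then have xy: "(x, y) \<in> path_edges (rev (cin v))" by (simp add: path_edges_rev)
      note mem = path_edges_set[OF yx]
      show "before \<pi> L v y x"
        using li[of x] li[of y] mem f.ins_adj_modal[OF v xy] o.ins_order_L[OF v xy] o.ins_order_R[OF v xy] graph(4)
        unfolding before_def quadrant_def by auto
    qed
    moreover have "successively (before \<pi> L v) (outs v)" unfolding successively_iff_path_edges
    proof clarify
      fix x y assume xy: "(x, y) \<in> path_edges (outs v)"
      note mem = path_edges_set[OF xy]
      show "before \<pi> L v x y"
        using lo[of x] lo[of y] mem f.outs_adj_modal[OF v xy] o.outs_order_L[OF v xy] o.outs_order_R[OF v xy] graph(4)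
        unfolding before_def quadrant_def by auto
    qed
    moreover have "before \<pi> L v x y" if "x \<in> set (cin v)" "y \<in> set (outs v)" for x y
      using li(2)[OF that(1)] lo(2)[OF that(2)] by (auto simp: before_def quadrant_def)
    ultimately have "sorted_wrt (before \<pi> L v) (cin v @ outs v)"
      by (simp add: sorted_wrt_append successively_conv_sorted_wrt[OF tr])
    then show "clockwise_around (spine_point \<pi> v) (edge_arc \<pi> L v) (rot v)"
      using clockwise_around_iff[of "rot v" \<pi> v L] nb k by metis
  next
    fix d assume d: "d \<in> outer"
    then have dd: "d \<in> darts E" "face d = outer" using faces_mem[OF basic(8)] by auto
    obtain u v where uv: "d = (u, v)" by (cases d)
    show "left_region_unbounded V L R \<pi> d"
    proof (cases "(u, v) \<in> E")
      case True
      have l: "lf (u, v) = outer" using dd uv by (simp add: lf_def)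
      show ?thesis unfolding uv
        by (rule k.left_region_up[OF True]) (use o.outer_left_L[OF _ l] o.outer_left_R[OF _ l] in blast)+
    next
      case False
      then have E: "(v, u) \<in> E" using dd uv by (auto simp: darts_def)
      have r: "rf (v, u) = outer" using dd uv by (simp add: rf_def)
      show ?thesis unfolding uv
        by (rule k.left_region_down[OF E]) (use mo.outer_left_L[OF _ r] mo.outer_left_R[OF _ r] in blast)+
    qed
  qed
  ultimately show ?thesis by blast
qed

lemma necessity:
  assumes ube: "upward_book_embedding V L R \<pi>" and re: "respects_embedding V L R rot outer \<pi>"
  shows "four_modal V L R rot outer"
    "\<And>f. f \<in> faces E rot \<Longrightarrow> f \<noteq> outer \<Longrightarrow> \<not> impossible_face L R rot outer f"
proof -
  have mono: "\<pi> u < \<pi> v" if "(u, v) \<in> E" for u v using ube that by (auto simp: upward_book_embedding_def)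
  have inj: "inj_on \<pi> V" using ube by (auto simp: upward_book_embedding_def bij_betw_def)
  have nc: "False" if "S = L \<or> S = R" "(a, b) \<in> S" "(c, d) \<in> S" "\<pi> a < \<pi> c" "\<pi> c < \<pi> b" "\<pi> b < \<pi> d" for S a b c d
  proof -
    have "\<not> crossing \<pi> (a, b) (c, d)" using ube that(1-3) unfolding upward_book_embedding_def by blast
    then show False using that(4-6) by (simp add: crossing_def)
  qed
  interpret k: book V L R s t \<pi>
  proof
    show "\<exists>u. (u, v) \<in> L \<union> R" if "v \<in> V" "v \<noteq> s" for v using graph(8)[OF that(1)] that by (auto simp: is_source_def)
    show "\<exists>w. (v, w) \<in> L \<union> R" if "v \<in> V" "v \<noteq> t" for v using graph(9)[OF that(1)] that by (auto simp: is_sink_def)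
  qed (use graph(1,2,4-6) mono inj nc in blast)+
  have nbr: "\<pi> x < \<pi> v \<and> (x, v) \<in> E \<and> (left_edge L v x \<longleftrightarrow> (x, v) \<in> L) \<or>
      \<pi> v < \<pi> x \<and> (v, x) \<in> E \<and> (left_edge L v x \<longleftrightarrow> (v, x) \<in> L)" if "v \<in> V" "x \<in> set (rot v)" for v x
    using that graph(11)[OF that(1)] mono[of x v] mono[of v x] k.left_edge_iff[of v x] k.left_edge_iff'[of x v] by auto
  have "\<exists>outs cin. (\<exists>k. rotate k (rot v) = outs @ cin) \<and> sorted_wrt (before \<pi> L v) (cin @ outs) \<and>
      set outs = {w. (v, w) \<in> E} \<and> set cin = {u. (u, v) \<in> E}" if v: "v \<in> V" for v
  proof -
    have "clockwise_around (spine_point \<pi> v) (edge_arc \<pi> L v) (rot v)"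
      using re v by (simp add: respects_embedding_def)
    moreover have "\<pi> x \<noteq> \<pi> v" if "x \<in> set (rot v)" for x using nbr[OF v that] by auto
    ultimately obtain k where k: "sorted_wrt (before \<pi> L v) (rotate k (rot v))"
      using clockwise_around_iff[of "rot v" \<pi> v L] by blast
    let ?ys = "rotate k (rot v)"
    \<comment> \<open>Arcs that go down occupy the first two quadrants, so filtering by height
      splits the sorted list into two blocks.\<close>
    define cin where "cin = filter (\<lambda>x. \<pi> x < \<pi> v) ?ys"
    define outs where "outs = filter (\<lambda>x. \<not> \<pi> x < \<pi> v) ?ys"
    have ys: "?ys = cin @ outs" unfolding cin_def outs_def
      by (rule sorted_wrt_filter_split[OF k]) (auto simp: before_def quadrant_def split: if_splits)
    then have "rotate (length cin + k) (rot v) = outs @ cin" by (metis rotate_append rotate_rotate)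
    moreover have "x \<in> set outs \<longleftrightarrow> (v, x) \<in> E" for x
    proof -
      have "x \<in> set outs \<longleftrightarrow> x \<in> set (rot v) \<and> \<not> \<pi> x < \<pi> v" by (auto simp: outs_def)
      then show ?thesis using nbr[OF v, of x] graph(11)[OF v] mono[of v x] by auto
    qed
    then have "set outs = {w. (v, w) \<in> E}" by blast
    moreover have "x \<in> set cin \<longleftrightarrow> (x, v) \<in> E" for x
    proof -
      have "x \<in> set cin \<longleftrightarrow> x \<in> set (rot v) \<and> \<pi> x < \<pi> v" by (auto simp: cin_def)
      then show ?thesis using nbr[OF v, of x] graph(11)[OF v] mono[of x v] by auto
    qed
    then have "set cin = {u. (u, v) \<in> E}" by blast
    ultimately show ?thesis using k ys by metis
  qed
  then obtain outs cin where oc: "\<And>v. v \<in> V \<Longrightarrow> (\<exists>k. rotate k (rot v) = outs v @ cin v) \<and>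
      sorted_wrt (before \<pi> L v) (cin v @ outs v) \<and> set (outs v) = {w. (v, w) \<in> E} \<and> set (cin v) = {u. (u, v) \<in> E}"
    by metis
  have of: "outer \<in> faces E rot" "s \<in> fst ` outer" "t \<in> fst ` outer" using st by (auto simp: plane_st_graph_def)
  have unb: "left_region_unbounded V L R \<pi> d" if "d \<in> outer" for d using re that by (simp add: respects_embedding_def)
  have first: "x = hd xs" if "sorted_wrt (before \<pi> L v) xs" "x \<in> set xs" "\<not> before \<pi> L v (hd xs) x" for v x xs
    using that by (cases xs) auto
  have b: "bimodal V E s t rot outer outs cin"
  proof
    \<comment> \<open>Some dart at \<open>s\<close> is in the outer face. If it were not the first
      outgoing edge, the first one would witness that the region to its left is bounded.\<close>
    obtain x where x: "(s, x) \<in> outer" using of(2) by auto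
    have no: "(u, s) \<notin> E" for u using graph(5,8) by (auto simp: is_source_def)
    have "(s, x) \<in> E" using outer_darts x no by (auto simp: darts_def)
    then have xs: "x \<in> set (outs s)" using oc[OF graph(5)] by auto
    then have "hd (outs s) \<in> set (outs s)" by (intro hd_in_set) auto
    then have "(s, hd (outs s)) \<in> E" using oc[OF graph(5)] by auto
    then have "\<not> before \<pi> L s (hd (outs s)) x" using k.left_region_source \<open>(s, x) \<in> E\<close> unb[OF x] by blast
    then have "x = hd (outs s)" using first[of s, OF _ xs] oc[OF graph(5)] unfolding sorted_wrt_append by blast
    then show "(s, hd (outs s)) \<in> outer" using x by simp
  next
    obtain x where x: "(t, x) \<in> outer" using of(3) by auto
    have no: "(t, u) \<notin> E" for u using graph(6,9) by (auto simp: is_sink_def)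
    have "(x, t) \<in> E" using outer_darts x no by (auto simp: darts_def)
    then have xs: "x \<in> set (cin t)" using oc[OF graph(6)] by auto
    then have "hd (cin t) \<in> set (cin t)" by (intro hd_in_set) auto
    then have "(hd (cin t), t) \<in> E" using oc[OF graph(6)] by auto
    then have "\<not> before \<pi> L t (hd (cin t)) x" using k.left_region_sink \<open>(x, t) \<in> E\<close> unb[OF x] by blast
    then have "x = hd (cin t)" using first[of t, OF _ xs] oc[OF graph(6)] unfolding sorted_wrt_append by blast
    then show "(t, hd (cin t)) \<in> outer" using x by simp
  qed (use st oc in blast)+
  have m: "modal_lists V R outs cin" unfolding modal_lists_def
  proof (intro ballI conjI)
    fix v assume v: "v \<in> V"
    have srt: "sorted_wrt (before \<pi> L v) (cin v)" "sorted_wrt (before \<pi> L v) (outs v)"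
      using oc[OF v] by (auto simp: sorted_wrt_append)
    have sets: "set (outs v) = {w. (v, w) \<in> E}" "set (cin v) = {u. (u, v) \<in> E}" using oc[OF v] by auto
    show "sorted_wrt (\<lambda>x y. (v, x) \<in> R \<longrightarrow> (v, y) \<in> R) (outs v)"
    proof (rule sorted_wrt_mono_rel[OF _ srt(2)])
      fix x y assume xy: "x \<in> set (outs v)" "y \<in> set (outs v)" "before \<pi> L v x y"
      then have "(v, x) \<in> E" "(v, y) \<in> E" using sets by auto
      then show "(v, x) \<in> R \<longrightarrow> (v, y) \<in> R"
        using xy(3) mono[of v x] mono[of v y] k.left_edge_iff[of v x] k.left_edge_iff[of v y] graph(4)
        unfolding before_def quadrant_def by (auto split: if_splits)
    qed
    show "sorted_wrt (\<lambda>x y. (y, v) \<in> R \<longrightarrow> (x, v) \<in> R) (cin v)"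
    proof (rule sorted_wrt_mono_rel[OF _ srt(1)])
      fix x y assume xy: "x \<in> set (cin v)" "y \<in> set (cin v)" "before \<pi> L v x y"
      then have "(x, v) \<in> E" "(y, v) \<in> E" using sets by auto
      then show "(y, v) \<in> R \<longrightarrow> (x, v) \<in> R"
        using xy(3) mono[of x v] mono[of y v] k.left_edge_iff'[of x v] k.left_edge_iff'[of y v] graph(4)
        unfolding before_def quadrant_def by (auto split: if_splits)
    qed
  qed
  show "four_modal V L R rot outer" by (rule modal_lists_four_modal[OF b m])
  interpret bimodal V E s t rot outer outs cin by (rule b)
  interpret f: st_faces V E L R s t "\<lambda>v. rev (cin v)" outs lf rf outer lp rp
    by (rule bimodal_st_faces) (use m graph(4) in \<open>auto simp: modal_lists_def\<close>)
  interpret mf: st_faces V E R L s t "\<lambda>v. rev (rev (cin v))" "\<lambda>v. rev (outs v)" rf lf outer rp lp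
    by (rule f.mirror)
  have ord: "before \<pi> L v x y" if v: "v \<in> V" and xy: "(x, y) \<in> path_edges (outs v)" for v x y
  proof -
    have "sorted_wrt (before \<pi> L v) (outs v)" using oc[OF v] by (auto simp: sorted_wrt_append)
    then have "successively (before \<pi> L v) (outs v)" by (rule successively_if_sorted_wrt)
    then show ?thesis using xy by (auto simp: successively_iff_path_edges)
  qed
  have ordR: "\<pi> x < \<pi> y" if "v \<in> V" "(x, y) \<in> path_edges (outs v)" "(v, x) \<in> R" "(v, y) \<in> R" for v x y
    using ord[OF that(1,2)] that(3,4) mono[of v x] mono[of v y] k.left_edge_iff[of v x] k.left_edge_iff[of v y] graph(4)
    unfolding before_def quadrant_def by (auto split: if_splits)
  have ordL: "\<pi> x < \<pi> y" if "v \<in> V" "(x, y) \<in> path_edges (rev (outs v))" "(v, x) \<in> L" "(v, y) \<in> L" for v x y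
    using ord[OF that(1), of y x] that(2-4) mono[of v x] mono[of v y] k.left_edge_iff[of v x] k.left_edge_iff[of v y] graph(4)
    unfolding before_def quadrant_def by (auto simp: path_edges_rev split: if_splits)
  fix f assume f: "f \<in> faces E rot" "f \<noteq> outer"
  show "\<not> impossible_face L R rot outer f"
  proof
    assume "impossible_face L R rot outer f"
    then obtain l r where lr: "bounding_paths E rot outer f l r"
      and imp: "path_edges l \<subseteq> R \<and> length r \<noteq> 2 \<or> path_edges r \<subseteq> L \<and> length l \<noteq> 2"
      unfolding impossible_face_def by blast
    have p: "directed_path E l" "directed_path E r" "hd l = hd r" "last l = last r"
      "f = path_edges r \<union> (path_edges l)\<inverse>" using lr f(2) unfolding bounding_paths_def by auto
    have pE: "path_edges l \<subseteq> E" "path_edges r \<subseteq> E" using p directed_path_edges by blast+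
    \<comment> \<open>An impossible face is defined through arbitrary bounding paths; their edges
      are determined by \<open>f\<close>, because no edge is also present in reverse.\<close>
    have le: "path_edges l = {e \<in> E. rf e = f}"
    proof (intro subset_antisym subsetI)
      fix e assume e: "e \<in> path_edges l"
      then have "(snd e, fst e) \<in> f" using p(5) by (cases e) auto
      then show "e \<in> {e \<in> E. rf e = f}" using faces_mem[OF f(1)] pE e by (auto simp: rf_def)
    next
      fix e assume "e \<in> {e \<in> E. rf e = f}"
      then have e: "e \<in> E" "rf e = f" by auto
      then have "(snd e, fst e) \<in> f" using faces_mem[OF f(1)] by (cases e) (auto simp: rf_def darts_def)
      moreover have "(snd e, fst e) \<notin> path_edges r" using graph(12)[of "fst e" "snd e"] e pE by auto
      ultimately show "e \<in> path_edges l" using p(5) by auto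
    qed
    have rre: "path_edges r = {e \<in> E. lf e = f}"
    proof (intro subset_antisym subsetI)
      fix e assume e: "e \<in> path_edges r"
      then have "e \<in> f" using p(5) by blast
      then have "face e = f" using faces_mem[OF f(1)] by blast
      then show "e \<in> {e \<in> E. lf e = f}" using pE e by (auto simp: lf_def)
    next
      fix e assume "e \<in> {e \<in> E. lf e = f}"
      then have e: "e \<in> E" "lf e = f" by auto
      then have "e \<in> f" using faces_mem[OF f(1)] by (auto simp: lf_def darts_def)
      moreover have "(snd e, fst e) \<notin> path_edges l" using graph(12)[of "fst e" "snd e"] e pE by auto
      ultimately show "e \<in> path_edges r" using p(5) by (cases e) auto
    qed
    from imp show False
    proof
      assume a: "path_edges l \<subseteq> R \<and> length r \<noteq> 2"
      show False
        by (rule f.impossible_contra[OF f(2) p(1-4) le rre, of \<pi>])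
          (use a mono inj ordR nc[OF disjI2[OF refl]] in blast)+
    next
      assume a: "path_edges r \<subseteq> L \<and> length l \<noteq> 2"
      show False
        by (rule mf.impossible_contra[OF f(2) p(2,1) p(3,4)[symmetric] rre le, of \<pi>])
          (use a mono inj ordL nc[OF disjI1[OF refl]] in blast)+
    qed
  qed
qed

end

theorem theorem3:
  fixes V :: "'a set" and L R :: "'a rel" and s t :: 'a
    and rot :: "'a \<Rightarrow> 'a list" and outer :: "('a \<times> 'a) set"
  assumes "partitioned_digraph V L R"
    and "plane_st_graph V (L \<union> R) s t rot outer"
  shows "(\<exists>\<pi>. upward_book_embedding V L R \<pi> \<and> respects_embedding V L R rot outer \<pi>) \<longleftrightarrow>
    four_modal V L R rot outer \<and>
    (\<forall>f \<in> faces (L \<union> R) rot. f \<noteq> outer \<longrightarrow> \<not> impossible_face L R rot outer f)"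
proof -
  interpret partitioned_st V L R s t rot outer by unfold_locales (fact assms)+
  show ?thesis using sufficiency necessity by blast
qed

end
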